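(* Let $\rho_0,\rho_1\in\mathcal M_+(\bar\Omega)$. Then $$WF_\delta(\rho_0,\rho_1)^2=-\inf_{\varphi\in C^1([0,1]\times\bar\Omega)}J(\varphi),$$ where $$J(\varphi)=\int_0^1\!\!\int_{\Omega}\iota_{B_\delta}\big(\partial_t\varphi,\nabla\varphi,\varphi\big)\,dx\,dt+\int_{\bar\Omega}\varphi(0,\cdot)\,d\rho_0-\int_{\bar\Omega}\varphi(1,\cdot)\,d\rho_1,$$ and the infimum $\inf_{\mu\in\mathcal{CE}_0^1(\rho_0,\rho_1)}D_\delta(\mu)$ defining $WF_\delta(\rho_0,\rho_1)^2$ is attained.
   Context: Let $\Omega\subset\mathbb R^d$ ($d\ge 1$) be a nonempty open bounded convex set with closure $\bar\Omega$, and let $\delta>0$. For compact $X$, $\mathcal M(X)$ denotes the finite signed Radon measures on $X$ (the dual of $C(X)$ with the sup norm) and $\mathcal M_+(X)$ the nonnegative ones. $B_\delta=\{(a,b,c)\in\mathbb R\times\mathbb R^d\times\mathbb R:\ a+\tfrac12(|b|^2+c^2/\delta^2)\le 0\}$, and $\iota_{B_\delta}$ is its convex indicator function ($0$ on $B_\delta$, $+\infty$ elsewhere). Let $f_\delta:\mathbb R\times\mathbb R^d\times\mathbb R\to[0,+\infty]$ be its Fenchel conjugate: $f_\delta(x,y,z)=\frac{|y|^2+\delta^2z^2}{2x}$ if $x>0$, $f_\delta(0,0,0)=0$, and $f_\delta=+\infty$ otherwise. For $\mu=(\rho,\omega,\zeta)\in\mathcal M([0,1]\times\bar\Omega)\times\mathcal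 M([0,1]\times\bar\Omega)^d\times\mathcal M([0,1]\times\bar\Omega)$ set $D_\delta(\mu)=\int_{[0,1]\times\bar\Omega}f_\delta\big(\frac{d\mu}{d\lambda}\big)\,d\lambda$, where $\lambda$ is any nonnegative measure with $|\mu|\ll\lambda$ (the value does not depend on $\lambda$ by homogeneity). For $\rho_0,\rho_1\in\mathcal M_+(\bar\Omega)$, $\mathcal{CE}_0^1(\rho_0,\rho_1)$ is the set of triples $(\rho,\omega,\zeta)\in\mathcal M([0,1]\times\bar\Omega)\times\mathcal M([0,1]\times\bar\Omega)^d\times\mathcal M([0,1]\times\bar\Omega)$ such that for all $\varphi\in C^1([0,1]\times\bar\Omega)$ $$\int\partial_t\varphi\,d\rho+\int\nabla\varphi\cdot d\omega+\int\varphi\,d\zeta=\int_{\bar\Omega}\varphi(1,\cdot)\,d\rho_1-\int_{\bar\Omega}\varphi(0,\cdot)\,d\rho_0 .$$ Finally $WF_\delta(\rho_0,\rho_1)=\big(\inf_{\mu\in\mathcal{CE}_0^1(\rho_0,\rho_1)}D_\delta(\mu)\big)^{1/2}$. *)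

theory Defs
  imports "HOL-Analysis.Analysis"
begin

section \<open>Finite signed measures\<close>

text \<open>
  A finite signed measure on the measurable space \<open>M\<close> is a countably additive real-valued set
  function on \<open>sets M\<close>; its values outside \<open>sets M\<close> are irrelevant.  For the Borel sets of a
  compact subset of a Euclidean space, such set functions are exactly the finite signed Radon
  measures, since every finite Borel measure on it is regular.
\<close>

definition signed_measures :: "'x measure \<Rightarrow> ('x set \<Rightarrow> real) set" where
  "signed_measures M = {\<nu>. \<nu> {} = 0 \<and>
     (\<forall>A. range A \<subseteq> sets M \<longrightarrow> disjoint_family A \<longrightarrow>
        (\<lambda>i::nat. \<nu> (A i)) sums \<nu> (\<Union>i. A i))}"

text \<open>
  The Jordan decomposition: \<open>pos_part\<close> is the upper variation.  Negative values of \<open>\<nu> B\<close> are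
  truncated by \<open>ennreal\<close>, which does not change the supremum because \<open>\<nu> {} = 0\<close>.
\<close>

definition pos_part :: "'x measure \<Rightarrow> ('x set \<Rightarrow> real) \<Rightarrow> 'x measure" where
  "pos_part M \<nu> = measure_of (space M) (sets M)
     (\<lambda>A. SUP B\<in>{B \<in> sets M. B \<subseteq> A}. ennreal (\<nu> B))"

definition neg_part :: "'x measure \<Rightarrow> ('x set \<Rightarrow> real) \<Rightarrow> 'x measure" where
  "neg_part M \<nu> = pos_part M (\<lambda>A. - \<nu> A)"

definition signed_integral :: "'x measure \<Rightarrow> ('x set \<Rightarrow> real) \<Rightarrow> ('x \<Rightarrow> real) \<Rightarrow> real" where
  "signed_integral M \<nu> f = (\<integral>x. f x \<partial>pos_part M \<nu>) - (\<integral>x. f x \<partial>neg_part M \<nu>)"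

definition signed_RN_deriv ::
    "'x measure \<Rightarrow> 'x measure \<Rightarrow> ('x set \<Rightarrow> real) \<Rightarrow> 'x \<Rightarrow> real" where
  "signed_RN_deriv M \<Lambda> \<nu> x =
     enn2real (RN_deriv \<Lambda> (pos_part M \<nu>) x) - enn2real (RN_deriv \<Lambda> (neg_part M \<nu>) x)"

definition total_variation ::
    "'x measure \<Rightarrow> ('x set \<Rightarrow> 'b::real_normed_vector) \<Rightarrow> 'x measure" where
  "total_variation M \<mu> = measure_of (space M) (sets M)
     (\<lambda>A. SUP P\<in>{P. finite P \<and> P \<subseteq> sets M \<and> partition_on A P}. \<Sum>B\<in>P. ennreal (norm (\<mu> B)))"

section \<open>The action functional\<close>

definition B_set :: "real \<Rightarrow> (real \<times> (real^'d) \<times> real) set" where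
  "B_set \<delta> = {(a, b, c). a + 1/2 * ((norm b)\<^sup>2 + c\<^sup>2 / \<delta>\<^sup>2) \<le> 0}"

definition convex_indicator :: "'b set \<Rightarrow> 'b \<Rightarrow> ennreal" where
  "convex_indicator S p = (if p \<in> S then 0 else \<infinity>)"

definition f_delta :: "real \<Rightarrow> real \<times> (real^'d) \<times> real \<Rightarrow> ennreal" where
  "f_delta \<delta> = (\<lambda>(x, y, z).
     if x > 0 then ennreal (((norm y)\<^sup>2 + \<delta>\<^sup>2 * z\<^sup>2) / (2 * x))
     else if x = 0 \<and> y = 0 \<and> z = 0 then 0
     else \<infinity>)"

lemma f_delta_eq_conjugate:
  fixes q :: "real \<times> (real^'d) \<times> real"
  assumes "\<delta> > 0"
  shows "enn2ereal (f_delta \<delta> q) =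
    (SUP p. ereal (p \<bullet> q) - enn2ereal (convex_indicator (B_set \<delta>) p))"
proof -
  define G where "G = (\<lambda>p. ereal (p \<bullet> q) - enn2ereal (convex_indicator (B_set \<delta>) p))"
  have G_in: "G p = ereal (p \<bullet> q)" if "p \<in> B_set \<delta>" for p
    using that by (simp add: G_def convex_indicator_def zero_ennreal.rep_eq)
  have G_out: "G p = -\<infinity>" if "p \<notin> B_set \<delta>" for p
    using that by (simp add: G_def convex_indicator_def)
  obtain x y z where q: "q = (x, y, z)" by (cases q) auto
  have ge: "ereal (p \<bullet> q) \<le> (SUP p. G p)" if "p \<in> B_set \<delta>" for p
    using G_in[OF that] by (metis SUP_upper UNIV_I)
  consider "x > 0" | "x = 0" "y = 0" "z = 0" | "x < 0" | "x = 0" "y \<noteq> 0 \<or> z \<noteq> 0" by linarith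
  then have "enn2ereal (f_delta \<delta> q) = (SUP p. G p)"
  proof cases
    case 1
    let ?v = "((norm y)\<^sup>2 + \<delta>\<^sup>2 * z\<^sup>2) / (2 * x)"
    have v0: "?v \<ge> 0" using 1 by simp
    have f: "enn2ereal (f_delta \<delta> q) = ereal ?v"
      using 1 v0 by (simp add: f_delta_def q enn2ereal_ennreal)
    have up: "G p \<le> ereal ?v" for p
    proof (cases "p \<in> B_set \<delta>")
      case True
      obtain a b c where p: "p = (a, b, c)" by (cases p) auto
      have a: "a \<le> - (1/2) * ((norm b)\<^sup>2 + c\<^sup>2 / \<delta>\<^sup>2)"
        using True by (auto simp: B_set_def p)
      have "0 \<le> (norm (y - x *\<^sub>R b))\<^sup>2" by simp
      then have y: "2 * x * (b \<bullet> y) \<le> (norm y)\<^sup>2 + x\<^sup>2 * (norm b)\<^sup>2"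
        unfolding power2_norm_eq_inner
        by (simp add: inner_diff_left inner_diff_right inner_commute power2_eq_square algebra_simps)
      have "0 \<le> (\<delta> * z - x * c / \<delta>)\<^sup>2" by simp
      then have z: "2 * x * (c * z) \<le> \<delta>\<^sup>2 * z\<^sup>2 + x\<^sup>2 * (c\<^sup>2 / \<delta>\<^sup>2)"
        using assms by (simp add: power2_diff power_mult_distrib power_divide algebra_simps)
      have "x * x * a * 2 \<le> x * x * (- (1/2) * ((norm b)\<^sup>2 + c\<^sup>2 / \<delta>\<^sup>2)) * 2"
        using a 1 by (intro mult_right_mono mult_left_mono) auto
      then have "2 * x * (a * x + b \<bullet> y + c * z) \<le> (norm y)\<^sup>2 + \<delta>\<^sup>2 * z\<^sup>2"
        using y z by (simp add: power2_eq_square algebra_simps)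
      then have "a * x + b \<bullet> y + c * z \<le> ?v"
        using 1 by (simp add: pos_le_divide_eq mult.commute)
      then show ?thesis using G_in[OF True] by (simp add: p q add.assoc)
    qed (simp add: G_out)
    define p where "p = (- (1/2) * ((norm (y /\<^sub>R x))\<^sup>2 + (\<delta>\<^sup>2 * z / x)\<^sup>2 / \<delta>\<^sup>2),
                         y /\<^sub>R x, \<delta>\<^sup>2 * z / x)"
    have pB: "p \<in> B_set \<delta>" by (simp add: p_def B_set_def)
    have "p \<bullet> q = ?v"
      using 1 assms unfolding p_def q
      by (simp add: power2_norm_eq_inner[symmetric] power_mult_distrib power_divide)
         (simp add: field_simps power2_eq_square power4_eq_xxxx)
    then have "ereal ?v \<le> (SUP p. G p)" using ge[OF pB] by simp
    with up show ?thesis unfolding f by (intro antisym SUP_least) auto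
  next
    case 2
    have f: "enn2ereal (f_delta \<delta> q) = 0"
      using 2 by (simp add: f_delta_def q zero_ennreal.rep_eq)
    have up: "G p \<le> 0" for p
      by (cases "p \<in> B_set \<delta>"; cases p) (simp_all add: G_in G_out 2 q)
    have "0 \<in> B_set \<delta>" by (simp add: B_set_def zero_prod_def)
    from ge[OF this] have "0 \<le> (SUP p. G p)" by (simp add: zero_ereal_def)
    with up show ?thesis unfolding f by (intro antisym SUP_least) auto
  next
    case 3
    have f: "enn2ereal (f_delta \<delta> q) = \<infinity>"
      using 3 by (simp add: f_delta_def q)
    have "ereal r \<le> (SUP p. G p)" for r
    proof -
      define p :: "real \<times> (real^'d) \<times> real" where "p = (- \<bar>r\<bar> / \<bar>x\<bar>, 0, 0)"
      have "p \<in> B_set \<delta>" by (simp add: p_def B_set_def)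
      moreover have "p \<bullet> q = \<bar>r\<bar>" using 3 by (simp add: p_def q)
      ultimately have "ereal \<bar>r\<bar> \<le> (SUP p. G p)" using ge by metis
      then show ?thesis by (metis abs_ge_self ereal_less_eq(3) order_trans)
    qed
    then show ?thesis unfolding f by (metis ereal_top)
  next
    case 4
    have f: "enn2ereal (f_delta \<delta> q) = \<infinity>"
      using 4 by (auto simp: f_delta_def q)
    have N: "(norm y)\<^sup>2 + z\<^sup>2 > 0" using 4
      by (metis add_nonneg_pos add_pos_nonneg norm_eq_zero zero_le_power2 zero_less_power2)
    have "ereal r \<le> (SUP p. G p)" for r
    proof -
      define t where "t = r / ((norm y)\<^sup>2 + z\<^sup>2)"
      define p where "p = (- (1/2) * ((norm (t *\<^sub>R y))\<^sup>2 + (t * z)\<^sup>2 / \<delta>\<^sup>2), t *\<^sub>R y, t * z)"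
      have "p \<in> B_set \<delta>" by (simp add: p_def B_set_def)
      moreover have "p \<bullet> q = t * ((norm y)\<^sup>2 + z\<^sup>2)"
        using 4 by (simp add: p_def q dot_square_norm power2_eq_square algebra_simps)
      moreover have "t * ((norm y)\<^sup>2 + z\<^sup>2) = r" using N unfolding t_def by (metis less_irrefl nonzero_divide_eq_eq)
      ultimately show ?thesis using ge by metis
    qed
    then show ?thesis unfolding f by (metis ereal_top)
  qed
  then show ?thesis by (simp add: G_def)
qed

type_synonym 'd spacetime = "real \<times> (real^'d)"

type_synonym 'd triple =
  "('d spacetime set \<Rightarrow> real) \<times> ('d \<Rightarrow> 'd spacetime set \<Rightarrow> real) \<times> ('d spacetime set \<Rightarrow> real)"

definition cyl :: "(real^'d) set \<Rightarrow> 'd spacetime set" where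
  "cyl \<Omega> = {0..1} \<times> closure \<Omega>"

definition cylM :: "(real^'d) set \<Rightarrow> 'd spacetime measure" where
  "cylM \<Omega> = restrict_space borel (cyl \<Omega>)"

definition joint :: "'d::finite triple \<Rightarrow> 'd spacetime set \<Rightarrow> real \<times> (real^'d) \<times> real" where
  "joint = (\<lambda>(\<rho>, \<omega>, \<zeta>) A. (\<rho> A, \<chi> i. \<omega> i A, \<zeta> A))"

definition action_wrt ::
    "real \<Rightarrow> (real^'d) set \<Rightarrow> 'd spacetime measure \<Rightarrow> 'd triple \<Rightarrow> ennreal" where
  "action_wrt \<delta> \<Omega> \<Lambda> = (\<lambda>(\<rho>, \<omega>, \<zeta>).
     \<integral>\<^sup>+ p. f_delta \<delta> (signed_RN_deriv (cylM \<Omega>) \<Lambda> \<rho> p,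
                       \<chi> i. signed_RN_deriv (cylM \<Omega>) \<Lambda> (\<omega> i) p,
                       signed_RN_deriv (cylM \<Omega>) \<Lambda> \<zeta> p) \<partial>\<Lambda>)"

text \<open>
  Since \<open>f_delta \<delta>\<close> is positively homogeneous of degree one, \<open>action_wrt\<close> takes the same value for
  every dominating \<open>\<Lambda>\<close>; the canonical choice is the total variation measure of the triple itself.
\<close>

definition action :: "real \<Rightarrow> (real^'d) set \<Rightarrow> 'd triple \<Rightarrow> ennreal" where
  "action \<delta> \<Omega> \<mu> = action_wrt \<delta> \<Omega> (total_variation (cylM \<Omega>) (joint \<mu>)) \<mu>"

section \<open>Test functions, continuity equation and the distance\<close>

text \<open>
  Differentiability up to the boundary is expressed by derivatives relative to \<open>cyl \<Omega>\<close>.  For an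
  open nonempty convex \<open>\<Omega>\<close>, \<open>cyl \<Omega>\<close> is convex with nonempty interior, so that these derivatives are
  unique and the resulting class is that of the \<open>C\<^sup>1\<close> functions on the interior which extend
  continuously to \<open>cyl \<Omega>\<close> together with their first derivatives.
  Values of test functions outside \<open>cyl \<Omega>\<close> are irrelevant.
\<close>

definition time_deriv :: "(real^'d) set \<Rightarrow> ('d spacetime \<Rightarrow> real) \<Rightarrow> 'd spacetime \<Rightarrow> real" where
  "time_deriv \<Omega> \<phi> p = frechet_derivative \<phi> (at p within cyl \<Omega>) (1, 0)"

definition space_grad ::
    "(real^'d) set \<Rightarrow> ('d spacetime \<Rightarrow> real) \<Rightarrow> 'd spacetime \<Rightarrow> real^'d" where
  "space_grad \<Omega> \<phi> p = (\<chi> i. frechet_derivative \<phi> (at p within cyl \<Omega>) (0, axis i 1))"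

definition C1 :: "(real^'d) set \<Rightarrow> ('d spacetime \<Rightarrow> real) set" where
  "C1 \<Omega> = {\<phi>. \<phi> differentiable_on cyl \<Omega> \<and>
     continuous_on (cyl \<Omega>) (time_deriv \<Omega> \<phi>) \<and> continuous_on (cyl \<Omega>) (space_grad \<Omega> \<phi>)}"

definition CE ::
    "(real^'d) set \<Rightarrow> (real^'d) measure \<Rightarrow> (real^'d) measure \<Rightarrow> 'd::finite triple set" where
  "CE \<Omega> \<rho>0 \<rho>1 = {(\<rho>, \<omega>, \<zeta>).
     \<rho> \<in> signed_measures (cylM \<Omega>) \<and> (\<forall>i. \<omega> i \<in> signed_measures (cylM \<Omega>)) \<and>
     \<zeta> \<in> signed_measures (cylM \<Omega>) \<and>
     (\<forall>\<phi>\<in>C1 \<Omega>.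
        signed_integral (cylM \<Omega>) \<rho> (time_deriv \<Omega> \<phi>)
        + (\<Sum>i\<in>UNIV. signed_integral (cylM \<Omega>) (\<omega> i) (\<lambda>p. space_grad \<Omega> \<phi> p $ i))
        + signed_integral (cylM \<Omega>) \<zeta> \<phi>
        = (\<integral>x. \<phi> (1, x) \<partial>\<rho>1) - (\<integral>x. \<phi> (0, x) \<partial>\<rho>0))}"

definition ennreal_sqrt :: "ennreal \<Rightarrow> ennreal" where
  "ennreal_sqrt x = (if x = \<infinity> then \<infinity> else ennreal (sqrt (enn2real x)))"

lemma ennreal_sqrt_power2: "(ennreal_sqrt x)\<^sup>2 = x"
proof (cases x)
  case (real r)
  then show ?thesis
    by (simp add: ennreal_sqrt_def ennreal_power)
qed (simp add: ennreal_sqrt_def power2_eq_square ennreal_top_mult)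

definition WF ::
    "real \<Rightarrow> (real^'d) set \<Rightarrow> (real^'d) measure \<Rightarrow> (real^'d) measure \<Rightarrow> ennreal" where
  "WF \<delta> \<Omega> \<rho>0 \<rho>1 = ennreal_sqrt (INF \<mu>\<in>CE \<Omega> \<rho>0 \<rho>1. action \<delta> \<Omega> \<mu>)"

definition J ::
    "real \<Rightarrow> (real^'d) set \<Rightarrow> (real^'d) measure \<Rightarrow> (real^'d) measure
      \<Rightarrow> ('d spacetime \<Rightarrow> real) \<Rightarrow> ereal" where
  "J \<delta> \<Omega> \<rho>0 \<rho>1 \<phi> =
     enn2ereal (\<integral>\<^sup>+ t\<in>{0..1}. (\<integral>\<^sup>+ x\<in>\<Omega>.
        convex_indicator (B_set \<delta>) (time_deriv \<Omega> \<phi> (t, x), space_grad \<Omega> \<phi> (t, x), \<phi> (t, x))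
        \<partial>lborel) \<partial>lborel)
     + ereal (\<integral>x. \<phi> (0, x) \<partial>\<rho>0) - ereal (\<integral>x. \<phi> (1, x) \<partial>\<rho>1)"

end

theory Submission
  imports Defs "HOL-Probability.Discrete_Topology"
begin

text \<open>
  The action is a support functional.  Since \<open>f_delta \<delta>\<close> is the convex conjugate of the indicator of
  \<open>B_set \<delta>\<close>, pairing a triple \<open>(\<rho>, \<omega>, \<zeta>)\<close> with a field whose values lie in \<open>B_set \<delta>\<close> never exceeds
  the action of the triple.  Applied to the field \<open>(\<partial>\<^sub>t \<phi>, \<nabla>\<phi>, \<phi>)\<close> of a test function, this and the
  continuity equation bound \<open>L \<phi> = \<integral>\<phi>(1, \<cdot>) d\<rho>1 - \<integral>\<phi>(0, \<cdot>) d\<rho>0\<close> by the action of every competitor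
  (\<open>weak_duality\<close>).  The functional \<open>J\<close> is \<open>- L\<close> on the admissible test functions, those whose field
  lies in \<open>B_set \<delta>\<close> everywhere on the closed cylinder, and is infinite elsewhere: a violation at one
  point persists on an open set by continuity (\<open>J_admissible\<close>, \<open>J_not_admissible\<close>).  So one inequality
  between the two extremal values is immediate.

  For the other inequality and for attainment, let \<open>S\<close> be the supremum of \<open>L\<close> over the admissible test
  functions.  It is finite, because in time direction an admissible function satisfies the Riccati
  inequality \<open>\<phi>' \<le> - \<phi>\<^sup>2 / (2 \<delta>\<^sup>2)\<close>, whose solutions blow up too early unless \<open>\<phi>(1, \<cdot>) \<le> 2 \<delta>\<^sup>2\<close> and
  \<open>\<phi>(0, \<cdot>) \<ge> - 2 \<delta>\<^sup>2\<close>.  On the linear space of fields of test functions, \<open>L\<close> is a linear functional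
  bounded by \<open>S\<close> on the convex set of fields with values in \<open>B_set \<delta>\<close>, and the field of
  \<open>(t, x) \<mapsto> - \<epsilon> t\<close> is an interior point of that set.  The geometric Hahn-Banach theorem
  (\<open>bounded_function_extension\<close>) extends \<open>L\<close> to all bounded fields with the same bound.

  The extension is represented by measures (\<open>triple_of_functional\<close>).  Its first component is a
  positive functional, since \<open>B_set \<delta>\<close> is stable under decreasing the first coordinate; each of the
  others is bounded on the unit ball and is a difference of two positive functionals.  Because the
  functionals are defined on all bounded functions, indicator functions included, the Riesz
  representation needs no extension of premeasures (\<open>positive_functional.riesz_representation\<close>).
  The resulting triple satisfies the continuity equation, as the functional extends \<open>L\<close>.  Its pairings
  with continuous fields with values in \<open>B_set \<delta>\<close> are at most \<open>S\<close>, and since these fields approximate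
  bounded measurable ones almost everywhere, its action is at most \<open>S\<close> (\<open>action_le\<close>).  Hence all
  inequalities are equalities and this triple is a minimiser.
\<close>

section \<open>Linear functionals below a convex constraint\<close>

definition sublinear :: "('v::real_vector \<Rightarrow> real) \<Rightarrow> bool" where
  "sublinear p \<longleftrightarrow> (\<forall>x y. p (x + y) \<le> p x + p y) \<and> (\<forall>c>0. \<forall>x. p (c *\<^sub>R x) = c * p x)"

lemma sublinear_zero: assumes "sublinear p" shows "p 0 = 0"
proof -
  have "p ((2::real) *\<^sub>R 0) = 2 * p 0" using assms unfolding sublinear_def by (metis zero_less_numeral)
  then show ?thesis by simp
qed

lemma sublinear_neg_le:
  assumes "sublinear p" shows "- p (- x) \<le> p x"
proof -
  have "p (x + - x) \<le> p x + p (- x)" using assms unfolding sublinear_def by blast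
  then show ?thesis using sublinear_zero[OF assms] by simp
qed

text \<open>
  All sublinear functionals below are infima of families of bounds.
\<close>

lemma sublinear_INF:
  fixes h :: "'v::real_vector \<Rightarrow> 'z \<Rightarrow> real"
  assumes ne: "\<And>x. A x \<noteq> {}" and bdd: "\<And>x. bdd_below (h x ` A x)"
    and add: "\<And>x y z z'. z \<in> A x \<Longrightarrow> z' \<in> A y \<Longrightarrow> \<exists>w\<in>A (x + y). h (x + y) w \<le> h x z + h y z'"
    and scale: "\<And>c x z. c > 0 \<Longrightarrow> z \<in> A x \<Longrightarrow> \<exists>w\<in>A (c *\<^sub>R x). h (c *\<^sub>R x) w \<le> c * h x z"
  shows "sublinear (\<lambda>x. INF z\<in>A x. h x z)"
proof -
  define q where "q x = (INF z\<in>A x. h x z)" for x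
  have qle: "q x \<le> h x z" if "z \<in> A x" for x z
    unfolding q_def by (rule cINF_lower[OF bdd that])
  have qge: "r \<le> q x" if "\<And>z. z \<in> A x \<Longrightarrow> r \<le> h x z" for r x
    unfolding q_def by (rule cINF_greatest[OF ne that])
  have sub: "q (x + y) \<le> q x + q y" for x y
  proof -
    have "q (x + y) - h y z' \<le> q x" if z': "z' \<in> A y" for z'
    proof (rule qge)
      fix z assume "z \<in> A x"
      then obtain w where w: "w \<in> A (x + y)" "h (x + y) w \<le> h x z + h y z'" using add z' by blast
      then show "q (x + y) - h y z' \<le> h x z" using qle[OF w(1)] by simp
    qed
    then have "q (x + y) - q x \<le> q y" by (intro qge) (simp add: algebra_simps)
    then show ?thesis by simp
  qed
  have scale_le: "q (c *\<^sub>R x) \<le> c * q x" if c: "c > 0" for c x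
  proof -
    have "q (c *\<^sub>R x) / c \<le> q x"
    proof (rule qge)
      fix z assume "z \<in> A x"
      then obtain w where w: "w \<in> A (c *\<^sub>R x)" "h (c *\<^sub>R x) w \<le> c * h x z" using scale c by blast
      then show "q (c *\<^sub>R x) / c \<le> h x z" using qle[OF w(1)] c by (simp add: field_simps)
    qed
    then show ?thesis using c by (simp add: field_simps)
  qed
  have "q (c *\<^sub>R x) = c * q x" if c: "c > 0" for c x
    using scale_le[OF c, of x] scale_le[of "1 / c" "c *\<^sub>R x"] c by (simp add: field_simps)
  with sub show ?thesis unfolding sublinear_def q_def by blast
qed

text \<open>
  Adding a multiple of a direction \<open>y\<close> and paying for it with \<open>p y\<close> gives the sublinear functional
  \<open>q x = (INF t\<ge>0. p (x + t y) - t p y)\<close> below \<open>p\<close>.  Minimality forces \<open>q = p\<close>, and \<open>t = 1\<close> turns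
  subadditivity of \<open>p\<close> into additivity.
\<close>

lemma minimal_sublinear_linear:
  assumes p: "sublinear p" and min: "\<And>q. sublinear q \<Longrightarrow> q \<le> p \<Longrightarrow> q = p"
  shows "linear p"
proof -
  have sub: "p (x + y) \<le> p x + p y" and hom: "c > 0 \<Longrightarrow> p (c *\<^sub>R x) = c * p x" for x y c
    using p unfolding sublinear_def by auto
  have hom0: "p (c *\<^sub>R x) = c * p x" if "c \<ge> 0" for c x
    using that hom sublinear_zero[OF p] by (cases "c = 0") auto
  have add: "p (x + y) = p x + p y" for x y
  proof -
    define h where "h x t = p (x + t *\<^sub>R y) - t * p y" for x t
    define q where "q x = (INF t\<in>{0..}. h x t)" for x
    have bdd: "bdd_below (h x ` {0..})" for x
    proof (rule bdd_belowI2)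
      fix t :: real assume t: "t \<in> {0..}"
      show "- p (- x) \<le> h x t"
        using sub[of "x + t *\<^sub>R y" "- x"] hom0[of t y] t by (simp add: h_def)
    qed
    have qle: "q x \<le> h x t" if "t \<ge> 0" for x t
      unfolding q_def by (rule cINF_lower[OF bdd]) (use that in auto)
    have "sublinear q"
      unfolding q_def[abs_def]
    proof (rule sublinear_INF[OF _ bdd])
      fix x x' and t t' :: real assume t: "t \<in> {0..}" "t' \<in> {0..}"
      have "h (x + x') (t + t') \<le> h x t + h x' t'"
        using sub[of "x + t *\<^sub>R y" "x' + t' *\<^sub>R y"] by (simp add: h_def algebra_simps)
      then show "\<exists>s\<in>{0..}. h (x + x') s \<le> h x t + h x' t'" using t by (intro bexI[of _ "t + t'"]) auto
    next
      fix c t :: real and x assume c: "c > 0" and t: "t \<in> {0..}"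
      have "h (c *\<^sub>R x) (c * t) = c * h x t"
        using hom[OF c, of "x + t *\<^sub>R y"] by (simp add: h_def algebra_simps)
      then show "\<exists>s\<in>{0..}. h (c *\<^sub>R x) s \<le> c * h x t" using c t by (intro bexI[of _ "c * t"]) auto
    qed auto
    moreover have "q \<le> p" using qle[of 0] by (auto simp: le_fun_def h_def)
    ultimately have "q = p" by (rule min)
    then show ?thesis using qle[of 1 x] sub[of x y] by (simp add: h_def)
  qed
  have neg: "p (- x) = - p x" for x using add[of x "- x"] sublinear_zero[OF p] by simp
  show ?thesis
  proof (rule linearI)
    show "p (c *\<^sub>R x) = c *\<^sub>R p x" for c x
      using hom0[of c x] hom0[of "-c" x] neg[of "c *\<^sub>R x"] by (cases "c \<ge> 0") auto
  qed (rule add)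
qed

text \<open>
  Working with minimal sublinear functionals makes Zorn's lemma apply to functionals defined on the
  whole space, so that no domains of partial extensions have to be compared.  Pointwise infima of
  chains stay finite because \<open>q \<le> p\<close> implies \<open>- p (- x) \<le> q x\<close>.
\<close>

lemma linear_below_sublinear:
  assumes p: "sublinear p"
  shows "\<exists>l. linear l \<and> (\<forall>x. l x \<le> p x)"
proof -
  define S where "S = {q. sublinear q \<and> q \<le> p}"
  define P where "P = (\<lambda>a b. b \<le> (a :: 'a \<Rightarrow> real))"
  have po: "partial_order_on S (relation_of P S)"
    unfolding P_def by (rule partial_order_on_relation_ofI) auto
  have "\<exists>m\<in>S. \<forall>a\<in>S. P m a \<longrightarrow> a = m"
  proof (rule predicate_Zorn[OF po])
    fix C assume C: "C \<in> Chains (relation_of P S)"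
    have CS: "C \<subseteq> S" and tot: "\<And>a b. a \<in> C \<Longrightarrow> b \<in> C \<Longrightarrow> a \<le> b \<or> b \<le> a"
      using C by (auto simp: Chains_def relation_of_def P_def)
    show "\<exists>u\<in>S. \<forall>a\<in>C. P a u"
    proof (cases "C = {}")
      case True
      then show ?thesis using p by (auto simp: S_def)
    next
      case False
      define u where "u x = (INF q\<in>C. q x)" for x
      have lin: "sublinear q" "q \<le> p" if "q \<in> C" for q using that CS by (auto simp: S_def)
      have bdd: "bdd_below ((\<lambda>q. q x) ` C)" for x
      proof (rule bdd_belowI2)
        fix q assume q: "q \<in> C"
        have "- p (- x) \<le> - q (- x)" using lin(2)[OF q] by (auto simp: le_fun_def)
        also have "\<dots> \<le> q x" by (rule sublinear_neg_le[OF lin(1)[OF q]])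
        finally show "- p (- x) \<le> q x" .
      qed
      have ule: "u x \<le> q x" if "q \<in> C" for x q
        unfolding u_def by (rule cINF_lower[OF bdd that])
      have "sublinear u"
        unfolding u_def[abs_def]
      proof (rule sublinear_INF[OF False bdd])
        fix x y q q' assume q: "q \<in> C" "q' \<in> C"
        obtain r where r: "r \<in> C" "r \<le> q" "r \<le> q'" using tot[OF q] q by auto
        have "r (x + y) \<le> r x + r y" using lin(1)[OF r(1)] by (auto simp: sublinear_def)
        also have "\<dots> \<le> q x + q' y" using r by (intro add_mono) (auto simp: le_fun_def)
        finally show "\<exists>r\<in>C. r (x + y) \<le> q x + q' y" using r(1) by blast
      next
        fix c :: real and x q assume "c > 0" "q \<in> C"
        then show "\<exists>r\<in>C. r (c *\<^sub>R x) \<le> c * q x" using lin(1) by (auto simp: sublinear_def)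
      qed
      moreover obtain q where "q \<in> C" using False by auto
      then have "u \<le> p" using ule lin(2) by (fastforce simp: le_fun_def intro: order_trans)
      ultimately show ?thesis using ule by (auto simp: S_def P_def le_fun_def)
    qed
  qed
  then obtain m where m: "m \<in> S" "\<And>a. a \<in> S \<Longrightarrow> a \<le> m \<Longrightarrow> a = m" by (auto simp: P_def)
  have "linear m" by (rule minimal_sublinear_linear) (use m in \<open>auto simp: S_def\<close>)
  then show ?thesis using m(1) by (auto simp: S_def le_fun_def)
qed

text \<open>
  Geometric Hahn-Banach theorem.  The inequalities wanted for an extension \<open>l\<close>, namely \<open>l \<le> S\<close> on \<open>C\<close>
  and \<open>l = L\<close> on \<open>V\<close>, force \<open>l x \<le> t S - L w\<close> whenever \<open>x + w \<in> t C\<close> with \<open>w \<in> V\<close>.  The infimum of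
  these bounds is sublinear, and any linear functional below it does what is wanted.  The point
  \<open>v0\<close> makes the set of bounds nonempty.
\<close>

lemma linear_extension_bounded_on_convex:
  fixes L :: "'v::real_vector \<Rightarrow> real"
  assumes V: "subspace V"
    and L_add: "\<And>x y. x \<in> V \<Longrightarrow> y \<in> V \<Longrightarrow> L (x + y) = L x + L y"
    and L_scale: "\<And>c x. x \<in> V \<Longrightarrow> L (c *\<^sub>R x) = c * L x"
    and C: "convex C"
    and v0: "v0 \<in> V" and core: "\<And>x. \<exists>e>0. v0 + e *\<^sub>R x \<in> C"
    and S: "\<And>x. x \<in> V \<Longrightarrow> x \<in> C \<Longrightarrow> L x \<le> S"
  shows "\<exists>l. linear l \<and> (\<forall>x\<in>V. l x = L x) \<and> (\<forall>x\<in>C. l x \<le> S)"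
proof -
  \<comment> \<open>\<open>A x\<close> collects the pairs \<open>(t, w)\<close> that yield a bound for the value at \<open>x\<close>.\<close>
  define A where "A x = {(t, w). t > 0 \<and> w \<in> V \<and> (1/t) *\<^sub>R (x + w) \<in> C}" for x
  have A_add: "(t + t', w + w') \<in> A (x + x')" if "(t, w) \<in> A x" "(t', w') \<in> A x'" for t t' w w' x x'
  proof -
    have t: "t > 0" "t' > 0" using that by (auto simp: A_def)
    have "(t / (t + t')) *\<^sub>R ((1/t) *\<^sub>R (x + w)) + (t' / (t + t')) *\<^sub>R ((1/t') *\<^sub>R (x' + w')) \<in> C"
      by (rule convexD[OF C]) (use that t in \<open>auto simp: A_def add_divide_distrib[symmetric]\<close>)
    also have "(t / (t + t')) *\<^sub>R ((1/t) *\<^sub>R (x + w)) + (t' / (t + t')) *\<^sub>R ((1/t') *\<^sub>R (x' + w'))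
        = (1/(t+t')) *\<^sub>R ((x + x') + (w + w'))"
      using t by (simp add: algebra_simps)
    finally show ?thesis using that subspace_add[OF V] by (auto simp: A_def)
  qed
  have A_scale: "(c * t, c *\<^sub>R w) \<in> A (c *\<^sub>R x)" if "(t, w) \<in> A x" "c > 0" for c t w x
  proof -
    have "(1 / (c * t)) *\<^sub>R (c *\<^sub>R x + c *\<^sub>R w) = (1/t) *\<^sub>R (x + w)"
      using that by (simp add: algebra_simps)
    then show ?thesis using that subspace_scale[OF V] by (auto simp: A_def)
  qed
  have A_ne: "A x \<noteq> {}" for x
  proof -
    obtain e where e: "e > 0" "v0 + e *\<^sub>R x \<in> C" using core by blast
    have "(1/(1/e)) *\<^sub>R (x + (1/e) *\<^sub>R v0) = v0 + e *\<^sub>R x" using e by (simp add: algebra_simps)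
    then have "(1/e, (1/e) *\<^sub>R v0) \<in> A x" using e subspace_scale[OF V v0] by (simp add: A_def)
    then show ?thesis by auto
  qed
  define h where "h = (\<lambda>(t, w). t * S - L w)"
  have h_add: "h (t + t', w + w') = h (t, w) + h (t', w')" if "w \<in> V" "w' \<in> V" for t t' w w'
    using L_add[OF that] by (simp add: h_def algebra_simps)
  have h0: "0 \<le> h (t, w)" if "(t, w) \<in> A 0" for t w
  proof -
    have t: "t > 0" "w \<in> V" "(1/t) *\<^sub>R w \<in> C" using that by (auto simp: A_def)
    have "L ((1/t) *\<^sub>R w) \<le> S" using t subspace_scale[OF V] by (intro S) auto
    then show ?thesis using t L_scale[of w "1/t"] by (simp add: h_def field_simps)
  qed
  define q where "q x = (INF z\<in>A x. h z)" for x
  have bdd: "bdd_below (h ` A x)" for x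
  proof -
    obtain t' w' where z': "(t', w') \<in> A (- x)" using A_ne by fast
    show ?thesis
    proof (rule bdd_belowI2)
      fix z assume z: "z \<in> A x"
      obtain t w where zz: "z = (t, w)" by (cases z) auto
      have "w \<in> V" "w' \<in> V" using z z' by (auto simp: A_def zz)
      then show "- h (t', w') \<le> h z"
        using h0[of "t + t'" "w + w'"] A_add[OF z[unfolded zz] z'] h_add[of w w' t t'] by (simp add: zz)
    qed
  qed
  have qle: "q x \<le> h z" if "z \<in> A x" for x z
    unfolding q_def by (rule cINF_lower[OF bdd that])
  have "sublinear q"
    unfolding q_def[abs_def]
  proof (rule sublinear_INF[OF A_ne bdd])
    fix x y z z' assume z: "z \<in> A x" "z' \<in> A y"
    obtain t w t' w' where zz: "z = (t, w)" "z' = (t', w')" by (cases z, cases z') auto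
    have "h (t + t', w + w') = h z + h z'" unfolding zz using z zz by (intro h_add) (auto simp: A_def)
    then show "\<exists>z''\<in>A (x + y). h z'' \<le> h z + h z'" using A_add z zz by force
  next
    fix c :: real and x z assume c: "c > 0" and z: "z \<in> A x"
    obtain t w where zz: "z = (t, w)" by (cases z) auto
    have "h (c * t, c *\<^sub>R w) = c * h z" using z L_scale by (auto simp: zz h_def A_def algebra_simps)
    then show "\<exists>z'\<in>A (c *\<^sub>R x). h z' \<le> c * h z" using A_scale z zz c by force
  qed
  then obtain l where l: "linear l" "\<And>x. l x \<le> q x" using linear_below_sublinear by blast
  have v0C: "v0 \<in> C" using core[of 0] by auto
  have lC: "l x \<le> S" if "x \<in> C" for x
  proof -
    have "(1, 0) \<in> A x" using that subspace_0[OF V] by (auto simp: A_def)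
    from qle[OF this] have "q x \<le> S" using L_scale[OF v0, of 0] by (simp add: h_def)
    then show ?thesis using l(2)[of x] by simp
  qed
  have lV: "l v \<le> L v" if v: "v \<in> V" for v
  proof (rule field_le_epsilon)
    fix e :: real assume e: "e > 0"
    \<comment> \<open>Testing with \<open>w = t v0 - v\<close> gives the bound \<open>L v + t (S - L v0)\<close>; now let \<open>t\<close> tend to 0.\<close>
    have s: "S - L v0 \<ge> 0" using S[OF v0 v0C] by simp
    define t where "t = e / (S - L v0 + 1)"
    have t: "t > 0" using e s by (auto simp: t_def)
    have w: "t *\<^sub>R v0 + (-1) *\<^sub>R v \<in> V"
      using v v0 V by (intro subspace_add subspace_scale) auto
    have "(t, t *\<^sub>R v0 + (-1) *\<^sub>R v) \<in> A v" using t w v0C by (auto simp: A_def)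
    from qle[OF this] have "q v \<le> t * S - L (t *\<^sub>R v0 + (-1) *\<^sub>R v)" by (simp add: h_def)
    also have "L (t *\<^sub>R v0 + (-1) *\<^sub>R v) = t * L v0 + (-1) * L v"
      using v v0 V L_scale[OF v0, of t] L_scale[OF v, of "-1"]
        L_add[of "t *\<^sub>R v0" "(-1) *\<^sub>R v"] subspace_scale[OF V] by metis
    finally have "q v \<le> L v + t * (S - L v0)" by (simp add: algebra_simps)
    also have "t * (S - L v0) \<le> e"
      using e s mult_left_le[of "(S - L v0) / (S - L v0 + 1)" e] by (simp add: t_def)
    finally show "l v \<le> L v + e" using l(2)[of v] by simp
  qed
  have "l v = L v" if v: "v \<in> V" for v
  proof (rule antisym)
    have "l ((-1) *\<^sub>R v) \<le> L ((-1) *\<^sub>R v)" by (rule lV) (use v subspace_scale[OF V] in blast)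
    then show "L v \<le> l v" using L_scale[OF v, of "-1"] linear_neg[OF l(1), of v] by simp
  qed (rule lV[OF v])
  then show ?thesis using l lC by blast
qed

lemma bounded_range_scaleR:
  fixes f :: "'a \<Rightarrow> 'b::real_normed_vector"
  shows "bounded (range f) \<Longrightarrow> bounded (range (\<lambda>x. c *\<^sub>R f x))"
  using bounded_scaling[of "range f" c] by (simp add: image_image)

lemma bounded_range_normD: "bounded (range f) \<Longrightarrow> \<exists>B. \<forall>x. norm (f x) \<le> B"
  by (auto simp: bounded_iff)

lemma bounded_range_scaleR_const:
  fixes e :: "'b::real_normed_vector"
  assumes "bounded (range f)" shows "bounded (range (\<lambda>x. f x *\<^sub>R e))"
proof -
  obtain B where B: "\<forall>x. \<bar>f x\<bar> \<le> B" using bounded_range_normD[OF assms] by auto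
  show ?thesis unfolding bounded_iff
    by (rule exI[of _ "B * norm e"]) (use B in \<open>auto intro!: mult_right_mono\<close>)
qed

definition linear_on_bounded :: "(('a \<Rightarrow> 'b::real_normed_vector) \<Rightarrow> real) \<Rightarrow> bool" where
  "linear_on_bounded l \<longleftrightarrow>
     (\<forall>f g. bounded (range f) \<longrightarrow> bounded (range g) \<longrightarrow> l (\<lambda>x. f x + g x) = l f + l g) \<and>
     (\<forall>c f. bounded (range f) \<longrightarrow> l (\<lambda>x. c *\<^sub>R f x) = c * l f)"

lemma linear_on_bounded_add:
  "linear_on_bounded l \<Longrightarrow> bounded (range f) \<Longrightarrow> bounded (range g) \<Longrightarrow> l (\<lambda>x. f x + g x) = l f + l g"
  by (simp add: linear_on_bounded_def)

lemma linear_on_bounded_scale: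
  "linear_on_bounded l \<Longrightarrow> bounded (range f) \<Longrightarrow> l (\<lambda>x. c *\<^sub>R f x) = c * l f"
  by (simp add: linear_on_bounded_def)

lemma linear_on_bounded_along:
  assumes l: "linear_on_bounded l"
  shows "linear_on_bounded (\<lambda>f. l (\<lambda>x. f x *\<^sub>R e))"
  unfolding linear_on_bounded_def
  using linear_on_bounded_add[OF l bounded_range_scaleR_const bounded_range_scaleR_const]
    linear_on_bounded_scale[OF l bounded_range_scaleR_const]
  by (simp add: scaleR_add_left)

text \<open>
  The same theorem for the space of all bounded functions, which is the space of bounded continuous
  functions on the domain with the discrete topology.  The constraint only concerns the values on
  \<open>K\<close>.
\<close>

lemma bounded_function_extension:
  fixes L :: "('a \<Rightarrow> 'b::real_normed_vector) \<Rightarrow> real"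
  assumes V_zero: "(\<lambda>_. 0) \<in> V"
    and V_bdd: "\<And>f. f \<in> V \<Longrightarrow> bounded (range f)"
    and V_add: "\<And>f g. f \<in> V \<Longrightarrow> g \<in> V \<Longrightarrow> (\<lambda>x. f x + g x) \<in> V"
    and V_scale: "\<And>c f. f \<in> V \<Longrightarrow> (\<lambda>x. c *\<^sub>R f x) \<in> V"
    and L_add: "\<And>f g. f \<in> V \<Longrightarrow> g \<in> V \<Longrightarrow> L (\<lambda>x. f x + g x) = L f + L g"
    and L_scale: "\<And>c f. f \<in> V \<Longrightarrow> L (\<lambda>x. c *\<^sub>R f x) = c * L f"
    and C: "convex C"
    and v0: "v0 \<in> V" and r: "r > 0"
    and core: "\<And>f x. (\<forall>y\<in>K. norm (f y - v0 y) \<le> r) \<Longrightarrow> x \<in> K \<Longrightarrow> f x \<in> C"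
    and S: "\<And>f. f \<in> V \<Longrightarrow> \<forall>x\<in>K. f x \<in> C \<Longrightarrow> L f \<le> S"
  shows "\<exists>l. linear_on_bounded l \<and> (\<forall>f\<in>V. l f = L f)
    \<and> (\<forall>f. bounded (range f) \<longrightarrow> (\<forall>x\<in>K. f x \<in> C) \<longrightarrow> l f \<le> S)"
proof -
  define ap :: "('a discrete \<Rightarrow>\<^sub>C 'b) \<Rightarrow> 'a \<Rightarrow> 'b" where "ap F = (\<lambda>x. apply_bcontfun F (discrete x))" for F
  define em :: "('a \<Rightarrow> 'b) \<Rightarrow> ('a discrete \<Rightarrow>\<^sub>C 'b)" where "em f = Bcontfun (\<lambda>x. f (of_discrete x))" for f
  have cont: "continuous_on UNIV (g :: 'a discrete \<Rightarrow> 'b)" for g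
    by (simp add: continuous_on_open_vimage open_discrete)
  have bd: "bounded (range (ap F))" for F
    by (rule bounded_subset[OF bounded_apply_bcontfun[of F]]) (auto simp: ap_def)
  have apem: "ap (em f) = f" if "bounded (range f)" for f
  proof -
    have "(\<lambda>x. f (of_discrete x)) \<in> bcontfun"
      unfolding bcontfun_def using cont bounded_subset[OF that, of "range (\<lambda>x. f (of_discrete x))"] by auto
    then show ?thesis unfolding ap_def em_def by (simp add: Bcontfun_inverse discrete_inverse)
  qed
  have apinj: "F = G" if "ap F = ap G" for F G
    by (rule bcontfun_eqI) (metis ap_def of_discrete_inverse that)
  have ap_add: "ap (F + G) = (\<lambda>x. ap F x + ap G x)" and ap_scale: "ap (c *\<^sub>R F) = (\<lambda>x. c *\<^sub>R ap F x)"
    and ap_0: "ap 0 = (\<lambda>_. 0)" for F G c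
    by (auto simp: ap_def plus_bcontfun.rep_eq scaleR_bcontfun.rep_eq)
  have em_add: "em (\<lambda>x. f x + g x) = em f + em g" if "bounded (range f)" "bounded (range g)" for f g
    by (rule apinj) (simp add: ap_add apem that bounded_plus_comp)
  have em_scale: "em (\<lambda>x. c *\<^sub>R f x) = c *\<^sub>R em f" if "bounded (range f)" for f c
    by (rule apinj) (simp add: ap_scale apem that bounded_range_scaleR)
  have "\<exists>l. linear l \<and> (\<forall>F\<in>{F. ap F \<in> V}. l F = L (ap F)) \<and> (\<forall>F\<in>{F. \<forall>x\<in>K. ap F x \<in> C}. l F \<le> S)"
  proof (rule linear_extension_bounded_on_convex)
    show "subspace {F. ap F \<in> V}"
      by (rule subspaceI) (auto simp: ap_add ap_scale ap_0 V_zero V_add V_scale)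
    show "em v0 \<in> {F. ap F \<in> V}" using v0 V_bdd by (simp add: apem)
    show "convex {F. \<forall>x\<in>K. ap F x \<in> C}"
      unfolding convex_def using C by (auto simp: ap_add ap_scale convex_def)
    fix F :: "'a discrete \<Rightarrow>\<^sub>C 'b"
    define e where "e = r / (norm F + 1)"
    have e: "e > 0" using r unfolding e_def by (intro divide_pos_pos) (auto intro: add_nonneg_pos)
    have "ap (em v0 + e *\<^sub>R F) x \<in> C" if "x \<in> K" for x
    proof (rule core[OF _ that], rule ballI)
      fix y
      have "norm (ap F y) \<le> norm F" unfolding ap_def by (rule norm_bounded)
      then have "e * norm (ap F y) \<le> e * (norm F + 1)" using e by (intro mult_left_mono) auto
      also have "\<dots> = r" unfolding e_def
        by (metis add_nonneg_pos less_irrefl nonzero_eq_divide_eq norm_ge_zero zero_less_one)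
      finally show "norm (ap (em v0 + e *\<^sub>R F) y - v0 y) \<le> r"
        using e v0 V_bdd by (simp add: ap_add ap_scale apem)
    qed
    then show "\<exists>e>0. em v0 + e *\<^sub>R F \<in> {F. \<forall>x\<in>K. ap F x \<in> C}" using e by blast
  qed (auto simp: ap_add ap_scale L_add L_scale S)
  then obtain l where l: "linear l" "\<And>F. ap F \<in> V \<Longrightarrow> l F = L (ap F)"
    "\<And>F. \<forall>x\<in>K. ap F x \<in> C \<Longrightarrow> l F \<le> S" by blast
  show ?thesis
    by (rule exI[of _ "\<lambda>f. l (em f)"])
      (use l V_bdd in \<open>auto simp: linear_on_bounded_def em_add em_scale linear_add linear_scale apem\<close>)
qed

section \<open>Riesz representation on a compact set\<close>

text \<open>
  Successive bisection of a cell \<open>C\<close> by the sets in the list \<open>As\<close>, laid out on the real line: the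
  interval \<open>[0, m C)\<close> is cut into consecutive intervals, one for each final cell, whose lengths are
  the contents of these cells.  The function finds the cell in whose interval \<open>u\<close> lies, together with
  the offset of \<open>u\<close> in that interval, at which a further bisection can continue.
\<close>

primrec walk :: "('a set \<Rightarrow> real) \<Rightarrow> 'a set list \<Rightarrow> 'a set \<Rightarrow> real \<Rightarrow> 'a set \<times> real" where
  "walk m [] C u = (C, u)"
| "walk m (A # As) C u =
     (if u < m (C \<inter> A) then walk m As (C \<inter> A) u else walk m As (C - A) (u - m (C \<inter> A)))"

text \<open>
  All final cells of the bisection, the empty ones included.
\<close>

primrec leaves :: "'a set list \<Rightarrow> 'a set \<Rightarrow> 'a set set" where
  "leaves [] C = {C}"
| "leaves (A # As) C = leaves As (C \<inter> A) \<union> leaves As (C - A)"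

text \<open>
  The Riemann sum over the final cells, arranged along the bisection so that statements about it
  follow by induction on the list.
\<close>

primrec cell_sum :: "('a set \<Rightarrow> real) \<Rightarrow> ('a set \<Rightarrow> real) \<Rightarrow> 'a set list \<Rightarrow> 'a set \<Rightarrow> real" where
  "cell_sum m F [] C = F C * m C"
| "cell_sum m F (A # As) C = cell_sum m F As (C \<inter> A) + cell_sum m F As (C - A)"

lemma walk_append: "walk m (As @ Bs) C u = (case walk m As C u of (D, v) \<Rightarrow> walk m Bs D v)"
  by (induction As arbitrary: C u) auto

lemma leaves_append: "leaves (As @ Bs) C = (\<Union>D\<in>leaves As C. leaves Bs D)"
  by (induction As arbitrary: C) auto

lemma walk_in_leaves: "fst (walk m As C u) \<in> leaves As C"
  by (induction As arbitrary: C u) auto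

lemma leaves_subset: "D \<in> leaves As C \<Longrightarrow> D \<subseteq> C"
  by (induction As arbitrary: C) auto

lemma leaves_cover:
  assumes "D \<in> leaves As C" "C \<subseteq> \<Union>(set As)"
  shows "D = {} \<or> (\<exists>A\<in>set As. D \<subseteq> A)"
  using assms
proof (induction As arbitrary: C)
  case (Cons A As)
  then consider "D \<in> leaves As (C \<inter> A)" | "D \<in> leaves As (C - A)" by auto
  then show ?case
  proof cases
    case 1
    then show ?thesis using leaves_subset[OF 1] by auto
  next
    case 2
    then show ?thesis using Cons.IH[OF 2] Cons.prems(2) by auto
  qed
qed auto

locale positive_functional =
  fixes K :: "'a::euclidean_space set" and l :: "('a \<Rightarrow> real) \<Rightarrow> real"
  assumes linear: "linear_on_bounded l"
    and pos: "\<And>f. bounded (range f) \<Longrightarrow> (\<forall>x\<in>K. 0 \<le> f x) \<Longrightarrow> 0 \<le> l f"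
begin

lemmas add = linear_on_bounded_add[OF linear]
lemmas bounded_mult = bounded_range_scaleR[where 'b = real, unfolded real_scaleR_def]
lemmas scale = linear_on_bounded_scale[OF linear, unfolded real_scaleR_def]

definition content :: "'a set \<Rightarrow> real" where "content A = l (indicator A)"

lemma bounded_indicator: "bounded (range (indicator A :: 'a \<Rightarrow> real))"
  unfolding bounded_iff by (auto intro!: exI[of _ 1] simp: indicator_def)

lemma bounded_mult_indicator: "bounded (range f) \<Longrightarrow> bounded (range (\<lambda>x. f x * indicator A x :: real))"
  by (rule bounded_subset[of "insert 0 (range f)"]) (auto simp: indicator_def)

lemma mono:
  assumes "bounded (range f)" "bounded (range g)" "\<And>x. x \<in> K \<Longrightarrow> f x \<le> g x"
  shows "l f \<le> l g"
proof -
  have b: "bounded (range (\<lambda>x. (-1) * f x))" using assms(1) by (rule bounded_mult)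
  have "0 \<le> l (\<lambda>x. g x + (-1) * f x)"
    using assms b by (intro pos bounded_plus_comp) auto
  also have "\<dots> = l g + (-1) * l f" using assms b by (simp only: add scale)
  finally show ?thesis by simp
qed

lemma cong:
  assumes "bounded (range f)" "bounded (range g)" "\<And>x. x \<in> K \<Longrightarrow> f x = g x"
  shows "l f = l g"
  by (rule antisym) (use assms in \<open>auto intro!: mono\<close>)

lemma content_nonneg: "0 \<le> content A"
  unfolding content_def by (intro pos bounded_indicator) auto

lemma content_empty: "content {} = 0"
proof -
  have "l (\<lambda>x. 0 * indicator {} x) = 0 * l (indicator {})" by (intro scale bounded_indicator)
  moreover have "(\<lambda>x. 0 * indicator {} x) = (indicator {} :: 'a \<Rightarrow> real)" by auto
  ultimately show ?thesis unfolding content_def by simp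
qed

lemma split_mult:
  assumes "bounded (range f)"
  shows "l (\<lambda>x. f x * indicator C x) = l (\<lambda>x. f x * indicator (C \<inter> A) x) + l (\<lambda>x. f x * indicator (C - A) x)"
proof -
  have "(\<lambda>x. f x * indicator C x) = (\<lambda>x. f x * indicator (C \<inter> A) x + f x * indicator (C - A) x)"
    by (auto simp: indicator_def)
  then show ?thesis by (simp add: add bounded_mult_indicator assms)
qed

lemma content_split: "content C = content (C \<inter> A) + content (C - A)"
proof -
  have "bounded (range (\<lambda>_::'a. 1::real))" by (simp add: image_def)
  from split_mult[OF this, of C A] show ?thesis unfolding content_def by simp
qed

lemma walk_nonempty:
  assumes "0 \<le> u" "u < content C" shows "fst (walk content As C u) \<noteq> {}"
  using assms
proof (induction As arbitrary: C u)
  case (Cons A As)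
  show ?case
  proof (cases "u < content (C \<inter> A)")
    case False
    have "u - content (C \<inter> A) < content (C - A)" using Cons.prems content_split[of C A] by simp
    then show ?thesis using False Cons.IH by simp
  qed (use Cons in auto)
qed (auto simp: content_empty)

lemma walk_measurable: "(\<lambda>u. h (fst (walk content As C u))) \<in> borel_measurable borel"
proof (induction As arbitrary: C)
  case (Cons A As)
  have "(\<lambda>u. h (fst (walk content (A # As) C u))) = (\<lambda>u. if u < content (C \<inter> A) then h (fst (walk content As (C \<inter> A) u))
      else h (fst (walk content As (C - A) (u - content (C \<inter> A)))))" by auto
  also have "\<dots> \<in> borel_measurable borel"
  proof (rule measurable_If)
    show "(\<lambda>u. h (fst (walk content As (C - A) (u - content (C \<inter> A))))) \<in> borel_measurable borel"
      by (rule measurable_compose[OF _ Cons]) simp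
  qed (auto intro: Cons)
  finally show ?case .
qed simp

text \<open>
  The intervals have the right lengths, so that the integral over the line is the Riemann sum.
\<close>

lemma walk_integral:
  "has_bochner_integral lborel (\<lambda>u. indicator {0..<content C} u * F (fst (walk content As C u))) (cell_sum content F As C)"
proof (induction As arbitrary: C)
  case Nil
  have "has_bochner_integral lborel (\<lambda>u. indicator {0..<content C} u :: real) (content C)"
    using has_bochner_integral_real_indicator[of "{0..<content C}" lborel] content_nonneg[of C] by simp
  from has_bochner_integral_mult_right[OF this, of "F C"] show ?case by (simp add: mult.commute)
next
  case (Cons A As)
  define s where "s = content (C \<inter> A)"
  have mC: "content C = s + content (C - A)" using content_split[of C A] by (simp add: s_def)
  have s0: "0 \<le> s" "0 \<le> content (C - A)" by (simp_all add: s_def content_nonneg)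
  let ?g = "\<lambda>u. indicator {0..<content (C - A)} u * F (fst (walk content As (C - A) u))"
  have "has_bochner_integral lborel (\<lambda>u. ?g (- s + 1 * u)) (cell_sum content F As (C - A) /\<^sub>R \<bar>1\<bar>)"
    using lborel_has_bochner_integral_real_affine_iff[of 1 ?g "cell_sum content F As (C - A)" "- s"] Cons[of "C - A"] by simp
  then have "has_bochner_integral lborel (\<lambda>u. ?g (u - s)) (cell_sum content F As (C - A))" by simp
  from has_bochner_integral_add[OF Cons[of "C \<inter> A"] this]
  have "has_bochner_integral lborel (\<lambda>u. indicator {0..<s} u * F (fst (walk content As (C \<inter> A) u)) + ?g (u - s))
     (cell_sum content F (A # As) C)" by (simp add: s_def)
  also have "(\<lambda>u. indicator {0..<s} u * F (fst (walk content As (C \<inter> A) u)) + ?g (u - s)) =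
      (\<lambda>u. indicator {0..<content C} u * F (fst (walk content (A # As) C u)))"
    using s0 by (auto simp: mC s_def[symmetric] indicator_def)
  finally show ?case .
qed

text \<open>
  On a final cell, \<open>f\<close> differs from the sample value by at most \<open>e\<close>, so positivity bounds the error
  by \<open>e\<close> times the content; the errors add up along the bisection.
\<close>

lemma cell_sum_approx:
  assumes f: "bounded (range f)" and CK: "C \<subseteq> K"
    and osc: "\<And>D x. D \<in> leaves As C \<Longrightarrow> x \<in> D \<Longrightarrow> \<bar>f x - F D\<bar> \<le> e"
  shows "\<bar>l (\<lambda>x. f x * indicator C x) - cell_sum content F As C\<bar> \<le> e * content C"
  using CK osc
proof (induction As arbitrary: C)
  case Nil
  have le: "f x * indicator C x \<le> (F C + e) * indicator C x" "(F C - e) * indicator C x \<le> f x * indicator C x" for x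
    using Nil.prems(2)[of C x] by (auto simp: indicator_def)
  have "l (\<lambda>x. f x * indicator C x) \<le> l (\<lambda>x. (F C + e) * indicator C x)"
    by (intro mono bounded_mult_indicator f bounded_mult bounded_indicator le)
  moreover have "l (\<lambda>x. (F C - e) * indicator C x) \<le> l (\<lambda>x. f x * indicator C x)"
    by (intro mono bounded_mult_indicator f bounded_mult bounded_indicator le)
  ultimately show ?case
    using scale[OF bounded_indicator, of "F C + e" C] scale[OF bounded_indicator, of "F C - e" C]
    by (simp add: content_def algebra_simps abs_le_iff)
next
  case (Cons A As)
  have "\<bar>l (\<lambda>x. f x * indicator (C \<inter> A) x) - cell_sum content F As (C \<inter> A)\<bar> \<le> e * content (C \<inter> A)"
    by (rule Cons.IH) (use Cons.prems in auto)
  moreover have "\<bar>l (\<lambda>x. f x * indicator (C - A) x) - cell_sum content F As (C - A)\<bar> \<le> e * content (C - A)"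
    by (rule Cons.IH) (use Cons.prems in auto)
  moreover have "e * content C = e * content (C \<inter> A) + e * content (C - A)" using content_split[of C A] by (simp add: algebra_simps)
  ultimately show ?case using split_mult[OF f, of C A] by simp
qed

text \<open>
  Bisecting by finer and finer finite coverings of \<open>K\<close> with balls attaches to every \<open>u \<in> [0, content K)\<close>
  a decreasing sequence of nonempty cells whose diameters tend to 0, hence a point \<open>X u\<close> of \<open>K\<close>.
  The image of Lebesgue measure under \<open>X\<close> represents the functional: for continuous \<open>f\<close>, the
  integrals of \<open>f\<close> at sample points of the cells converge to the integral of \<open>f \<circ> X\<close>, and they are the
  Riemann sums, which converge to \<open>l f\<close>.
\<close>

lemma riesz_representation:
  assumes K: "compact K"
  shows "\<exists>\<mu>. finite_measure \<mu> \<and> sets \<mu> = sets (restrict_space borel K) \<and>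
    (\<forall>f. bounded (range f) \<longrightarrow> continuous_on K f \<longrightarrow> l f = (\<integral>x. f x \<partial>\<mu>))"
proof -
  have "\<exists>As. K \<subseteq> \<Union>(set As) \<and> (\<forall>A\<in>set As. \<exists>x. A = ball x (1 / real (Suc n)))" for n
  proof -
    obtain k where "finite k" "K \<subseteq> (\<Union>x\<in>k. ball x (1 / real (Suc n)))"
      by (rule compactE_image[OF K, of K "\<lambda>x. ball x (1 / real (Suc n))"]) auto
    moreover obtain xs where "set xs = k" using \<open>finite k\<close> finite_list by blast
    ultimately show ?thesis by (intro exI[of _ "map (\<lambda>x. ball x (1 / real (Suc n))) xs"]) auto
  qed
  then obtain As where As: "\<And>n. K \<subseteq> \<Union>(set (As n))" "\<And>n A. A \<in> set (As n) \<Longrightarrow> \<exists>x. A = ball x (1 / real (Suc n))"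
    by metis
  define Ls where "Ls n = concat (map As [0..<n])" for n
  have LsS: "Ls (Suc n) = Ls n @ As n" for n by (simp add: Ls_def)
  have small: "dist x y < 2 / real (Suc n)" if D: "D \<in> leaves (Ls (Suc n)) K" "x \<in> D" "y \<in> D" for D n x y
  proof -
    obtain E where E: "E \<in> leaves (Ls n) K" "D \<in> leaves (As n) E" using D by (auto simp: LsS leaves_append)
    have "E \<subseteq> \<Union>(set (As n))" using leaves_subset[OF E(1)] As(1)[of n] by auto
    then obtain A where "A \<in> set (As n)" "D \<subseteq> A" using leaves_cover[OF E(2)] D by auto
    then obtain z where "D \<subseteq> ball z (1 / real (Suc n))" using As(2) by metis
    then have "dist z x < 1 / real (Suc n)" "dist z y < 1 / real (Suc n)" using D by auto
    then show ?thesis using dist_triangle3[of x y z] by simp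
  qed
  define pt where "pt D = (SOME x. x \<in> D)" for D :: "'a set"
  have pt: "pt D \<in> D" if "D \<noteq> {}" for D using that unfolding pt_def by (simp add: some_in_eq)
  define I where "I = {0..<content K}"
  define c where "c n u = fst (walk content (Ls n) K u)" for n u
  define xs where "xs n u = pt (c n u)" for n u
  have c_leaf: "c n u \<in> leaves (Ls n) K" for n u unfolding c_def by (rule walk_in_leaves)
  have cK: "c n u \<subseteq> K" for n u using leaves_subset[OF c_leaf] .
  have c_ne: "c n u \<noteq> {}" if "u \<in> I" for n u unfolding c_def by (rule walk_nonempty) (use that in \<open>auto simp: I_def\<close>)
  have c_dec: "c (Suc n) u \<subseteq> c n u" for n u
    by (simp add: c_def LsS walk_append split_beta leaves_subset[OF walk_in_leaves])
  have c_anti: "c k u \<subseteq> c n u" if "n \<le> k" for n k u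
    using that by (induction rule: dec_induct) (use c_dec in auto)
  have xs_c: "xs k u \<in> c n u" if "u \<in> I" "n \<le> k" for n k u
    using pt[OF c_ne[OF that(1), of k]] c_anti[OF that(2), of u] unfolding xs_def by auto
  have "Cauchy (\<lambda>n. xs n u)" if u: "u \<in> I" for u
  proof (rule metric_CauchyI)
    fix e :: real assume "e > 0"
    then obtain n where n: "2 / e < real n" using reals_Archimedean2 by blast
    then have "2 < e * real n" using \<open>e > 0\<close> by (simp add: field_simps)
    also have "\<dots> \<le> e * real (Suc n)" using \<open>e > 0\<close> by (intro mult_left_mono) auto
    finally have *: "2 / real (Suc n) < e" by (simp add: field_simps)
    have "dist (xs i u) (xs j u) < e" if "i \<ge> Suc n" "j \<ge> Suc n" for i j
      using small[OF c_leaf xs_c[OF u that(1)] xs_c[OF u that(2)]] * by simp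
    then show "\<exists>M. \<forall>i\<ge>M. \<forall>j\<ge>M. dist (xs i u) (xs j u) < e" by blast
  qed
  then have "\<exists>y. (\<lambda>n. xs n u) \<longlonglongrightarrow> y" if "u \<in> I" for u
    using that by (meson Cauchy_convergent_iff convergent_def)
  then obtain X where X: "\<And>u. u \<in> I \<Longrightarrow> (\<lambda>n. xs n u) \<longlonglongrightarrow> X u" by metis
  have XK: "X u \<in> K" if "u \<in> I" for u
    using closed_sequentially[OF compact_imp_closed[OF K] _ X[OF that]] xs_c[OF that le_refl] cK by blast
  define N where "N = restrict_space lborel I"
  have spN: "space N = I" by (simp add: N_def space_restrict_space)
  have "emeasure N (space N) < \<infinity>"
    unfolding spN N_def using content_nonneg[of K] by (subst emeasure_restrict_space) (auto simp: I_def)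
  then interpret N: finite_measure N by (intro finite_measureI) auto
  have Fm: "(\<lambda>u. h (c n u)) \<in> borel_measurable N" for h :: "'a set \<Rightarrow> 'c::topological_space" and n
    unfolding N_def c_def by (rule measurable_restrict_space1) (simp add: walk_measurable)
  have Xm: "X \<in> borel_measurable N"
  proof (rule borel_measurable_LIMSEQ_metric[of xs])
    show "xs n \<in> borel_measurable N" for n using Fm[of pt n] by (simp add: xs_def[abs_def])
  qed (use X in \<open>auto simp: spN\<close>)
  have Xm': "X \<in> measurable N (restrict_space borel K)"
    by (rule measurable_restrict_space2) (use Xm XK in \<open>auto simp: spN\<close>)
  define \<mu> where "\<mu> = distr N (restrict_space borel K) X"
  have fin: "finite_measure \<mu>" unfolding \<mu>_def by (rule N.finite_measure_distr[OF Xm'])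
  have "l f = (\<integral>x. f x \<partial>\<mu>)" if fb: "bounded (range f)" and fc: "continuous_on K f" for f
  proof -
    have "(\<integral>x. f x \<partial>\<mu>) = (\<integral>u. f (X u) \<partial>N)"
      unfolding \<mu>_def by (rule integral_distr[OF Xm' borel_measurable_continuous_on_restrict[OF fc]])
    obtain B where B: "\<And>x. \<bar>f x\<bar> \<le> B" using fb by (auto simp: bounded_iff)
    have lim1: "(\<lambda>n. \<integral>u. f (xs n u) \<partial>N) \<longlonglongrightarrow> (\<integral>u. f (X u) \<partial>N)"
    proof (rule integral_dominated_convergence[where w = "\<lambda>_. B"])
      show "(\<lambda>u. f (X u)) \<in> borel_measurable N"
        using measurable_compose[OF Xm' borel_measurable_continuous_on_restrict[OF fc]] .
      show "(\<lambda>u. f (xs i u)) \<in> borel_measurable N" for i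
        using Fm[of "\<lambda>D. f (pt D)"] by (simp add: xs_def)
      show "AE u in N. (\<lambda>i. f (xs i u)) \<longlonglongrightarrow> f (X u)"
      proof (rule AE_I2)
        fix u assume "u \<in> space N"
        then have u: "u \<in> I" by (simp add: spN)
        have "continuous (at (X u) within K) f" using fc XK[OF u] by (simp add: continuous_on_eq_continuous_within)
        then show "(\<lambda>i. f (xs i u)) \<longlonglongrightarrow> f (X u)"
        proof (rule continuous_within_tendsto_compose')
          show "xs n u \<in> K" for n using xs_c[OF u le_refl] cK by blast
        qed (rule X[OF u])
      qed
    qed (use B in auto)
    have eqn: "(\<integral>u. f (xs n u) \<partial>N) = cell_sum content (\<lambda>D. f (pt D)) (Ls n) K" for n
    proof -
      have "(\<integral>u. f (xs n u) \<partial>N) = (\<integral>u. indicator I u * f (xs n u) \<partial>lborel)"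
        unfolding N_def by (subst integral_restrict_space) (auto simp: I_def)
      also have "\<dots> = cell_sum content (\<lambda>D. f (pt D)) (Ls n) K"
        using has_bochner_integral_integral_eq[OF walk_integral[of K "\<lambda>D. f (pt D)" "Ls n"]]
        by (simp add: I_def xs_def c_def)
      finally show ?thesis .
    qed
    have lim2: "(\<lambda>n. \<integral>u. f (xs n u) \<partial>N) \<longlonglongrightarrow> l f"
    proof (rule metric_LIMSEQ_I)
      fix r :: real assume r: "r > 0"
      define e where "e = r / (content K + 1)"
      have e: "e > 0" using r content_nonneg[of K] by (simp add: e_def)
      obtain d where d: "d > 0" "\<And>x y. x \<in> K \<Longrightarrow> y \<in> K \<Longrightarrow> dist x y < d \<Longrightarrow> dist (f x) (f y) < e"
        using compact_uniformly_continuous[OF fc K] e unfolding uniformly_continuous_on_def by metis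
      obtain n0 where n0: "2 / d < real n0" using reals_Archimedean2 by blast
      have "dist (\<integral>u. f (xs n u) \<partial>N) (l f) < r" if "n \<ge> Suc n0" for n
      proof -
        obtain k where k: "n = Suc k" using \<open>n \<ge> Suc n0\<close> by (cases n) auto
        have "2 < d * real n0" using n0 d(1) by (simp add: field_simps)
        also have "\<dots> \<le> d * real (Suc k)" using d(1) that k by (intro mult_left_mono) auto
        finally have kd: "2 / real (Suc k) < d" by (simp add: field_simps)
        have "\<bar>l (\<lambda>x. f x * indicator K x) - cell_sum content (\<lambda>D. f (pt D)) (Ls n) K\<bar> \<le> e * content K"
        proof (rule cell_sum_approx[OF fb order_refl])
          fix D x assume D: "D \<in> leaves (Ls n) K" "x \<in> D"
          have p: "pt D \<in> D" using pt[of D] D(2) by blast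
          have "dist x (pt D) < d" using small[of D k x "pt D"] D p k kd by auto
          then have "dist (f x) (f (pt D)) < e" using leaves_subset[OF D(1)] D p by (intro d) auto
          then show "\<bar>f x - f (pt D)\<bar> \<le> e" by (simp add: dist_real_def)
        qed
        also have "l (\<lambda>x. f x * indicator K x) = l f"
          by (intro cong bounded_mult_indicator fb) auto
        also have "e * content K < r" using r content_nonneg[of K] by (simp add: e_def field_simps)
        finally show ?thesis by (simp add: eqn dist_real_def abs_minus_commute)
      qed
      then show "\<exists>n0. \<forall>n\<ge>n0. dist (\<integral>u. f (xs n u) \<partial>N) (l f) < r" by blast
    qed
    show ?thesis using LIMSEQ_unique[OF lim1 lim2] \<open>(\<integral>x. f x \<partial>\<mu>) = (\<integral>u. f (X u) \<partial>N)\<close> by simp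
  qed
  then show ?thesis using fin by (intro exI[of _ \<mu>]) (auto simp: \<mu>_def)
qed

end

text \<open>
  A linear functional bounded above on a cone is nonpositive there.
\<close>

lemma nonneg_if_multiples_bounded:
  fixes y :: real
  assumes "\<And>t. t > 0 \<Longrightarrow> - t * y \<le> S" shows "0 \<le> y"
proof (rule ccontr)
  assume "\<not> 0 \<le> y"
  then have y: "y < 0" by simp
  have "\<bar>S\<bar> + 1 = - ((\<bar>S\<bar> + 1) / (- y)) * y" using y by simp
  also have "\<dots> \<le> S" by (rule assms) (use y in \<open>auto intro: divide_pos_neg\<close>)
  finally show False by simp
qed

text \<open>
  On pairs of functions, extend the functional \<open>(f, - f) \<mapsto> l f\<close> so that its bound on the set of pairs
  with \<open>f \<le> 1\<close> and \<open>g \<le> 1\<close> is kept.  This set contains all multiples of pairs of nonpositive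
  functions, so both partial functionals are positive, and their difference is \<open>l\<close>.
\<close>

lemma jordan_functional:
  fixes l :: "('a::euclidean_space \<Rightarrow> real) \<Rightarrow> real"
  assumes lin: "linear_on_bounded l"
    and bnd: "\<And>f. bounded (range f) \<Longrightarrow> \<forall>x\<in>K. \<bar>f x\<bar> \<le> 1 \<Longrightarrow> l f \<le> c"
  shows "\<exists>l1 l2. positive_functional K l1 \<and> positive_functional K l2 \<and> (\<forall>f. bounded (range f) \<longrightarrow> l f = l1 f - l2 f)"
proof -
  define V where "V = {F :: 'a \<Rightarrow> real \<times> real. bounded (range F) \<and> (\<forall>x. snd (F x) = - fst (F x))}"
  define C where "C = {..1::real} \<times> {..1::real}"
  have fstV: "bounded (range (\<lambda>x. fst (F x)))" if "F \<in> V" for F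
    using that bounded_fst[of "range F"] by (simp add: V_def image_image)
  have "\<exists>h. linear_on_bounded h \<and> (\<forall>F\<in>V. h F = l (\<lambda>x. fst (F x)))
    \<and> (\<forall>f. bounded (range f) \<longrightarrow> (\<forall>x\<in>K. f x \<in> C) \<longrightarrow> h f \<le> c)"
  proof (rule bounded_function_extension[where r = 1 and ?v0.0 = "\<lambda>_. 0"])
    show "(\<lambda>_. 0) \<in> V" "(\<lambda>_. 0) \<in> V" by (simp_all add: V_def image_constant_conv)
    show "(\<lambda>x. F x + G x) \<in> V" if "F \<in> V" "G \<in> V" for F G
      using that by (simp add: V_def bounded_plus_comp)
    show "(\<lambda>x. c *\<^sub>R F x) \<in> V" if "F \<in> V" for c F
      using that by (simp add: V_def bounded_range_scaleR)
    show "l (\<lambda>x. fst (F x + G x)) = l (\<lambda>x. fst (F x)) + l (\<lambda>x. fst (G x))" if "F \<in> V" "G \<in> V" for F G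
      using linear_on_bounded_add[OF lin fstV[OF that(1)] fstV[OF that(2)]] by simp
    show "l (\<lambda>x. fst (c *\<^sub>R F x)) = c * l (\<lambda>x. fst (F x))" if "F \<in> V" for c F
      using linear_on_bounded_scale[OF lin fstV[OF that]] by simp
    show "convex C" unfolding C_def by (intro convex_Times convex_real_interval)
    show "F x \<in> C" if "\<forall>y\<in>K. norm (F y - 0) \<le> 1" "x \<in> K" for F x
    proof -
      have "norm (F x) \<le> 1" using that by simp
      then have "\<bar>fst (F x)\<bar> \<le> 1" "\<bar>snd (F x)\<bar> \<le> 1"
        using norm_fst_le[of "fst (F x)" "snd (F x)"] norm_snd_le[of "snd (F x)" "fst (F x)"] by auto
      then show ?thesis by (auto simp: C_def mem_Times_iff)
    qed
    show "l (\<lambda>x. fst (F x)) \<le> c" if "F \<in> V" "\<forall>x\<in>K. F x \<in> C" for F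
      by (rule bnd[OF fstV[OF that(1)]]) (use that in \<open>force simp: V_def C_def mem_Times_iff\<close>)
  qed (auto simp: V_def)
  then obtain h where lin_h: "linear_on_bounded h" and h_V: "\<forall>F\<in>V. h F = l (\<lambda>x. fst (F x))"
    and h_C: "\<forall>f. bounded (range f) \<longrightarrow> (\<forall>x\<in>K. f x \<in> C) \<longrightarrow> h f \<le> c" by (elim exE conjE)
  have pos: "positive_functional K (\<lambda>f. h (\<lambda>x. f x *\<^sub>R e))" if e: "e = (1, 0) \<or> e = (0, 1)" for e
  proof
    show lin_e: "linear_on_bounded (\<lambda>f. h (\<lambda>x. f x *\<^sub>R e))" by (rule linear_on_bounded_along[OF lin_h])
    show "0 \<le> h (\<lambda>x. f x *\<^sub>R e)" if f: "bounded (range f)" "\<forall>x\<in>K. 0 \<le> f x" for f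
    proof (rule nonneg_if_multiples_bounded)
      fix t :: real assume t: "t > 0"
      have le: "- t * f x \<le> 1" if "x \<in> K" for x
      proof -
        have "0 \<le> t * f x" using f(2) that t by simp
        then show ?thesis by linarith
      qed
      have "h (\<lambda>x. (- t *\<^sub>R f x) *\<^sub>R e) \<le> c"
        by (rule h_C[rule_format, OF bounded_range_scaleR_const[OF bounded_range_scaleR[OF f(1)]]])
          (use e le in \<open>auto simp: C_def\<close>)
      then show "- t * h (\<lambda>x. f x *\<^sub>R e) \<le> c" using linear_on_bounded_scale[OF lin_e f(1), of "- t"] by simp
    qed
  qed
  have "l f = h (\<lambda>x. f x *\<^sub>R (1, 0)) - h (\<lambda>x. f x *\<^sub>R (0, 1))" if f: "bounded (range f)" for f
  proof -
    note b = bounded_range_scaleR_const[OF f]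
    have eq: "(\<lambda>x. f x *\<^sub>R (1, -1)) = (\<lambda>x. f x *\<^sub>R (1, 0) + - 1 *\<^sub>R (f x *\<^sub>R (0, 1)))" by auto
    have "(\<lambda>x. f x *\<^sub>R (1, -1)) \<in> V" using b[of "(1, -1) :: real \<times> real"] by (simp add: V_def)
    then have "l f = h (\<lambda>x. f x *\<^sub>R (1, -1))" using h_V by simp
    then show ?thesis
      unfolding eq linear_on_bounded_add[OF lin_h b bounded_range_scaleR[OF b]] linear_on_bounded_scale[OF lin_h b]
      by simp
  qed
  then show ?thesis using pos by blast
qed

section \<open>Finite signed measures and their total variation\<close>

lemma ennreal_gauge_le_suminf:
  fixes f :: "nat \<Rightarrow> 'b::real_normed_vector" and g :: "'b \<Rightarrow> real"
  assumes "f sums s" and g: "isCont g s" "g 0 = 0" "\<And>x. 0 \<le> g x" "\<And>x y. g (x + y) \<le> g x + g y"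
  shows "ennreal (g s) \<le> (\<Sum>i. ennreal (g (f i)))"
proof (rule LIMSEQ_le_const2)
  show "(\<lambda>n. ennreal (g (\<Sum>i<n. f i))) \<longlonglongrightarrow> ennreal (g s)"
    using assms(1) unfolding sums_def by (intro tendsto_ennrealI isCont_tendsto_compose[OF g(1)])
  have "ennreal (g (\<Sum>i<n. f i)) \<le> (\<Sum>i. ennreal (g (f i)))" for n
  proof -
    have "g (\<Sum>i<n. f i) \<le> (\<Sum>i<n. g (f i))"
    proof (induction n)
      case (Suc n)
      then show ?case using g(4)[of "\<Sum>i<n. f i" "f n"] by simp
    qed (simp add: g(2))
    then have "ennreal (g (\<Sum>i<n. f i)) \<le> (\<Sum>i<n. ennreal (g (f i)))" using g(3) by (simp add: ennreal_leI)
    also have "\<dots> \<le> (\<Sum>i. ennreal (g (f i)))" by (intro sum_le_suminf) auto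
    finally show ?thesis .
  qed
  then show "\<exists>N. \<forall>n\<ge>N. ennreal (g (\<Sum>i<n. f i)) \<le> (\<Sum>i. ennreal (g (f i)))" by blast
qed

lemma ennreal_norm_le_suminf:
  fixes f :: "nat \<Rightarrow> 'b::real_normed_vector"
  assumes "f sums s" shows "ennreal (norm s) \<le> (\<Sum>i. ennreal (norm (f i)))"
  by (rule ennreal_gauge_le_suminf[OF assms]) (auto intro: norm_triangle_ineq)

lemma ennreal_le_suminf:
  fixes f :: "nat \<Rightarrow> real"
  assumes "f sums s" shows "ennreal s \<le> (\<Sum>i. ennreal (f i))"
proof -
  have "ennreal (max 0 x) = ennreal x" for x by (auto simp: max_def ennreal_neg)
  moreover have "isCont (\<lambda>x::real. max 0 x) s" by (intro continuous_intros)
  ultimately show ?thesis using ennreal_gauge_le_suminf[OF assms, of "max 0"] by auto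
qed

text \<open>
  The set functions that define the upper variation and the total variation are suprema.  For these,
  superadditivity on two sets and countable subadditivity are the natural facts.
\<close>

lemma emeasure_superadditive_subadditive:
  fixes V :: "'x set \<Rightarrow> ennreal"
  assumes V0: "V {} = 0"
    and super: "\<And>A B. A \<in> sets M \<Longrightarrow> B \<in> sets M \<Longrightarrow> A \<inter> B = {} \<Longrightarrow> V A + V B \<le> V (A \<union> B)"
    and sub: "\<And>A :: nat \<Rightarrow> 'x set. range A \<subseteq> sets M \<Longrightarrow> disjoint_family A \<Longrightarrow> V (\<Union>i. A i) \<le> (\<Sum>i. V (A i))"
    and A: "A \<in> sets M"
  shows "emeasure (measure_of (space M) (sets M) V) A = V A"
proof (rule emeasure_measure_of[OF refl])
  have mono: "V A \<le> V B" if "A \<in> sets M" "B \<in> sets M" "A \<subseteq> B" for A B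
  proof -
    have "V A \<le> V A + V (B - A)" by simp
    also have "\<dots> \<le> V (A \<union> (B - A))" using that by (intro super) auto
    also have "A \<union> (B - A) = B" using that by auto
    finally show ?thesis .
  qed
  have fin: "(\<Sum>i<n. V (F i)) \<le> V (\<Union>i<n. F i)" if "range F \<subseteq> sets M" "disjoint_family F" for n and F :: "nat \<Rightarrow> 'x set"
  proof (induction n)
    case (Suc n)
    have "(\<Sum>i<Suc n. V (F i)) \<le> V (\<Union>i<n. F i) + V (F n)" using Suc by (simp add: add_right_mono)
    also have "\<dots> \<le> V ((\<Union>i<n. F i) \<union> F n)"
    proof (intro super)
      have "F i \<inter> F n = {}" if "i < n" for i
        using \<open>disjoint_family F\<close> that by (simp add: disjoint_family_on_def)
      then show "(\<Union>i<n. F i) \<inter> F n = {}" by blast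
    qed (use that in auto)
    also have "(\<Union>i<n. F i) \<union> F n = (\<Union>i<Suc n. F i)" by (auto simp: less_Suc_eq)
    finally show ?case .
  qed (simp add: V0)
  show "countably_additive (sets (measure_of (space M) (sets M) V)) V"
  proof (rule countably_additiveI)
    fix F :: "nat \<Rightarrow> 'x set" assume "range F \<subseteq> sets (measure_of (space M) (sets M) V)" and d: "disjoint_family F"
    then have F: "range F \<subseteq> sets M" by simp
    have "(\<Sum>i. V (F i)) \<le> V (\<Union>i. F i)"
    proof (rule suminf_le_const)
      fix n
      have "(\<Sum>i<n. V (F i)) \<le> V (\<Union>i<n. F i)" by (rule fin[OF F d])
      also have "\<dots> \<le> V (\<Union>i. F i)" using F by (intro mono) auto
      finally show "(\<Sum>i<n. V (F i)) \<le> V (\<Union>i. F i)" .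
    qed auto
    then show "(\<Sum>i. V (F i)) = V (\<Union>i. F i)" using sub[OF F d] by (rule antisym)
  qed
qed (use A sets.sets_into_space in \<open>auto simp: positive_def V0\<close>)

lemma signed_measure_sums:
  assumes "\<nu> \<in> signed_measures M" "range A \<subseteq> sets M" "disjoint_family A"
  shows "(\<lambda>i::nat. \<nu> (A i)) sums \<nu> (\<Union>i. A i)"
  using assms by (auto simp: signed_measures_def)

lemma signed_measure_empty: "\<nu> \<in> signed_measures M \<Longrightarrow> \<nu> {} = 0"
  by (simp add: signed_measures_def)

lemma signed_measure_Un:
  assumes \<nu>: "\<nu> \<in> signed_measures M" and "A \<in> sets M" "B \<in> sets M" "A \<inter> B = {}"
  shows "\<nu> (A \<union> B) = \<nu> A + \<nu> B"
proof -
  have "(\<lambda>i. \<nu> (binaryset A B i)) sums \<nu> (\<Union>i. binaryset A B i)"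
    using assms by (intro signed_measure_sums[OF \<nu>]) (auto simp: range_binaryset_eq disjoint_family_on_def binaryset_def)
  moreover have "(\<lambda>i. \<nu> (binaryset A B i)) sums (\<nu> A + \<nu> B)"
    using signed_measure_empty[OF \<nu>] by (rule binaryset_sums)
  ultimately show ?thesis by (simp add: UN_binaryset_eq sums_unique2)
qed

lemma signed_measure_Diff:
  assumes \<nu>: "\<nu> \<in> signed_measures M" and "A \<in> sets M" "B \<in> sets M" "B \<subseteq> A"
  shows "\<nu> (A - B) = \<nu> A - \<nu> B"
proof -
  have "B \<union> (A - B) = A" using assms by auto
  then show ?thesis using signed_measure_Un[OF \<nu>, of B "A - B"] assms by auto
qed

lemma signed_measure_uminus: "\<nu> \<in> signed_measures M \<Longrightarrow> (\<lambda>A. - \<nu> A) \<in> signed_measures M"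
  by (auto simp: signed_measures_def intro: sums_minus)

text \<open>
  If the values on subsets of \<open>X\<close> are unbounded, then \<open>X\<close> splits into two pieces such that they are
  unbounded on one piece and the other piece has a value of modulus at least 1.  Iterating yields
  disjoint sets whose values do not tend to 0, which contradicts convergence of their sum.
\<close>

lemma signed_measure_bounded:
  assumes \<nu>: "\<nu> \<in> signed_measures M"
  shows "\<exists>c. \<forall>A\<in>sets M. \<bar>\<nu> A\<bar> \<le> c"
proof (rule ccontr)
  define unb where "unb X \<longleftrightarrow> X \<in> sets M \<and> (\<forall>c. \<exists>B\<in>sets M. B \<subseteq> X \<and> \<bar>\<nu> B\<bar> > c)" for X
  assume "\<not> ?thesis"
  then have unb0: "unb (space M)" using sets.sets_into_space unfolding unb_def by (metis not_le sets.top)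
  have step: "\<exists>Y. unb Y \<and> Y \<subseteq> X \<and> 1 \<le> \<bar>\<nu> (X - Y)\<bar>" if X: "unb X" for X
  proof -
    have XM: "X \<in> sets M" using X by (simp add: unb_def)
    obtain B where B: "B \<in> sets M" "B \<subseteq> X" "\<bar>\<nu> B\<bar> > \<bar>\<nu> X\<bar> + 1" using X unfolding unb_def by blast
    have d: "\<nu> (X - B) = \<nu> X - \<nu> B" by (rule signed_measure_Diff[OF \<nu> XM B(1,2)])
    have "unb B \<or> unb (X - B)"
    proof (rule ccontr)
      assume "\<not> ?thesis"
      then have nb: "\<not> unb B" "\<not> unb (X - B)" by auto
      have XB: "X - B \<in> sets M" using XM B(1) by auto
      obtain c where "\<not> (\<exists>D\<in>sets M. D \<subseteq> B \<and> \<bar>\<nu> D\<bar> > c)" using nb(1) B(1) unfolding unb_def by auto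
      then have c: "\<bar>\<nu> D\<bar> \<le> c" if "D \<in> sets M" "D \<subseteq> B" for D using that by (meson not_le)
      obtain c' where "\<not> (\<exists>D\<in>sets M. D \<subseteq> X - B \<and> \<bar>\<nu> D\<bar> > c')" using nb(2) XB unfolding unb_def by auto
      then have c': "\<bar>\<nu> D\<bar> \<le> c'" if "D \<in> sets M" "D \<subseteq> X - B" for D using that by (meson not_le)
      obtain D where D: "D \<in> sets M" "D \<subseteq> X" "\<bar>\<nu> D\<bar> > c + c'" using X unfolding unb_def by blast
      have "D = (D \<inter> B) \<union> (D - B)" by auto
      then have "\<nu> D = \<nu> (D \<inter> B) + \<nu> (D - B)"
        using signed_measure_Un[OF \<nu>, of "D \<inter> B" "D - B"] D B by auto
      then show False using c[of "D \<inter> B"] c'[of "D - B"] Diff_mono[OF D(2) order_refl, of B] D B by auto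
    qed
    then show ?thesis
    proof
      assume "unb B"
      then show ?thesis using B d by (intro exI[of _ B]) auto
    next
      assume "unb (X - B)"
      moreover have "X - (X - B) = B" using B by auto
      ultimately show ?thesis using B by (intro exI[of _ "X - B"]) auto
    qed
  qed
  have "\<exists>Y. \<forall>n. unb (Y n) \<and> (Y (Suc n) \<subseteq> Y n \<and> 1 \<le> \<bar>\<nu> (Y n - Y (Suc n))\<bar>)"
  proof (rule dependent_nat_choice)
    show "\<exists>Y. unb Y" using unb0 by blast
  qed (rule step)
  then obtain Y where YY: "\<forall>n. unb (Y n) \<and> (Y (Suc n) \<subseteq> Y n \<and> 1 \<le> \<bar>\<nu> (Y n - Y (Suc n))\<bar>)" ..
  then have Y: "\<And>n. unb (Y n)" "\<And>n. Y (Suc n) \<subseteq> Y n" "\<And>n. 1 \<le> \<bar>\<nu> (Y n - Y (Suc n))\<bar>"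
    by simp_all
  have YM: "Y n \<in> sets M" for n using Y(1) by (simp add: unb_def)
  have anti: "Y k \<subseteq> Y n" if "n \<le> k" for n k using that by (induction rule: dec_induct) (use Y(2) in auto)
  have dj: "(Y i - Y (Suc i)) \<inter> (Y j - Y (Suc j)) = {}" if "i < j" for i j
    using anti[of "Suc i" j] that by auto
  have "disjoint_family (\<lambda>n. Y n - Y (Suc n))"
    unfolding disjoint_family_on_def
  proof (intro ballI impI)
    fix i j :: nat assume "i \<noteq> j"
    then show "(Y i - Y (Suc i)) \<inter> (Y j - Y (Suc j)) = {}" using dj[of i j] dj[of j i] by (cases "i < j") auto
  qed
  then have "(\<lambda>n. \<nu> (Y n - Y (Suc n))) sums \<nu> (\<Union>n. Y n - Y (Suc n))"
    using YM by (intro signed_measure_sums[OF \<nu>]) auto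
  then have "(\<lambda>n. \<nu> (Y n - Y (Suc n))) \<longlonglongrightarrow> 0" by (rule sums_summable[THEN summable_LIMSEQ_zero])
  then obtain n where "\<bar>\<nu> (Y n - Y (Suc n))\<bar> < 1"
    using LIMSEQ_D[of _ 0 1] by fastforce
  then show False using Y(3)[of n] by simp
qed

lemma sets_pos_part [simp]: "sets (pos_part M \<nu>) = sets M"
  and space_pos_part [simp]: "space (pos_part M \<nu>) = space M"
  and sets_neg_part [simp]: "sets (neg_part M \<nu>) = sets M"
  and space_neg_part [simp]: "space (neg_part M \<nu>) = space M"
  by (simp_all add: pos_part_def neg_part_def sets.space_closed)

lemma emeasure_pos_part:
  assumes \<nu>: "\<nu> \<in> signed_measures M" and A: "A \<in> sets M"
  shows "emeasure (pos_part M \<nu>) A = (SUP B\<in>{B \<in> sets M. B \<subseteq> A}. ennreal (\<nu> B))"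
  unfolding pos_part_def
proof (rule emeasure_superadditive_subadditive[OF _ _ _ A])
  let ?V = "\<lambda>A. SUP B\<in>{B \<in> sets M. B \<subseteq> A}. ennreal (\<nu> B)"
  have "{B \<in> sets M. B \<subseteq> {}} = {{}}" by auto
  then show "?V {} = 0" using signed_measure_empty[OF \<nu>] by simp
  show "?V A + ?V A' \<le> ?V (A \<union> A')" if A: "A \<in> sets M" "A' \<in> sets M" "A \<inter> A' = {}" for A A'
  proof -
    have *: "ennreal (\<nu> B) + ennreal (\<nu> B') \<le> ?V (A \<union> A')"
      if "B \<in> {B \<in> sets M. B \<subseteq> A}" "B' \<in> {B \<in> sets M. B \<subseteq> A'}" for B B'
    proof -
      define C C' where "C = (if \<nu> B < 0 then {} else B)" and "C' = (if \<nu> B' < 0 then {} else B')"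
      have C: "ennreal (\<nu> B) = ennreal (\<nu> C)" "0 \<le> \<nu> C" "C \<in> sets M" "C \<subseteq> A"
        and C': "ennreal (\<nu> B') = ennreal (\<nu> C')" "0 \<le> \<nu> C'" "C' \<in> sets M" "C' \<subseteq> A'"
        using that by (auto simp: C_def C'_def signed_measure_empty[OF \<nu>] ennreal_neg)
      have "ennreal (\<nu> B) + ennreal (\<nu> B') = ennreal (\<nu> C + \<nu> C')" using C C' by simp
      also have "\<nu> C + \<nu> C' = \<nu> (C \<union> C')"
        using C C' A by (intro signed_measure_Un[OF \<nu>, symmetric]) auto
      also have "ennreal \<dots> \<le> ?V (A \<union> A')" using C C' by (intro SUP_upper) auto
      finally show ?thesis .
    qed
    have "?V A + ?V A' = (SUP B\<in>{B \<in> sets M. B \<subseteq> A}. ennreal (\<nu> B) + ?V A')"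
      by (rule ennreal_SUP_add_left[symmetric]) auto
    also have "\<dots> = (SUP B\<in>{B \<in> sets M. B \<subseteq> A}. SUP B'\<in>{B \<in> sets M. B \<subseteq> A'}. ennreal (\<nu> B) + ennreal (\<nu> B'))"
      by (intro SUP_cong refl ennreal_SUP_add_right) auto
    also have "\<dots> \<le> ?V (A \<union> A')" by (intro SUP_least *)
    finally show ?thesis .
  qed
  show "?V (\<Union>i. F i) \<le> (\<Sum>i. ?V (F i))" if F: "range F \<subseteq> sets M" "disjoint_family F" for F :: "nat \<Rightarrow> 'a set"
  proof (rule SUP_least)
    fix B assume B: "B \<in> {B \<in> sets M. B \<subseteq> (\<Union>i. F i)}"
    have "(\<lambda>i. \<nu> (B \<inter> F i)) sums \<nu> (\<Union>i. B \<inter> F i)"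
      using B F by (intro signed_measure_sums[OF \<nu>]) (auto simp: disjoint_family_on_def)
    also have "(\<Union>i. B \<inter> F i) = B" using B by auto
    finally have "ennreal (\<nu> B) \<le> (\<Sum>i. ennreal (\<nu> (B \<inter> F i)))" by (rule ennreal_le_suminf)
    also have "\<dots> \<le> (\<Sum>i. ?V (F i))" using B F by (intro suminf_le SUP_upper) auto
    finally show "ennreal (\<nu> B) \<le> (\<Sum>i. ?V (F i))" .
  qed
qed

lemma finite_pos_part:
  assumes \<nu>: "\<nu> \<in> signed_measures M" shows "finite_measure (pos_part M \<nu>)"
proof (rule finite_measureI)
  obtain c where c: "\<And>A. A \<in> sets M \<Longrightarrow> \<bar>\<nu> A\<bar> \<le> c" using signed_measure_bounded[OF \<nu>] by blast
  have "emeasure (pos_part M \<nu>) (space M) \<le> ennreal c"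
    unfolding emeasure_pos_part[OF \<nu> sets.top] using c by (intro SUP_least ennreal_leI) fastforce
  then show "emeasure (pos_part M \<nu>) (space (pos_part M \<nu>)) \<noteq> \<infinity>"
    by (auto simp: top_unique)
qed

lemma finite_neg_part:
  assumes "\<nu> \<in> signed_measures M" shows "finite_measure (neg_part M \<nu>)"
  unfolding neg_part_def by (rule finite_pos_part[OF signed_measure_uminus[OF assms]])

lemma le_measure_pos_part:
  assumes \<nu>: "\<nu> \<in> signed_measures M" and "A \<in> sets M" "B \<in> sets M" "B \<subseteq> A"
  shows "\<nu> B \<le> measure (pos_part M \<nu>) A"
proof -
  interpret finite_measure "pos_part M \<nu>" by (rule finite_pos_part[OF \<nu>])
  have "ennreal (\<nu> B) \<le> emeasure (pos_part M \<nu>) A"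
    unfolding emeasure_pos_part[OF assms(1,2)] using assms by (intro SUP_upper) auto
  then show ?thesis by (simp add: emeasure_eq_measure)
qed

lemma measure_pos_part_le:
  assumes \<nu>: "\<nu> \<in> signed_measures M" and "A \<in> sets M" "0 \<le> c"
    and "\<And>B. B \<in> sets M \<Longrightarrow> B \<subseteq> A \<Longrightarrow> \<nu> B \<le> c"
  shows "measure (pos_part M \<nu>) A \<le> c"
proof -
  interpret finite_measure "pos_part M \<nu>" by (rule finite_pos_part[OF \<nu>])
  have "emeasure (pos_part M \<nu>) A \<le> ennreal c"
    unfolding emeasure_pos_part[OF assms(1,2)] using assms by (intro SUP_least ennreal_leI) auto
  then show ?thesis using assms by (simp add: emeasure_eq_measure)
qed

text \<open>
  Passing to complements, \<open>\<nu> B = \<nu> A - \<nu> (A - B)\<close>, turns the supremum of \<open>\<nu>\<close> over the subsets of \<open>A\<close>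
  into \<open>\<nu> A\<close> plus the supremum of \<open>- \<nu>\<close>.
\<close>

lemma jordan_decomposition:
  assumes \<nu>: "\<nu> \<in> signed_measures M" and A: "A \<in> sets M"
  shows "\<nu> A = measure (pos_part M \<nu>) A - measure (neg_part M \<nu>) A"
proof -
  note \<nu>' = signed_measure_uminus[OF \<nu>]
  have *: "measure (pos_part M \<nu>) A \<le> \<nu> A + measure (pos_part M (\<lambda>A. - \<nu> A)) A"
    if \<nu>: "\<nu> \<in> signed_measures M" for \<nu>
  proof (rule measure_pos_part_le[OF \<nu> A])
    note \<nu>' = signed_measure_uminus[OF \<nu>]
    show "0 \<le> \<nu> A + measure (pos_part M (\<lambda>A. - \<nu> A)) A"
      using le_measure_pos_part[OF \<nu>' A A] by simp
    show "\<nu> B \<le> \<nu> A + measure (pos_part M (\<lambda>A. - \<nu> A)) A" if "B \<in> sets M" "B \<subseteq> A" for B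
      using le_measure_pos_part[OF \<nu>' A, of "A - B"] signed_measure_Diff[OF \<nu> A that] that A by auto
  qed
  show ?thesis using *[OF \<nu>] *[OF \<nu>'] unfolding neg_part_def by simp
qed

lemma signed_measure_diff:
  assumes "finite_measure P" "finite_measure N" "sets P = sets M" "sets N = sets M"
  shows "(\<lambda>A. measure P A - measure N A) \<in> signed_measures M"
proof -
  interpret P: finite_measure P by fact
  interpret N: finite_measure N by fact
  show ?thesis using assms(3,4) P.finite_measure_UNION N.finite_measure_UNION
    by (auto simp: signed_measures_def intro!: sums_diff)
qed

text \<open>
  Avoids forming the sum of two measures: the identity \<open>P + N' = P' + N\<close> is carried from sets to
  nonnegative functions by measurable induction, and then to bounded functions by adding a constant.
\<close>

lemma integral_sum_measures:
  assumes fin: "finite_measure P" "finite_measure N" "finite_measure P'" "finite_measure N'"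
    and sets: "sets P = sets M" "sets N = sets M" "sets P' = sets M" "sets N' = sets M"
    and eq: "\<And>A. A \<in> sets M \<Longrightarrow> measure P A + measure N' A = measure P' A + measure N A"
    and f: "f \<in> borel_measurable M" and B: "\<And>x. x \<in> space M \<Longrightarrow> \<bar>f x\<bar> \<le> (B::real)"
  shows "(\<integral>x. f x \<partial>P) - (\<integral>x. f x \<partial>N) = (\<integral>x. f x \<partial>P') - (\<integral>x. f x \<partial>N')"
proof -
  interpret P: finite_measure P by fact
  interpret N: finite_measure N by fact
  interpret P': finite_measure P' by fact
  interpret N': finite_measure N' by fact
  have meas: "g \<in> borel_measurable P" "g \<in> borel_measurable N" "g \<in> borel_measurable P'" "g \<in> borel_measurable N'"
    if "g \<in> borel_measurable M" for g :: "_ \<Rightarrow> 'z::topological_space"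
    using that sets by (auto cong: measurable_cong_sets)
  have sp: "space P = space M" "space N = space M" "space P' = space M" "space N' = space M"
    using sets by (auto dest: sets_eq_imp_space_eq)
  have nn: "(\<integral>\<^sup>+x. g x \<partial>P) + (\<integral>\<^sup>+x. g x \<partial>N') = (\<integral>\<^sup>+x. g x \<partial>P') + (\<integral>\<^sup>+x. g x \<partial>N)"
    if "g \<in> borel_measurable M" for g
    using that
  proof (induction rule: borel_measurable_induct)
    case (cong f g)
    have "integral\<^sup>N Q f = integral\<^sup>N Q g" if "space Q = space M" for Q
      using cong(3) that by (intro nn_integral_cong) auto
    then show ?case using cong(4) sp by simp
  next
    case (set A)
    then show ?case
      using eq[OF set] sets
      by (simp add: P.emeasure_eq_measure N.emeasure_eq_measure P'.emeasure_eq_measure N'.emeasure_eq_measure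
          flip: ennreal_plus)
  next
    case (mult u c)
    then show ?case using meas[OF mult(2)] by (simp add: nn_integral_cmult flip: distrib_left)
  next
    case (add u v)
    have "(\<integral>\<^sup>+x. v x + u x \<partial>P) + (\<integral>\<^sup>+x. v x + u x \<partial>N') =
       ((\<integral>\<^sup>+x. v x \<partial>P) + (\<integral>\<^sup>+x. v x \<partial>N')) + ((\<integral>\<^sup>+x. u x \<partial>P) + (\<integral>\<^sup>+x. u x \<partial>N'))"
      using meas[OF add(1)] meas[OF add(3)] by (simp add: nn_integral_add ac_simps)
    also have "\<dots> = (\<integral>\<^sup>+x. v x + u x \<partial>P') + (\<integral>\<^sup>+x. v x + u x \<partial>N)"
      using add meas[OF add(1)] meas[OF add(3)] by (simp add: nn_integral_add ac_simps)
    finally show ?case .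
  next
    case (seq U)
    have lim: "(\<lambda>i. integral\<^sup>N Q (U i)) \<longlonglongrightarrow> integral\<^sup>N Q (SUP i. U i)" if "\<And>i. U i \<in> borel_measurable Q" for Q
    proof -
      have "(SUP i. U i) = (\<lambda>x. SUP i. U i x)" by (rule ext) (simp add: image_comp)
      then have "integral\<^sup>N Q (SUP i. U i) = (\<integral>\<^sup>+x. (SUP i. U i x) \<partial>Q)" by simp
      also have "\<dots> = (SUP i. integral\<^sup>N Q (U i))"
        by (rule nn_integral_monotone_convergence_SUP[OF \<open>incseq U\<close> that])
      finally show ?thesis
        using LIMSEQ_SUP[of "\<lambda>i. integral\<^sup>N Q (U i)"] \<open>incseq U\<close>
        by (auto simp: incseq_def le_fun_def intro!: nn_integral_mono)
    qed
    have l1: "(\<lambda>i. integral\<^sup>N P (U i) + integral\<^sup>N N' (U i)) \<longlonglongrightarrow> integral\<^sup>N P (SUP i. U i) + integral\<^sup>N N' (SUP i. U i)"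
      by (intro tendsto_add lim meas seq.hyps(1))
    have l2: "(\<lambda>i. integral\<^sup>N P' (U i) + integral\<^sup>N N (U i)) \<longlonglongrightarrow> integral\<^sup>N P' (SUP i. U i) + integral\<^sup>N N (SUP i. U i)"
      by (intro tendsto_add lim meas seq.hyps(1))
    show ?case using LIMSEQ_unique[OF l1[unfolded seq.IH] l2] \<open>g = (SUP i. U i)\<close> by (simp only:)
  qed
  define g where "g x = f x + B" for x
  have gm: "g \<in> borel_measurable M" using f unfolding g_def by measurable
  have g0: "0 \<le> g x" if "x \<in> space M" for x using B[OF that] by (simp add: g_def)
  have int: "(\<integral>\<^sup>+x. ennreal (g x) \<partial>Q) = ennreal ((\<integral>x. f x \<partial>Q) + B * measure Q (space M))"
    "0 \<le> (\<integral>x. f x \<partial>Q) + B * measure Q (space M)"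
    if "finite_measure Q" "space Q = space M" "f \<in> borel_measurable Q" for Q
  proof -
    interpret Q: finite_measure Q by fact
    have fi: "integrable Q f" by (rule Q.integrable_const_bound[where B = B]) (use that B in auto)
    have gi: "integrable Q g" unfolding g_def using fi by simp
    have "(\<integral>x. g x \<partial>Q) = (\<integral>x. f x \<partial>Q) + B * measure Q (space M)"
      unfolding g_def using fi that by simp
    moreover have "(\<integral>\<^sup>+x. ennreal (g x) \<partial>Q) = ennreal (\<integral>x. g x \<partial>Q)"
      by (rule nn_integral_eq_integral[OF gi]) (use g0 that in auto)
    moreover have "0 \<le> (\<integral>x. g x \<partial>Q)" by (rule integral_nonneg_AE) (use g0 that in auto)
    ultimately show "(\<integral>\<^sup>+x. ennreal (g x) \<partial>Q) = ennreal ((\<integral>x. f x \<partial>Q) + B * measure Q (space M))"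
      "0 \<le> (\<integral>x. f x \<partial>Q) + B * measure Q (space M)" by auto
  qed
  note iP = int[OF fin(1) sp(1) meas(1)[OF f]] and iN = int[OF fin(2) sp(2) meas(2)[OF f]]
    and iP' = int[OF fin(3) sp(3) meas(3)[OF f]] and iN' = int[OF fin(4) sp(4) meas(4)[OF f]]
  have "((\<integral>x. f x \<partial>P) + B * measure P (space M)) + ((\<integral>x. f x \<partial>N') + B * measure N' (space M)) =
      ((\<integral>x. f x \<partial>P') + B * measure P' (space M)) + ((\<integral>x. f x \<partial>N) + B * measure N (space M))"
    using nn[of "\<lambda>x. ennreal (g x)"] gm iP iN iP' iN' by (simp flip: ennreal_plus)
  moreover have "B * measure P (space M) + B * measure N' (space M) = B * measure P' (space M) + B * measure N (space M)"
    using eq[OF sets.top] by (simp flip: distrib_left)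
  ultimately show ?thesis by simp
qed

lemma signed_integral_diff:
  assumes PN: "finite_measure P" "finite_measure N" "sets P = sets M" "sets N = sets M"
    and f: "f \<in> borel_measurable M" "\<And>x. x \<in> space M \<Longrightarrow> \<bar>f x\<bar> \<le> B"
  shows "signed_integral M (\<lambda>A. measure P A - measure N A) f = (\<integral>x. f x \<partial>P) - (\<integral>x. f x \<partial>N)"
  unfolding signed_integral_def
proof (rule integral_sum_measures[where M = M and B = B])
  note sm = signed_measure_diff[OF PN]
  show "measure (pos_part M (\<lambda>A. measure P A - measure N A)) A + measure N A
      = measure P A + measure (neg_part M (\<lambda>A. measure P A - measure N A)) A" if "A \<in> sets M" for A
    using jordan_decomposition[OF sm that] by simp
qed (use assms finite_pos_part[OF signed_measure_diff[OF PN]] finite_neg_part[OF signed_measure_diff[OF PN]] in auto)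

lemma RN_deriv_integral_bounded:
  assumes \<Lambda>: "finite_measure \<Lambda>" "sets \<Lambda> = sets M"
    and N: "finite_measure N" "sets N = sets M"
    and ac: "absolutely_continuous \<Lambda> N"
    and f: "f \<in> borel_measurable M" "\<And>x. x \<in> space M \<Longrightarrow> \<bar>f x\<bar> \<le> (B::real)"
  shows "integrable \<Lambda> (\<lambda>x. enn2real (RN_deriv \<Lambda> N x) * f x)"
    and "(\<integral>x. f x \<partial>N) = (\<integral>x. enn2real (RN_deriv \<Lambda> N x) * f x \<partial>\<Lambda>)"
proof -
  interpret \<Lambda>: finite_measure \<Lambda> by fact
  interpret N: finite_measure N by fact
  have s: "sets N = sets \<Lambda>" using \<Lambda> N by simp
  have fm: "f \<in> borel_measurable \<Lambda>" "f \<in> borel_measurable N"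
    using f(1) \<Lambda>(2) N(2) by (auto cong: measurable_cong_sets)
  have "integrable N f" by (rule N.integrable_const_bound[where B = B])
    (use fm f(2) sets_eq_imp_space_eq[OF N(2)] in auto)
  then show "integrable \<Lambda> (\<lambda>x. enn2real (RN_deriv \<Lambda> N x) * f x)"
    using \<Lambda>.RN_deriv_integrable[OF N.sigma_finite_measure_axioms ac s fm(1)] by simp
  show "(\<integral>x. f x \<partial>N) = (\<integral>x. enn2real (RN_deriv \<Lambda> N x) * f x \<partial>\<Lambda>)"
    by (rule \<Lambda>.RN_deriv_integral[OF N.sigma_finite_measure_axioms ac s fm(1)])
qed

lemma signed_integral_RN_deriv:
  assumes \<nu>: "\<nu> \<in> signed_measures M"
    and \<Lambda>: "finite_measure \<Lambda>" "sets \<Lambda> = sets M"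
    and dom: "\<And>A. A \<in> sets M \<Longrightarrow> emeasure \<Lambda> A = 0 \<Longrightarrow> \<nu> A = 0"
    and f: "f \<in> borel_measurable M" "\<And>x. x \<in> space M \<Longrightarrow> \<bar>f x\<bar> \<le> B"
  shows "integrable \<Lambda> (\<lambda>x. signed_RN_deriv M \<Lambda> \<nu> x * f x)"
    and "signed_integral M \<nu> f = (\<integral>x. signed_RN_deriv M \<Lambda> \<nu> x * f x \<partial>\<Lambda>)"
proof -
  have ac: "absolutely_continuous \<Lambda> (pos_part M \<nu>)"
    if \<nu>: "\<nu> \<in> signed_measures M" and dom: "\<And>A. A \<in> sets M \<Longrightarrow> emeasure \<Lambda> A = 0 \<Longrightarrow> \<nu> A = 0" for \<nu>
  proof -
    have "emeasure (pos_part M \<nu>) A = 0" if A: "A \<in> sets M" "emeasure \<Lambda> A = 0" for A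
    proof -
      have "\<nu> B = 0" if "B \<in> sets M" "B \<subseteq> A" for B
        using dom[OF that(1)] emeasure_mono[of B A \<Lambda>] that A \<Lambda>(2) by auto
      then show ?thesis unfolding emeasure_pos_part[OF \<nu> A(1)] by (auto intro!: antisym SUP_least)
    qed
    then show ?thesis unfolding absolutely_continuous_def null_sets_def using \<Lambda>(2) by auto
  qed
  note P = RN_deriv_integral_bounded[OF \<Lambda> finite_pos_part[OF \<nu>] sets_pos_part ac[OF \<nu> dom] f, simplified]
  have acN: "absolutely_continuous \<Lambda> (neg_part M \<nu>)"
    unfolding neg_part_def by (rule ac[OF signed_measure_uminus[OF \<nu>]]) (use dom in auto)
  note N = RN_deriv_integral_bounded[OF \<Lambda> finite_neg_part[OF \<nu>] sets_neg_part acN f, simplified]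
  have eq: "signed_RN_deriv M \<Lambda> \<nu> x * f x =
     enn2real (RN_deriv \<Lambda> (pos_part M \<nu>) x) * f x - enn2real (RN_deriv \<Lambda> (neg_part M \<nu>) x) * f x" for x
    by (simp add: signed_RN_deriv_def algebra_simps)
  show "integrable \<Lambda> (\<lambda>x. signed_RN_deriv M \<Lambda> \<nu> x * f x)" unfolding eq by (intro Bochner_Integration.integrable_diff P N)
  show "signed_integral M \<nu> f = (\<integral>x. signed_RN_deriv M \<Lambda> \<nu> x * f x \<partial>\<Lambda>)"
    unfolding eq signed_integral_def using P N by simp
qed

lemma emeasure_total_variation:
  fixes \<mu> :: "'x set \<Rightarrow> 'b::real_normed_vector"
  assumes \<mu>0: "\<mu> {} = 0"
    and sums: "\<And>A :: nat \<Rightarrow> 'x set. range A \<subseteq> sets M \<Longrightarrow> disjoint_family A \<Longrightarrow> (\<lambda>i. \<mu> (A i)) sums \<mu> (\<Union>i. A i)"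
    and A: "A \<in> sets M"
  shows "emeasure (total_variation M \<mu>) A =
    (SUP P\<in>{P. finite P \<and> P \<subseteq> sets M \<and> partition_on A P}. \<Sum>B\<in>P. ennreal (norm (\<mu> B)))"
  unfolding total_variation_def
proof (rule emeasure_superadditive_subadditive[OF _ _ _ A])
  let ?T = "\<lambda>A. {P. finite P \<and> P \<subseteq> sets M \<and> partition_on A P}"
  let ?s = "\<lambda>P. \<Sum>B\<in>P. ennreal (norm (\<mu> B))"
  let ?V = "\<lambda>A. SUP P\<in>?T A. ?s P"
  have "?T {} = {{}}" by (auto simp: partition_on_empty)
  then show "?V {} = 0" by simp
  have T_ne: "?T A \<noteq> {}" if "A \<in> sets M" for A
  proof (cases "A = {}")
    case False
    then have "{A} \<in> ?T A" using that by (auto simp: partition_on_space)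
    then show ?thesis by blast
  qed (use \<open>?T {} = {{}}\<close> in auto)
  show "?V A + ?V A' \<le> ?V (A \<union> A')" if A: "A \<in> sets M" "A' \<in> sets M" "A \<inter> A' = {}" for A A'
  proof -
    have *: "?s P + ?s Q \<le> ?V (A \<union> A')" if PQ: "P \<in> ?T A" "Q \<in> ?T A'" for P Q
    proof -
      have "B \<notin> Q" if B: "B \<in> P" for B
      proof
        assume "B \<in> Q"
        then have "B \<subseteq> A \<inter> A'" "B \<noteq> {}" using B PQ by (auto simp: partition_on_def)
        then show False using A(3) by simp
      qed
      then have "P \<inter> Q = {}" by blast
      then have "?s P + ?s Q = ?s (P \<union> Q)" using PQ by (intro sum.union_disjoint[symmetric]) auto
      also have "P \<union> Q \<in> ?T (A \<union> A')" using PQ A by (auto simp: partition_on_def intro!: disjoint_union)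
      then have "?s (P \<union> Q) \<le> ?V (A \<union> A')" by (rule SUP_upper)
      finally show ?thesis .
    qed
    have "?V A + ?V A' = (SUP P\<in>?T A. ?s P + ?V A')"
      by (rule ennreal_SUP_add_left[symmetric, OF T_ne[OF A(1)]])
    also have "\<dots> = (SUP P\<in>?T A. SUP Q\<in>?T A'. ?s P + ?s Q)"
      by (intro SUP_cong refl ennreal_SUP_add_right T_ne A)
    also have "\<dots> \<le> ?V (A \<union> A')" by (intro SUP_least *)
    finally show ?thesis .
  qed
  show "?V (\<Union>i. F i) \<le> (\<Sum>i. ?V (F i))" if F: "range F \<subseteq> sets M" "disjoint_family F" for F :: "nat \<Rightarrow> 'x set"
  proof (rule SUP_least)
    fix P assume P: "P \<in> ?T (\<Union>i. F i)"
    have UP: "\<Union>P = (\<Union>i. F i)" using P by (simp add: partition_on_def)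
    have disj: "B \<inter> B' = {}" if "B \<in> P" "B' \<in> P" "B \<noteq> B'" for B B'
      using P that by (simp add: partition_on_def disjoint_def)
    have "ennreal (norm (\<mu> B)) \<le> (\<Sum>i. ennreal (norm (\<mu> (B \<inter> F i))))" if B: "B \<in> P" for B
    proof -
      have "(\<lambda>i. \<mu> (B \<inter> F i)) sums \<mu> (\<Union>i. B \<inter> F i)"
        using P B F by (intro sums) (auto simp: disjoint_family_on_def)
      also have "(\<Union>i. B \<inter> F i) = B" using P B by (auto simp: partition_on_def)
      finally show ?thesis by (rule ennreal_norm_le_suminf)
    qed
    then have "?s P \<le> (\<Sum>B\<in>P. \<Sum>i. ennreal (norm (\<mu> (B \<inter> F i))))" by (rule sum_mono)
    also have "\<dots> = (\<Sum>i. \<Sum>B\<in>P. ennreal (norm (\<mu> (B \<inter> F i))))" by (rule suminf_sum[symmetric]) auto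
    also have "\<dots> \<le> (\<Sum>i. ?V (F i))"
    proof (rule suminf_le)
      fix i
      have "(\<Sum>B\<in>P. ennreal (norm (\<mu> (B \<inter> F i)))) = (\<Sum>B\<in>{B\<in>P. B \<inter> F i \<noteq> {}}. ennreal (norm (\<mu> (B \<inter> F i))))"
        using P \<mu>0 by (intro sum.mono_neutral_right) auto
      also have "\<dots> = ?s ((\<lambda>B. B \<inter> F i) ` {B\<in>P. B \<inter> F i \<noteq> {}})"
      proof (rule sum.reindex_cong[symmetric, OF _ refl refl])
        show "inj_on (\<lambda>B. B \<inter> F i) {B\<in>P. B \<inter> F i \<noteq> {}}"
        proof (rule inj_onI)
          fix B B' assume B: "B \<in> {B\<in>P. B \<inter> F i \<noteq> {}}" "B' \<in> {B\<in>P. B \<inter> F i \<noteq> {}}" "B \<inter> F i = B' \<inter> F i"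
          then have "B \<inter> B' \<noteq> {}" by auto
          then show "B = B'" using B disj by auto
        qed
      qed
      also have "\<dots> \<le> ?V (F i)"
      proof (rule SUP_upper)
        have "partition_on (F i) ((\<lambda>B. B \<inter> F i) ` {B\<in>P. B \<inter> F i \<noteq> {}})"
        proof (rule partition_onI)
          show "\<Union> ((\<lambda>B. B \<inter> F i) ` {B\<in>P. B \<inter> F i \<noteq> {}}) = F i"
          proof (intro equalityI subsetI)
            fix x assume x: "x \<in> F i"
            then have "x \<in> \<Union>P" unfolding UP by blast
            then obtain B where "B \<in> P" "x \<in> B" ..
            then show "x \<in> \<Union> ((\<lambda>B. B \<inter> F i) ` {B\<in>P. B \<inter> F i \<noteq> {}})" using x by blast
          qed auto
          fix D D' assume "D \<in> (\<lambda>B. B \<inter> F i) ` {B\<in>P. B \<inter> F i \<noteq> {}}" "D' \<in> (\<lambda>B. B \<inter> F i) ` {B\<in>P. B \<inter> F i \<noteq> {}}" "D \<noteq> D'"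
          then obtain B B' where "B \<in> P" "B' \<in> P" "D = B \<inter> F i" "D' = B' \<inter> F i" "B \<noteq> B'" by auto
          then show "disjnt D D'" using disj[of B B'] by (auto simp: disjnt_def)
        qed auto
        then show "(\<lambda>B. B \<inter> F i) ` {B\<in>P. B \<inter> F i \<noteq> {}} \<in> ?T (F i)" using P F by auto
      qed
      finally show "(\<Sum>B\<in>P. ennreal (norm (\<mu> (B \<inter> F i)))) \<le> ?V (F i)" .
    qed auto
    finally show "?s P \<le> (\<Sum>i. ?V (F i))" .
  qed
qed

lemma norm_le_total_variation:
  fixes \<mu> :: "'x set \<Rightarrow> 'b::real_normed_vector"
  assumes \<mu>0: "\<mu> {} = 0"
    and sums: "\<And>A :: nat \<Rightarrow> 'x set. range A \<subseteq> sets M \<Longrightarrow> disjoint_family A \<Longrightarrow> (\<lambda>i. \<mu> (A i)) sums \<mu> (\<Union>i. A i)"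
    and A: "A \<in> sets M"
  shows "ennreal (norm (\<mu> A)) \<le> emeasure (total_variation M \<mu>) A"
proof (cases "A = {}")
  case False
  then have "{A} \<in> {P. finite P \<and> P \<subseteq> sets M \<and> partition_on A P}" using A by (auto simp: partition_on_space)
  then have "(\<Sum>B\<in>{A}. ennreal (norm (\<mu> B))) \<le>
      (SUP P\<in>{P. finite P \<and> P \<subseteq> sets M \<and> partition_on A P}. \<Sum>B\<in>P. ennreal (norm (\<mu> B)))"
    by (rule SUP_upper)
  also have "\<dots> = emeasure (total_variation M \<mu>) A"
    by (rule emeasure_total_variation[where \<mu> = \<mu>, symmetric, OF \<mu>0 _ A]) (rule sums)
  finally show ?thesis by simp
qed (simp add: \<mu>0)

lemma sets_total_variation [simp]: "sets (total_variation M \<mu>) = sets M"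
  and space_total_variation [simp]: "space (total_variation M \<mu>) = space M"
  by (simp_all add: total_variation_def sets.space_closed)

lemma sums_vec:
  fixes f :: "nat \<Rightarrow> real^'n"
  assumes "\<And>i. (\<lambda>n. f n $ i) sums (s $ i)" shows "f sums s"
  using assms unfolding sums_def by (intro vec_tendstoI) simp

lemma sums_Pair:
  assumes "f sums s" "g sums t" shows "(\<lambda>n. (f n, g n)) sums (s, t)"
proof -
  have "(\<Sum>i<n. (f i, g i)) = (\<Sum>i<n. f i, \<Sum>i<n. g i)" for n by (induction n) (auto simp: zero_prod_def)
  then show ?thesis using assms unfolding sums_def by (auto intro: tendsto_Pair)
qed

lemma joint_sums:
  assumes "\<rho> \<in> signed_measures M" "\<And>i. \<omega> i \<in> signed_measures M" "\<zeta> \<in> signed_measures M"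
    and "range A \<subseteq> sets M" "disjoint_family A"
  shows "(\<lambda>n::nat. joint (\<rho>, \<omega>, \<zeta>) (A n)) sums joint (\<rho>, \<omega>, \<zeta>) (\<Union>n. A n)"
  unfolding joint_def prod.case
  by (intro sums_Pair sums_vec) (simp_all add: signed_measure_sums[OF _ assms(4,5)] assms(1-3))

text \<open>
  The Euclidean norm is at most the sum of the moduli of the components, so the total variations of the
  components bound that of the triple.
\<close>

lemma total_variation_joint:
  assumes sm: "\<rho> \<in> signed_measures M" "\<And>i::'d::finite. \<omega> i \<in> signed_measures M" "\<zeta> \<in> signed_measures M"
  shows "finite_measure (total_variation M (joint (\<rho>, \<omega>, \<zeta>)))"
    and "\<And>A. A \<in> sets M \<Longrightarrow> emeasure (total_variation M (joint (\<rho>, \<omega>, \<zeta>))) A = 0 \<Longrightarrow> joint (\<rho>, \<omega>, \<zeta>) A = 0"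
proof -
  let ?j = "joint (\<rho>, \<omega>, \<zeta>)"
  have j0: "?j {} = 0"
    by (simp add: joint_def signed_measure_empty[OF sm(1)] signed_measure_empty[OF sm(2)]
        signed_measure_empty[OF sm(3)] zero_prod_def vec_eq_iff)
  show "?j A = 0" if A: "A \<in> sets M" "emeasure (total_variation M ?j) A = 0" for A
  proof -
    have "ennreal (norm (?j A)) \<le> emeasure (total_variation M ?j) A"
      by (rule norm_le_total_variation[where \<mu> = ?j, OF j0 _ A(1)]) (rule joint_sums[OF sm])
    then show ?thesis using A(2) by simp
  qed
  let ?m = "\<lambda>\<nu> A. measure (pos_part M \<nu>) A + measure (neg_part M \<nu>) A"
  define b where "b A = ?m \<rho> A + (\<Sum>i\<in>UNIV. ?m (\<omega> i) A) + ?m \<zeta> A" for A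
  have le: "\<bar>\<nu> A\<bar> \<le> ?m \<nu> A" if "\<nu> \<in> signed_measures M" "A \<in> sets M" for \<nu> A
    using jordan_decomposition[OF that] by (auto simp: abs_le_iff intro: add_increasing add_increasing2)
  have norm_le: "norm (?j A) \<le> b A" if A: "A \<in> sets M" for A
  proof -
    have "norm (?j A) \<le> \<bar>\<rho> A\<bar> + (norm (\<chi> i. \<omega> i A) + \<bar>\<zeta> A\<bar>)"
      unfolding joint_def prod.case
      using norm_Pair_le[of "\<rho> A" "(\<chi> i. \<omega> i A, \<zeta> A)"] norm_Pair_le[of "\<chi> i. \<omega> i A" "\<zeta> A"]
      by (simp only: real_norm_def)
    also have "norm (\<chi> i. \<omega> i A) \<le> (\<Sum>i\<in>UNIV. \<bar>\<omega> i A\<bar>)"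
      using norm_le_l1_cart[of "\<chi> i. \<omega> i A"] by simp
    also have "\<dots> \<le> (\<Sum>i\<in>UNIV. ?m (\<omega> i) A)" by (intro sum_mono le sm A)
    finally show ?thesis using le[OF sm(1) A] le[OF sm(3) A] by (simp add: b_def)
  qed
  have part: "(\<Sum>B\<in>P. b B) = b (space M)" if P: "finite P" "P \<subseteq> sets M" "partition_on (space M) P" for P
  proof -
    have Q: "(\<Sum>B\<in>P. measure Q B) = measure Q (space M)" if "finite_measure Q" "sets Q = sets M" for Q
    proof -
      interpret Q: finite_measure Q by fact
      have "measure Q (\<Union>B\<in>P. B) = (\<Sum>B\<in>P. measure Q B)"
        using P that by (intro Q.finite_measure_finite_Union) (auto simp: partition_on_def disjoint_family_on_def disjoint_def)
      then show ?thesis using P by (simp add: partition_on_def)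
    qed
    have m: "(\<Sum>B\<in>P. ?m \<nu> B) = ?m \<nu> (space M)" if "\<nu> \<in> signed_measures M" for \<nu>
      using Q[OF finite_pos_part[OF that]] Q[OF finite_neg_part[OF that]] by (simp add: sum.distrib)
    have "(\<Sum>B\<in>P. \<Sum>i\<in>UNIV. ?m (\<omega> i) B) = (\<Sum>i\<in>UNIV. ?m (\<omega> i) (space M))"
      by (subst sum.swap) (simp only: m[OF sm(2)])
    then show ?thesis unfolding b_def sum.distrib[where A = P] using m[OF sm(1)] m[OF sm(3)] by (simp add: sum.distrib)
  qed
  have "emeasure (total_variation M ?j) (space M) =
      (SUP P\<in>{P. finite P \<and> P \<subseteq> sets M \<and> partition_on (space M) P}. \<Sum>B\<in>P. ennreal (norm (?j B)))"
    by (rule emeasure_total_variation[where \<mu> = ?j, OF j0 _ sets.top]) (rule joint_sums[OF sm])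
  also have "\<dots> \<le> ennreal (b (space M))"
  proof (rule SUP_least)
    fix P assume P: "P \<in> {P. finite P \<and> P \<subseteq> sets M \<and> partition_on (space M) P}"
    have "(\<Sum>B\<in>P. ennreal (norm (?j B))) = ennreal (\<Sum>B\<in>P. norm (?j B))" by simp
    also have "\<dots> \<le> ennreal (\<Sum>B\<in>P. b B)" using P by (intro ennreal_leI sum_mono norm_le) auto
    finally show "(\<Sum>B\<in>P. ennreal (norm (?j B))) \<le> ennreal (b (space M))" using part P by auto
  qed
  finally show "finite_measure (total_variation M ?j)"
    by (intro finite_measureI) (auto simp: top_unique)
qed

section \<open>Approximation of bounded measurable functions by continuous ones\<close>

lemma borel_measurable_inclusion:
  assumes "sets M = sets (restrict_space borel K)" shows "(\<lambda>x. x) \<in> measurable M borel"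
  using measurable_restrict_space1[OF measurable_ident, of borel K] assms
  by (simp add: id_def cong: measurable_cong_sets)

text \<open>
  Regularity encloses the set between a compact and an open set of almost the same measure, and
  Urysohn's lemma interpolates between these two.
\<close>

lemma indicator_approx_continuous:
  fixes K :: "'a::euclidean_space set"
  assumes M: "finite_measure M" "sets M = sets (restrict_space borel K)" and K: "closed K"
    and A: "A \<in> sets M" and e: "e > 0"
  shows "\<exists>g::'a \<Rightarrow> real. continuous_on UNIV g \<and> (\<forall>x. 0 \<le> g x \<and> g x \<le> 1) \<and> (\<integral>x. \<bar>indicator A x - g x\<bar> \<partial>M) \<le> e"
proof -
  interpret M: finite_measure M by fact
  have spM: "space M = K" using sets_eq_imp_space_eq[OF M(2)] by (simp add: space_restrict_space)
  have Km: "K \<in> sets borel" using K by auto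
  have sM: "B \<inter> K \<in> sets M" if "B \<in> sets borel" for B
    using that M(2) by (auto simp: sets_restrict_space)
  note idm = borel_measurable_inclusion[OF M(2)]
  define D where "D = distr M borel (\<lambda>x. x)"
  interpret D: finite_measure D unfolding D_def by (rule M.finite_measure_distr[OF idm])
  have AK: "A \<subseteq> K" using sets.sets_into_space[OF A] spM by simp
  have AB: "A \<in> sets borel" using A M(2) Km by (auto simp: sets_restrict_space)
  have mD: "measure D B = measure M (B \<inter> K)" if "B \<in> sets borel" for B
    unfolding D_def using that idm spM by (subst measure_distr) (auto simp: Int_commute)
  have sD: "sets D = sets borel" by (simp add: D_def)
  have fD: "emeasure D (space D) \<noteq> \<infinity>" by simp
  have "\<exists>C. C \<subseteq> A \<and> compact C \<and> measure D A - e/2 < measure D C"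
  proof (rule ccontr)
    assume n: "\<not> ?thesis"
    have "emeasure D A = (SUP K\<in>{K. K \<subseteq> A \<and> compact K}. emeasure D K)" by (rule inner_regular[OF sD fD AB])
    also have "\<dots> \<le> ennreal (max 0 (measure D A - e/2))"
    proof (rule SUP_least)
      fix C assume "C \<in> {K. K \<subseteq> A \<and> compact K}"
      then have "measure D C \<le> measure D A - e/2" using n by force
      then show "emeasure D C \<le> ennreal (max 0 (measure D A - e/2))"
        unfolding D.emeasure_eq_measure by (intro ennreal_leI) auto
    qed
    finally have le: "measure D A \<le> max 0 (measure D A - e/2)" unfolding D.emeasure_eq_measure by simp
    have "measure D {} \<le> measure D A - e/2" using n by force
    then show False using le e by auto
  qed
  then obtain C where C: "C \<subseteq> A" "compact C" "measure D A - e/2 < measure D C" by blast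
  have "\<exists>U. A \<subseteq> U \<and> open U \<and> measure D U < measure D A + e/2"
  proof (rule ccontr)
    assume n: "\<not> ?thesis"
    have "ennreal (measure D A + e/2) \<le> (INF U\<in>{U. A \<subseteq> U \<and> open U}. emeasure D U)"
    proof (rule INF_greatest)
      fix U assume "U \<in> {U. A \<subseteq> U \<and> open U}"
      then have "measure D A + e/2 \<le> measure D U" using n by force
      then show "ennreal (measure D A + e/2) \<le> emeasure D U"
        unfolding D.emeasure_eq_measure by (rule ennreal_leI)
    qed
    also have "\<dots> = emeasure D A" by (rule outer_regular[OF sD fD AB, symmetric])
    finally show False using e unfolding D.emeasure_eq_measure by simp
  qed
  then obtain U where U: "A \<subseteq> U" "open U" "measure D U < measure D A + e/2" by blast
  obtain g :: "'a \<Rightarrow> real" where g: "continuous_on UNIV g" "\<And>x. g x \<in> closed_segment 1 0"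
      "\<And>x. x \<in> C \<Longrightarrow> g x = 1" "\<And>x. x \<in> - U \<Longrightarrow> g x = 0"
    by (rule Urysohn[of C "- U" 1 0]) (use C U compact_imp_closed in auto)
  have g01: "0 \<le> g x" "g x \<le> 1" for x using g(2)[of x] by (auto simp: closed_segment_eq_real_ivl)
  have gm: "g \<in> borel_measurable M"
    using measurable_compose[OF idm borel_measurable_continuous_onI[OF g(1)]] .
  have UC: "U - C \<in> sets borel" using borel_open[OF U(2)] borel_compact[OF C(2)] by (rule sets.Diff)
  have "(\<integral>x. \<bar>indicator A x - g x\<bar> \<partial>M) \<le> (\<integral>x. indicator ((U - C) \<inter> K) x \<partial>M)"
  proof (rule integral_mono)
    have "norm \<bar>indicator A x - g x\<bar> \<le> 1" for x using g01[of x] by (auto simp: indicator_def)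
    then show "integrable M (\<lambda>x. \<bar>indicator A x - g x\<bar>)"
      by (intro M.integrable_const_bound[where B = 1] AE_I2) (use gm A in auto)
    show "integrable M (\<lambda>x. indicator ((U - C) \<inter> K) x :: real)"
      using sM[OF UC] by (auto simp: M.emeasure_eq_measure)
    fix x assume "x \<in> space M"
    then show "\<bar>indicator A x - g x\<bar> \<le> indicator ((U - C) \<inter> K) x"
      using g01[of x] g(3)[of x] g(4)[of x] C(1) U(1) by (auto simp: indicator_def spM)
  qed
  also have "\<dots> = measure M ((U - C) \<inter> K)" using sM[OF UC] sets.sets_into_space[OF sM[OF UC]] by (simp add: Int_absorb1 Int_absorb2)
  also have "\<dots> = measure D (U - C)" by (rule mD[OF UC, symmetric])
  also have "\<dots> = measure D U - measure D C"
    using C U borel_compact[OF C(2)] borel_open[OF U(2)] by (intro D.finite_measure_Diff) (auto simp: sD)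
  also have "\<dots> \<le> e" using C(3) U(3) by simp
  finally show ?thesis using g(1) g01 by blast
qed

lemma bounded_approx_continuous:
  fixes K :: "'a::euclidean_space set" and f :: "'a \<Rightarrow> real"
  assumes M: "finite_measure M" "sets M = sets (restrict_space borel K)" and K: "closed K"
    and f: "f \<in> borel_measurable M" "\<And>x. \<bar>f x\<bar> \<le> B" and e: "e > 0"
  shows "\<exists>g. continuous_on UNIV g \<and> (\<forall>x. \<bar>g x\<bar> \<le> B) \<and> (\<integral>x. \<bar>f x - g x\<bar> \<partial>M) < e"
proof -
  interpret M: finite_measure M by fact
  note idm = borel_measurable_inclusion[OF M(2)]
  have contm: "g \<in> borel_measurable M" if "continuous_on UNIV g" for g :: "'a \<Rightarrow> real"
    using measurable_compose[OF idm borel_measurable_continuous_onI[OF that]] .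
  have gi: "integrable M g" if "continuous_on UNIV g" "\<forall>x. \<bar>g x\<bar> \<le> b" for g and b :: real
    by (rule M.integrable_const_bound[where B = b]) (use that contm in auto)
  have "integrable M f" by (rule M.integrable_const_bound[where B = B]) (use f in auto)
  then have "\<forall>e>0. \<exists>g b. continuous_on UNIV g \<and> (\<forall>x. \<bar>g x\<bar> \<le> b) \<and> (\<integral>x. \<bar>f x - g x\<bar> \<partial>M) < e"
  proof (induction rule: integrable_induct)
    case (base A c)
    show ?case
    proof (intro allI impI)
      fix e :: real assume e: "e > 0"
      define e' where "e' = e / (2 * (\<bar>c\<bar> + 1))"
      have e': "e' > 0" using e by (simp add: e'_def)
      obtain g where g: "continuous_on UNIV g" "\<And>x. 0 \<le> g x \<and> g x \<le> 1" "(\<integral>x. \<bar>indicator A x - g x\<bar> \<partial>M) \<le> e'"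
        using indicator_approx_continuous[OF M K base(1) e'] by blast
      have "(\<integral>x. \<bar>indicator A x *\<^sub>R c - g x * c\<bar> \<partial>M) = (\<integral>x. \<bar>c\<bar> * \<bar>indicator A x - g x\<bar> \<partial>M)"
        by (intro Bochner_Integration.integral_cong) (auto simp: abs_mult[symmetric] algebra_simps)
      also have "\<dots> = \<bar>c\<bar> * (\<integral>x. \<bar>indicator A x - g x\<bar> \<partial>M)" by simp
      also have "\<dots> \<le> \<bar>c\<bar> * e'" using g by (intro mult_left_mono) auto
      also have "\<bar>c\<bar> * e' < (2 * (\<bar>c\<bar> + 1)) * e'" using e' by (intro mult_strict_right_mono) auto
      also have "\<dots> = e" by (simp add: e'_def)
      finally have "(\<integral>x. \<bar>indicator A x *\<^sub>R c - g x * c\<bar> \<partial>M) < e" .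
      moreover have "\<bar>g x * c\<bar> \<le> \<bar>c\<bar>" for x using g(2)[of x] by (simp add: abs_mult mult_left_le_one_le)
      moreover have "continuous_on UNIV (\<lambda>x. g x * c)" by (intro continuous_intros g)
      ultimately show "\<exists>g b. continuous_on UNIV g \<and> (\<forall>x. \<bar>g x\<bar> \<le> b) \<and> (\<integral>x. \<bar>indicator A x *\<^sub>R c - g x\<bar> \<partial>M) < e"
        by blast
    qed
  next
    case (add f f')
    show ?case
    proof (intro allI impI)
      fix e :: real assume "e > 0"
      then have e: "e/2 > 0" by simp
      obtain g b where g: "continuous_on UNIV g" "\<forall>x. \<bar>g x\<bar> \<le> b" "(\<integral>x. \<bar>f x - g x\<bar> \<partial>M) < e/2"
        using add.IH(1) e by blast
      obtain g' b' where g': "continuous_on UNIV g'" "\<forall>x. \<bar>g' x\<bar> \<le> b'" "(\<integral>x. \<bar>f' x - g' x\<bar> \<partial>M) < e/2"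
        using add.IH(2) e by blast
      have "(\<integral>x. \<bar>(f x + f' x) - (g x + g' x)\<bar> \<partial>M) \<le> (\<integral>x. \<bar>f x - g x\<bar> + \<bar>f' x - g' x\<bar> \<partial>M)"
        using add.hyps gi[OF g(1,2)] gi[OF g'(1,2)] by (intro integral_mono) auto
      also have "\<dots> = (\<integral>x. \<bar>f x - g x\<bar> \<partial>M) + (\<integral>x. \<bar>f' x - g' x\<bar> \<partial>M)"
        using add.hyps gi[OF g(1,2)] gi[OF g'(1,2)] by (intro Bochner_Integration.integral_add) auto
      also have "\<dots> < e" using g g' by simp
      finally have "(\<integral>x. \<bar>(f x + f' x) - (g x + g' x)\<bar> \<partial>M) < e" .
      moreover have "\<bar>g x + g' x\<bar> \<le> b + b'" for x
        using g(2) g'(2) by (meson abs_triangle_ineq add_mono order_trans)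
      moreover have "continuous_on UNIV (\<lambda>x. g x + g' x)" by (intro continuous_intros g g')
      ultimately show "\<exists>g b. continuous_on UNIV g \<and> (\<forall>x. \<bar>g x\<bar> \<le> b) \<and> (\<integral>x. \<bar>(f x + f' x) - g x\<bar> \<partial>M) < e"
        by blast
    qed
  next
    case (lim f s)
    show ?case
    proof (intro allI impI)
      fix e :: real assume "e > 0"
      then have e: "e/2 > 0" by simp
      have fm: "f \<in> borel_measurable M" and sm: "\<And>i. s i \<in> borel_measurable M" using lim by auto
      have "(\<lambda>i. \<integral>x. \<bar>f x - s i x\<bar> \<partial>M) \<longlonglongrightarrow> (\<integral>x. 0 \<partial>M)"
      proof (rule integral_dominated_convergence[where w = "\<lambda>x. 3 * \<bar>f x\<bar>"])
        show "integrable M (\<lambda>x. 3 * \<bar>f x\<bar>)" using lim by auto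
        show "AE x in M. (\<lambda>i. \<bar>f x - s i x\<bar>) \<longlonglongrightarrow> 0"
        proof (rule AE_I2)
          fix x assume "x \<in> space M"
          then have "(\<lambda>i. s i x) \<longlonglongrightarrow> f x" using lim by blast
          from tendsto_rabs[OF tendsto_diff[OF tendsto_const[of "f x"] this]]
          show "(\<lambda>i. \<bar>f x - s i x\<bar>) \<longlonglongrightarrow> 0" by simp
        qed
        show "AE x in M. norm \<bar>f x - s i x\<bar> \<le> 3 * \<bar>f x\<bar>" for i
        proof (rule AE_I2)
          fix x assume "x \<in> space M"
          then have "\<bar>s i x\<bar> \<le> 2 * \<bar>f x\<bar>" using lim by fastforce
          then show "norm \<bar>f x - s i x\<bar> \<le> 3 * \<bar>f x\<bar>" by simp
        qed
      qed (use fm sm in auto)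
      then have "(\<lambda>i. \<integral>x. \<bar>f x - s i x\<bar> \<partial>M) \<longlonglongrightarrow> 0" by simp
      from order_tendstoD(2)[OF this e] obtain i where i: "(\<integral>x. \<bar>f x - s i x\<bar> \<partial>M) < e/2"
        by (auto simp: eventually_sequentially)
      obtain g b where g: "continuous_on UNIV g" "\<forall>x. \<bar>g x\<bar> \<le> b" "(\<integral>x. \<bar>s i x - g x\<bar> \<partial>M) < e/2"
        using lim.IH e by blast
      have "(\<integral>x. \<bar>f x - g x\<bar> \<partial>M) \<le> (\<integral>x. \<bar>f x - s i x\<bar> + \<bar>s i x - g x\<bar> \<partial>M)"
        using lim.hyps gi[OF g(1,2)] by (intro integral_mono) auto
      also have "\<dots> = (\<integral>x. \<bar>f x - s i x\<bar> \<partial>M) + (\<integral>x. \<bar>s i x - g x\<bar> \<partial>M)"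
        using lim.hyps gi[OF g(1,2)] by (intro Bochner_Integration.integral_add) auto
      also have "\<dots> < e" using g i by simp
      finally show "\<exists>g b. continuous_on UNIV g \<and> (\<forall>x. \<bar>g x\<bar> \<le> b) \<and> (\<integral>x. \<bar>f x - g x\<bar> \<partial>M) < e"
        using g by blast
    qed
  qed
  then obtain g b where g: "continuous_on UNIV g" "\<forall>x. \<bar>g x\<bar> \<le> b" "(\<integral>x. \<bar>f x - g x\<bar> \<partial>M) < e"
    using e by blast
  define h where "h x = max (- B) (min B (g x))" for x
  have B0: "0 \<le> B" using f(2)[of undefined] by simp
  have hc: "continuous_on UNIV h" unfolding h_def by (intro continuous_intros g)
  have hB: "\<forall>x. \<bar>h x\<bar> \<le> B" using B0 by (auto simp: h_def)
  have "(\<integral>x. \<bar>f x - h x\<bar> \<partial>M) \<le> (\<integral>x. \<bar>f x - g x\<bar> \<partial>M)"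
  proof (rule integral_mono)
    show "\<bar>f x - h x\<bar> \<le> \<bar>f x - g x\<bar>" for x using f(2)[of x] by (auto simp: h_def max_def min_def)
  qed (use \<open>integrable M f\<close> gi[OF g(1,2)] gi[OF hc hB] in auto)
  then show ?thesis using g(3) hc hB by (intro exI[of _ h]) auto
qed

text \<open>
  A uniform bound together with convergence almost everywhere is what dominated convergence needs.
  The finitely many functions share one subsequence because the sum of all errors converges to 0 in
  the mean.
\<close>

lemma family_approx_continuous:
  fixes K :: "'a::euclidean_space set" and f :: "'i::finite \<Rightarrow> 'a \<Rightarrow> real"
  assumes M: "finite_measure M" "sets M = sets (restrict_space borel K)" and K: "closed K"
    and f: "\<And>i. f i \<in> borel_measurable M" "\<And>i x. \<bar>f i x\<bar> \<le> B"
  shows "\<exists>g. (\<forall>n i. continuous_on UNIV (g n i)) \<and> (\<forall>n i x. \<bar>g n i x\<bar> \<le> B) \<and>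
    (AE x in M. \<forall>i. (\<lambda>n::nat. g n i x) \<longlonglongrightarrow> f i x)"
proof -
  interpret M: finite_measure M by fact
  define P where "P n i g \<longleftrightarrow> continuous_on UNIV g \<and> (\<forall>x. \<bar>g x\<bar> \<le> B) \<and> (\<integral>x. \<bar>f i x - g x\<bar> \<partial>M) < 1 / real (Suc n)" for n i g
  have "\<exists>g. P n i g" for i n
    unfolding P_def by (rule bounded_approx_continuous[OF M K f]) simp
  then have "\<forall>n. \<forall>i. \<exists>g. P n i g" by blast
  then have "\<forall>n. \<exists>g. \<forall>i. P n i (g i)" by (intro allI choice) simp
  then have "\<exists>g. \<forall>n i. P n i (g n i)" by (rule choice)
  then obtain g where "\<forall>n i. P n i (g n i)" ..
  then have g: "\<And>n i. continuous_on UNIV (g n i)" "\<And>n i x. \<bar>g n i x\<bar> \<le> B"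
    "\<And>n i. (\<integral>x. \<bar>f i x - g n i x\<bar> \<partial>M) < 1 / real (Suc n)" by (simp_all add: P_def)
  note idm = borel_measurable_inclusion[OF M(2)]
  have int: "integrable M (\<lambda>x. \<bar>f i x - g n i x\<bar>)" for n i
  proof -
    have "g n i \<in> borel_measurable M"
      using measurable_compose[OF idm borel_measurable_continuous_onI[OF g(1)]] .
    then have "integrable M (f i)" "integrable M (g n i)"
      by (auto intro!: M.integrable_const_bound[where B = B] f g)
    then show ?thesis by auto
  qed
  define u where "u n x = (\<Sum>i\<in>UNIV. \<bar>f i x - g n i x\<bar>)" for n x
  have ui: "integrable M (u n)" for n unfolding u_def[abs_def] by (intro Bochner_Integration.integrable_sum int)
  have u0: "0 \<le> u n x" for n x unfolding u_def by (intro sum_nonneg) auto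
  have "(\<lambda>n. \<integral>x. norm (u n x) \<partial>M) \<longlonglongrightarrow> 0"
  proof (rule tendsto_sandwich[where f = "\<lambda>_. 0" and h = "\<lambda>n. real CARD('i) * (1 / real (Suc n))"])
    have "(\<integral>x. norm (u n x) \<partial>M) \<le> real CARD('i) * (1 / real (Suc n))" for n
    proof -
      have "(\<integral>x. norm (u n x) \<partial>M) = (\<integral>x. u n x \<partial>M)" using u0 by simp
      also have "\<dots> = (\<Sum>i\<in>UNIV. \<integral>x. \<bar>f i x - g n i x\<bar> \<partial>M)"
        unfolding u_def by (intro Bochner_Integration.integral_sum int)
      also have "\<dots> \<le> (\<Sum>i\<in>(UNIV::'i set). 1 / real (Suc n))" using g(3) by (intro sum_mono) (auto simp: less_imp_le)
      finally show ?thesis by simp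
    qed
    then show "\<forall>\<^sub>F n in sequentially. (\<integral>x. norm (u n x) \<partial>M) \<le> real CARD('i) * (1 / real (Suc n))" by simp
    show "(\<lambda>n. real CARD('i) * (1 / real (Suc n))) \<longlonglongrightarrow> 0"
      using tendsto_mult_left[OF LIMSEQ_Suc[OF lim_const_over_n[of 1]], of "real CARD('i)"] by simp
  qed auto
  from tendsto_L1_AE_subseq[OF ui this] obtain r where r: "strict_mono (r::nat \<Rightarrow> nat)" "AE x in M. (\<lambda>n. u (r n) x) \<longlonglongrightarrow> 0"
    by blast
  have "AE x in M. \<forall>i. (\<lambda>n. g (r n) i x) \<longlonglongrightarrow> f i x"
    using r(2)
  proof (eventually_elim, intro allI)
    fix x i assume u: "(\<lambda>n. u (r n) x) \<longlonglongrightarrow> 0"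
    have "(\<lambda>n. f i x - g (r n) i x) \<longlonglongrightarrow> 0"
    proof (rule Lim_null_comparison[OF _ u])
      have "norm (f i x - g (r n) i x) \<le> u (r n) x" for n
        unfolding u_def real_norm_def by (rule member_le_sum[of i UNIV "\<lambda>i. \<bar>f i x - g (r n) i x\<bar>"]) auto
      then show "\<forall>\<^sub>F n in sequentially. norm (f i x - g (r n) i x) \<le> u (r n) x" by simp
    qed
    from tendsto_diff[OF tendsto_const[of "f i x"] this] show "(\<lambda>n. g (r n) i x) \<longlonglongrightarrow> f i x" by simp
  qed
  then show ?thesis using g by (intro exI[of _ "\<lambda>n. g (r n)"]) auto
qed

section \<open>Test functions on the cylinder\<close>

text \<open>
  At a boundary point the coordinate directions need not point into \<open>K\<close>.  The derivative is
  determined on all differences \<open>y - x\<close> with \<open>y \<in> K\<close> by restricting to segments, and as \<open>K\<close> has interior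
  points these differences span the space.
\<close>

lemma has_derivative_within_convex_unique:
  fixes f :: "'a::euclidean_space \<Rightarrow> 'b::real_normed_vector"
  assumes K: "convex K" "interior K \<noteq> {}" and x: "x \<in> K"
    and F: "(f has_derivative F) (at x within K)" and G: "(f has_derivative G) (at x within K)"
  shows "F = G"
proof -
  obtain y0 where "y0 \<in> interior K" using K(2) by blast
  then obtain r where r: "r > 0" "ball y0 r \<subseteq> K"
    by (meson interior_subset mem_interior)
  have lin: "linear F" "linear G" using F G by (auto intro: has_derivative_linear)
  have eq: "F (y - x) = G (y - x)" if y: "y \<in> K" for y
  proof -
    have path: "((\<lambda>t. f (x + t *\<^sub>R (y - x))) has_vector_derivative D (y - x)) (at 0 within {0..1})"
      if D: "(f has_derivative D) (at x within K)" for D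
    proof -
      let ?g = "\<lambda>t::real. x + t *\<^sub>R (y - x)"
      have sub: "?g ` {0..1} \<subseteq> K"
      proof
        fix z assume "z \<in> ?g ` {0..1}"
        then obtain t where t: "0 \<le> t" "t \<le> 1" "z = x + t *\<^sub>R (y - x)" by auto
        have "z = (1 - t) *\<^sub>R x + t *\<^sub>R y" unfolding t(3) by (simp add: algebra_simps)
        then show "z \<in> K" using convexD[OF K(1) x y, of "1 - t" t] t by simp
      qed
      have g: "(?g has_derivative (\<lambda>t. t *\<^sub>R (y - x))) (at 0 within {0..1})"
        by (auto intro!: derivative_eq_intros)
      have "(f has_derivative D) (at (?g 0) within ?g ` {0..1})"
        using has_derivative_subset[OF D sub] by simp
      from has_derivative_in_compose[OF g this]
      have "((\<lambda>t. f (?g t)) has_derivative (\<lambda>t. D (t *\<^sub>R (y - x)))) (at 0 within {0..1})" .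
      then show ?thesis
        using linear_scale[OF has_derivative_linear[OF D]] by (simp add: has_vector_derivative_def)
    qed
    show ?thesis
      by (rule vector_derivative_unique_within_closed_interval[unfolded cbox_interval, OF _ _ path[OF F] path[OF G]]) auto
  qed
  show ?thesis
  proof
    fix v :: 'a
    obtain s :: real where s: "s > 0" "norm (s *\<^sub>R v) < r"
    proof (cases "v = 0")
      case False
      then show ?thesis using r(1) that[of "r / (2 * norm v)"] by (simp add: field_simps)
    qed (use that[of 1] r in auto)
    have "y0 + s *\<^sub>R v \<in> K" "y0 \<in> K" using r s by (auto simp: dist_norm subset_iff)
    from eq[OF this(1)] eq[OF this(2)]
    have "F (y0 + s *\<^sub>R v - x) - F (y0 - x) = G (y0 + s *\<^sub>R v - x) - G (y0 - x)" by simp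
    then have "F (s *\<^sub>R v) = G (s *\<^sub>R v)"
      using linear_diff[OF lin(1), of "y0 + s *\<^sub>R v - x" "y0 - x"]
        linear_diff[OF lin(2), of "y0 + s *\<^sub>R v - x" "y0 - x"] by simp
    then show "F v = G v" using s(1) by (simp add: linear_scale[OF lin(1)] linear_scale[OF lin(2)])
  qed
qed

text \<open>
  Where \<open>g\<close> has no zero, \<open>1 / g\<close> increases at rate at least \<open>1 / (2 D)\<close>.  As \<open>g\<close> is nonincreasing,
  \<open>g 1 > 0\<close> excludes zeros and gives \<open>1 / g 1 \<ge> 1 / (2 D)\<close>; the case \<open>g 0 < 0\<close> is symmetric.
\<close>

lemma riccati_bounds:
  fixes g :: "real \<Rightarrow> real"
  assumes D: "D > 0"
    and g: "\<And>t. t \<in> {0..1} \<Longrightarrow> (g has_real_derivative g' t) (at t within {0..1})"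
    and le: "\<And>t. t \<in> {0..1} \<Longrightarrow> g' t \<le> - (g t)\<^sup>2 / (2 * D)"
  shows "g 1 \<le> 2 * D" and "- (2 * D) \<le> g 0"
proof -
  have neg: "g' t \<le> 0" if "t \<in> {0..1}" for t
    using le[OF that] D by (smt (verit) divide_nonneg_pos minus_divide_left zero_le_power2)
  have mono: "g b \<le> g a" if "0 \<le> a" "a \<le> b" "b \<le> 1" for a b
  proof (cases "a = b")
    case False
    then have ab: "a < b" using that by simp
    have "\<exists>x\<in>{a<..<b}. g b - g a = (\<lambda>h. g' x * h) (b - a)"
    proof (rule mvt_simple[OF ab])
      fix x assume "a \<le> x" "x \<le> b"
      then have "(g has_derivative (\<lambda>h. g' x * h)) (at x within {0..1})"
        using g[of x] that by (simp add: has_field_derivative_def)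
      then show "(g has_derivative (\<lambda>h. g' x * h)) (at x within {a..b})"
        by (rule has_derivative_subset) (use that in auto)
    qed
    then obtain x where "x \<in> {a<..<b}" "g b - g a = g' x * (b - a)" by auto
    then show ?thesis using neg[of x] that mult_nonpos_nonneg[of "g' x" "b - a"] by auto
  qed simp
  have inv: "1 / (2 * D) \<le> 1 / g 1 - 1 / g 0" if nz: "\<And>t. t \<in> {0..1} \<Longrightarrow> g t \<noteq> 0"
  proof -
    have "\<exists>x\<in>{0<..<1}. inverse (g 1) - inverse (g 0) = (\<lambda>h. - (g' x * inverse ((g x)\<^sup>2)) * h) (1 - 0 :: real)"
    proof (rule mvt_simple)
      fix x :: real assume x: "0 \<le> x" "x \<le> 1"
      have "((\<lambda>t. inverse (g t)) has_real_derivative - (g' x * inverse ((g x) ^ Suc (Suc 0)))) (at x within {0..1})"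
        by (rule DERIV_inverse_fun[OF g nz]) (use x in auto)
      then show "((\<lambda>t. inverse (g t)) has_derivative (\<lambda>h. - (g' x * inverse ((g x)\<^sup>2)) * h)) (at x within {0..1})"
        by (simp only: has_field_derivative_def numeral_2_eq_2)
    qed simp
    then obtain x where x: "x \<in> {0<..<1}" "inverse (g 1) - inverse (g 0) = - (g' x * inverse ((g x)\<^sup>2))" by auto
    have p: "(g x)\<^sup>2 > 0" using nz[of x] x by simp
    have "(g x)\<^sup>2 / (2 * D) \<le> - g' x" using le[of x] x by simp
    then have "((g x)\<^sup>2 / (2 * D)) * inverse ((g x)\<^sup>2) \<le> - g' x * inverse ((g x)\<^sup>2)"
      using p by (intro mult_right_mono) auto
    also have "((g x)\<^sup>2 / (2 * D)) * inverse ((g x)\<^sup>2) = 1 / (2 * D)" using p by (simp add: field_simps)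
    finally show ?thesis using x by (simp add: inverse_eq_divide)
  qed
  show "g 1 \<le> 2 * D"
  proof (cases "g 1 > 0")
    case True
    have "1 / (2 * D) \<le> 1 / g 1 - 1 / g 0" using mono[of _ 1] True by (intro inv) fastforce
    moreover have "1 / g 0 > 0" using mono[of 0 1] True by simp
    ultimately have "1 / (2 * D) \<le> 1 / g 1" by linarith
    then show ?thesis using D True by (simp add: field_simps)
  qed (use D in auto)
  show "- (2 * D) \<le> g 0"
  proof (cases "g 0 < 0")
    case True
    have "1 / (2 * D) \<le> 1 / g 1 - 1 / g 0" using mono[of 0] True by (intro inv) fastforce
    moreover have "1 / g 1 < 0" using mono[of 0 1] True by simp
    ultimately have "1 / (2 * D) \<le> - (1 / g 0)" by linarith
    then show ?thesis using D True by (simp add: field_simps)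
  qed (use D in auto)
qed

locale convex_domain =
  fixes \<Omega> :: "(real^'d) set"
  assumes open_dom: "open \<Omega>" and bounded_dom: "bounded \<Omega>" and convex_dom: "convex \<Omega>" and ne_dom: "\<Omega> \<noteq> {}"
begin

lemma compact_cyl: "compact (cyl \<Omega>)"
  unfolding cyl_def using bounded_dom by (intro compact_Times) auto

lemma closed_cyl: "closed (cyl \<Omega>)" by (rule compact_imp_closed[OF compact_cyl])

lemma convex_cyl: "convex (cyl \<Omega>)"
  unfolding cyl_def by (intro convex_Times convex_closure convex_dom) auto

lemma open_cyl_subset_interior: "{0<..<1} \<times> \<Omega> \<subseteq> interior (cyl \<Omega>)"
  by (rule interior_maximal) (auto simp: cyl_def closure_subset[THEN subsetD] intro!: open_Times open_dom)

lemma interior_cyl_ne: "interior (cyl \<Omega>) \<noteq> {}"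
proof -
  obtain x where "x \<in> \<Omega>" using ne_dom by blast
  then have "(1/2::real, x) \<in> {0<..<1} \<times> \<Omega>" by simp
  then show ?thesis using open_cyl_subset_interior by blast
qed

lemma cyl_subset_closure: "cyl \<Omega> \<subseteq> closure ({0<..<1} \<times> \<Omega>)"
  unfolding cyl_def closure_Times by (intro Sigma_mono) auto

lemma C1_has_derivative:
  assumes "\<phi> \<in> C1 \<Omega>" "p \<in> cyl \<Omega>"
  shows "(\<phi> has_derivative (\<lambda>q. fst q * time_deriv \<Omega> \<phi> p + space_grad \<Omega> \<phi> p \<bullet> snd q)) (at p within cyl \<Omega>)"
proof -
  let ?D = "frechet_derivative \<phi> (at p within cyl \<Omega>)"
  have d: "(\<phi> has_derivative ?D) (at p within cyl \<Omega>)"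
    using assms by (auto simp: C1_def differentiable_on_def frechet_derivative_works[symmetric])
  then have lin: "linear ?D" by (rule has_derivative_linear)
  have "?D q = fst q * time_deriv \<Omega> \<phi> p + space_grad \<Omega> \<phi> p \<bullet> snd q" for q
  proof -
    have "q = fst q *\<^sub>R (1, 0) + (\<Sum>i\<in>UNIV. snd q $ i *\<^sub>R (0, axis i 1))"
    proof (rule prod_eqI)
      have "snd q = (\<Sum>i\<in>UNIV. snd q $ i *\<^sub>R axis i 1)"
        using basis_expansion[of "snd q"] by (simp add: scalar_mult_eq_scaleR)
      then show "snd q = snd (fst q *\<^sub>R (1, 0) + (\<Sum>i\<in>UNIV. snd q $ i *\<^sub>R (0, axis i 1)))"
        by (simp add: snd_sum)
    qed (simp add: fst_sum)
    then have "?D q = ?D (fst q *\<^sub>R (1, 0) + (\<Sum>i\<in>UNIV. snd q $ i *\<^sub>R (0, axis i 1)))" by simp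
    also have "\<dots> = fst q * ?D (1, 0) + (\<Sum>i\<in>UNIV. snd q $ i * ?D (0, axis i 1))"
      by (simp only: linear_add[OF lin] linear_sum[OF lin] linear_scale[OF lin] real_scaleR_def)
    finally show ?thesis by (simp add: time_deriv_def space_grad_def inner_vec_def mult.commute)
  qed
  then have "?D = (\<lambda>q. fst q * time_deriv \<Omega> \<phi> p + space_grad \<Omega> \<phi> p \<bullet> snd q)" by blast
  then show ?thesis using d by simp
qed

text \<open>
  The only way in which derivatives of concrete functions enter: by uniqueness of derivatives
  relative to the cylinder, any continuous candidates are the derivatives of the definition.
\<close>

lemma C1_I:
  assumes d: "\<And>p. p \<in> cyl \<Omega> \<Longrightarrow> (\<phi> has_derivative (\<lambda>q. fst q * a p + b p \<bullet> snd q)) (at p within cyl \<Omega>)"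
    and a: "continuous_on (cyl \<Omega>) a" and b: "continuous_on (cyl \<Omega>) b"
  shows "\<phi> \<in> C1 \<Omega>" and "\<And>p. p \<in> cyl \<Omega> \<Longrightarrow> time_deriv \<Omega> \<phi> p = a p"
    and "\<And>p. p \<in> cyl \<Omega> \<Longrightarrow> space_grad \<Omega> \<phi> p = b p"
proof -
  have diff: "\<phi> differentiable (at p within cyl \<Omega>)" if "p \<in> cyl \<Omega>" for p
    using d[OF that] unfolding differentiable_def by blast
  have fd: "frechet_derivative \<phi> (at p within cyl \<Omega>) = (\<lambda>q. fst q * a p + b p \<bullet> snd q)" if "p \<in> cyl \<Omega>" for p
    by (rule has_derivative_within_convex_unique[OF convex_cyl interior_cyl_ne that])
      (use diff[OF that] d[OF that] frechet_derivative_works in auto)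
  show t: "time_deriv \<Omega> \<phi> p = a p" if "p \<in> cyl \<Omega>" for p
    by (simp add: time_deriv_def fd[OF that])
  show s: "space_grad \<Omega> \<phi> p = b p" if "p \<in> cyl \<Omega>" for p
    by (simp add: space_grad_def fd[OF that] inner_axis)
  show "\<phi> \<in> C1 \<Omega>"
    unfolding C1_def differentiable_on_def
    using diff continuous_on_eq[OF a t[symmetric]] continuous_on_eq[OF b s[symmetric]] by auto
qed

lemma C1_continuous: "\<phi> \<in> C1 \<Omega> \<Longrightarrow> continuous_on (cyl \<Omega>) \<phi>"
  by (simp add: C1_def differentiable_imp_continuous_on)

lemma C1_continuous_derivs:
  assumes "\<phi> \<in> C1 \<Omega>"
  shows "continuous_on (cyl \<Omega>) (time_deriv \<Omega> \<phi>)" "continuous_on (cyl \<Omega>) (space_grad \<Omega> \<phi>)"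
  using assms by (simp_all add: C1_def)

lemma C1_lincomb:
  assumes "\<phi> \<in> C1 \<Omega>" "\<psi> \<in> C1 \<Omega>"
  shows "(\<lambda>p. r * \<phi> p + s * \<psi> p) \<in> C1 \<Omega>"
    and "\<And>p. p \<in> cyl \<Omega> \<Longrightarrow> time_deriv \<Omega> (\<lambda>p. r * \<phi> p + s * \<psi> p) p = r * time_deriv \<Omega> \<phi> p + s * time_deriv \<Omega> \<psi> p"
    and "\<And>p. p \<in> cyl \<Omega> \<Longrightarrow> space_grad \<Omega> (\<lambda>p. r * \<phi> p + s * \<psi> p) p = r *\<^sub>R space_grad \<Omega> \<phi> p + s *\<^sub>R space_grad \<Omega> \<psi> p"
proof -
  have d: "((\<lambda>p. r * \<phi> p + s * \<psi> p) has_derivative (\<lambda>q. fst q * (r * time_deriv \<Omega> \<phi> p + s * time_deriv \<Omega> \<psi> p)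
      + (r *\<^sub>R space_grad \<Omega> \<phi> p + s *\<^sub>R space_grad \<Omega> \<psi> p) \<bullet> snd q)) (at p within cyl \<Omega>)" if "p \<in> cyl \<Omega>" for p
    using has_derivative_add[OF has_derivative_mult_right[OF C1_has_derivative[OF assms(1) that], of r]
      has_derivative_mult_right[OF C1_has_derivative[OF assms(2) that], of s]]
    by (simp add: algebra_simps)
  have c: "continuous_on (cyl \<Omega>) (\<lambda>p. r * time_deriv \<Omega> \<phi> p + s * time_deriv \<Omega> \<psi> p)"
    "continuous_on (cyl \<Omega>) (\<lambda>p. r *\<^sub>R space_grad \<Omega> \<phi> p + s *\<^sub>R space_grad \<Omega> \<psi> p)"
    using C1_continuous_derivs[OF assms(1)] C1_continuous_derivs[OF assms(2)] by (auto intro!: continuous_intros)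
  show "(\<lambda>p. r * \<phi> p + s * \<psi> p) \<in> C1 \<Omega>"
    "\<And>p. p \<in> cyl \<Omega> \<Longrightarrow> time_deriv \<Omega> (\<lambda>p. r * \<phi> p + s * \<psi> p) p = r * time_deriv \<Omega> \<phi> p + s * time_deriv \<Omega> \<psi> p"
    "\<And>p. p \<in> cyl \<Omega> \<Longrightarrow> space_grad \<Omega> (\<lambda>p. r * \<phi> p + s * \<psi> p) p = r *\<^sub>R space_grad \<Omega> \<phi> p + s *\<^sub>R space_grad \<Omega> \<psi> p"
    using C1_I[OF d c] by auto
qed

lemmas C1_add = C1_lincomb[where r = 1 and s = 1, simplified]
lemmas C1_scale = C1_lincomb[where s = 0, simplified]

lemma C1_time:
  shows "(\<lambda>p. r * fst p) \<in> C1 \<Omega>"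
    and "\<And>p. p \<in> cyl \<Omega> \<Longrightarrow> time_deriv \<Omega> (\<lambda>p. r * fst p) p = r"
    and "\<And>p. p \<in> cyl \<Omega> \<Longrightarrow> space_grad \<Omega> (\<lambda>p. r * fst p) p = 0"
proof -
  have d: "((\<lambda>p. r * fst p) has_derivative (\<lambda>q. fst q * r + 0 \<bullet> snd q)) (at p within cyl \<Omega>)" for p
    by (auto intro!: derivative_eq_intros)
  show "(\<lambda>p. r * fst p) \<in> C1 \<Omega>"
    "\<And>p. p \<in> cyl \<Omega> \<Longrightarrow> time_deriv \<Omega> (\<lambda>p. r * fst p) p = r"
    "\<And>p. p \<in> cyl \<Omega> \<Longrightarrow> space_grad \<Omega> (\<lambda>p. r * fst p) p = 0"
    using C1_I[OF d] by auto
qed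

definition admissible :: "real \<Rightarrow> ('d spacetime \<Rightarrow> real) \<Rightarrow> bool" where
  "admissible \<delta> \<phi> \<longleftrightarrow> (\<forall>p\<in>cyl \<Omega>. (time_deriv \<Omega> \<phi> p, space_grad \<Omega> \<phi> p, \<phi> p) \<in> B_set \<delta>)"

lemma admissible_bounds:
  assumes "\<delta> > 0" "\<phi> \<in> C1 \<Omega>" "admissible \<delta> \<phi>" "x \<in> closure \<Omega>"
  shows "\<phi> (1, x) \<le> 2 * \<delta>\<^sup>2" and "- (2 * \<delta>\<^sup>2) \<le> \<phi> (0, x)"
proof -
  have d: "((\<lambda>t. \<phi> (t, x)) has_real_derivative time_deriv \<Omega> \<phi> (t, x)) (at t within {0..1})" if t: "t \<in> {0..1}" for t
  proof -
    have p: "(t, x) \<in> cyl \<Omega>" using t assms by (simp add: cyl_def)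
    have g: "((\<lambda>t. (t, x)) has_derivative (\<lambda>h. (h, 0))) (at t within {0..1})"
      by (auto intro!: derivative_eq_intros)
    have "(\<phi> has_derivative (\<lambda>q. fst q * time_deriv \<Omega> \<phi> (t, x) + space_grad \<Omega> \<phi> (t, x) \<bullet> snd q))
        (at (t, x) within (\<lambda>t. (t, x)) ` {0..1})"
      by (rule has_derivative_subset[OF C1_has_derivative[OF assms(2) p]]) (use assms in \<open>auto simp: cyl_def\<close>)
    from has_derivative_in_compose[OF g this] show ?thesis
      by (simp add: has_field_derivative_def mult_commute_abs)
  qed
  have aux: "a + 1/2 * (N + C) \<le> 0 \<Longrightarrow> 0 \<le> N \<Longrightarrow> a \<le> - (1/2 * C)" for a N C :: real by (simp add: field_simps)
  have le: "time_deriv \<Omega> \<phi> (t, x) \<le> - (\<phi> (t, x))\<^sup>2 / (2 * \<delta>\<^sup>2)" if t: "t \<in> {0..1}" for t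
  proof -
    have "(t, x) \<in> cyl \<Omega>" using t assms by (simp add: cyl_def)
    then have "time_deriv \<Omega> \<phi> (t, x) + 1/2 * ((norm (space_grad \<Omega> \<phi> (t, x)))\<^sup>2 + (\<phi> (t, x))\<^sup>2 / \<delta>\<^sup>2) \<le> 0"
      using assms(3) by (auto simp: admissible_def B_set_def)
    moreover have "0 \<le> (norm (space_grad \<Omega> \<phi> (t, x)))\<^sup>2" by simp
    ultimately have "time_deriv \<Omega> \<phi> (t, x) \<le> - (1/2 * ((\<phi> (t, x))\<^sup>2 / \<delta>\<^sup>2))"
      by (rule aux)
    then show ?thesis by simp
  qed
  show "\<phi> (1, x) \<le> 2 * \<delta>\<^sup>2" and "- (2 * \<delta>\<^sup>2) \<le> \<phi> (0, x)"
    using riccati_bounds[of "\<delta>\<^sup>2" "\<lambda>t. \<phi> (t, x)", OF _ d le] assms(1) by auto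
qed

lemma J_admissible:
  assumes "admissible \<delta> \<phi>"
  shows "J \<delta> \<Omega> \<rho>0 \<rho>1 \<phi> = ereal ((\<integral>x. \<phi> (0, x) \<partial>\<rho>0) - (\<integral>x. \<phi> (1, x) \<partial>\<rho>1))"
proof -
  have z: "convex_indicator (B_set \<delta>) (time_deriv \<Omega> \<phi> (t, x), space_grad \<Omega> \<phi> (t, x), \<phi> (t, x)) * indicator \<Omega> x = 0"
    if "t \<in> {0..1}" for t x
    using assms that closure_subset[of \<Omega>]
    by (auto simp: admissible_def cyl_def convex_indicator_def indicator_def)
  have z': "(\<integral>\<^sup>+ x\<in>\<Omega>. convex_indicator (B_set \<delta>) (time_deriv \<Omega> \<phi> (t, x), space_grad \<Omega> \<phi> (t, x), \<phi> (t, x)) \<partial>lborel)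
      * indicator {0..1} t = 0" for t :: real
  proof (cases "t \<in> {0..1}")
    case True
    show ?thesis by (simp only: z[OF True] nn_integral_const mult_zero_left)
  qed auto
  show ?thesis unfolding J_def z' nn_integral_const by (simp add: zero_ennreal.rep_eq)
qed

lemma open_emeasure_pos:
  assumes "open (B :: 'e::euclidean_space set)" "B \<noteq> {}" shows "emeasure lborel B \<noteq> 0"
proof
  assume "emeasure lborel B = 0"
  then have "B \<in> null_sets lborel" using assms by auto
  then have "B \<in> null_sets lebesgue" by (rule null_sets_completionI)
  then show False using open_not_negligible[OF assms] by (simp add: negligible_iff_null_sets)
qed

text \<open>
  The constraint function \<open>F\<close> is continuous on the closed cylinder and the open cylinder is dense in it,
  so a violation spreads to a product of nonempty open sets, which have positive Lebesgue measure.
\<close>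

lemma J_not_admissible:
  assumes \<phi>: "\<phi> \<in> C1 \<Omega>" and n: "\<not> admissible \<delta> \<phi>"
  shows "J \<delta> \<Omega> \<rho>0 \<rho>1 \<phi> = \<infinity>"
proof -
  define F where "F p = time_deriv \<Omega> \<phi> p + 1/2 * ((norm (space_grad \<Omega> \<phi> p))\<^sup>2 + (\<phi> p)\<^sup>2 / \<delta>\<^sup>2)" for p
  let ?b = "\<lambda>p. (time_deriv \<Omega> \<phi> p, space_grad \<Omega> \<phi> p, \<phi> p)"
  have B: "?b p \<in> B_set \<delta> \<longleftrightarrow> F p \<le> 0" for p by (simp add: B_set_def F_def)
  have Fc: "continuous_on (cyl \<Omega>) F"
    unfolding F_def divide_inverse using C1_continuous[OF \<phi>] C1_continuous_derivs[OF \<phi>]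
    by (intro continuous_intros)
  obtain p0 where p0: "p0 \<in> cyl \<Omega>" "F p0 > 0" using n B by (auto simp: admissible_def not_le)
  have "\<exists>q\<in>{0<..<1} \<times> \<Omega>. F q > 0"
  proof (rule ccontr)
    assume "\<not> ?thesis"
    then have le: "F q \<le> 0" if "q \<in> {0<..<1} \<times> \<Omega>" for q using that by force
    have "continuous_on (closure ({0<..<1} \<times> \<Omega>)) F"
      by (rule continuous_on_subset[OF Fc]) (auto simp: cyl_def closure_Times)
    then have "F p0 \<le> 0"
      by (rule continuous_le_on_closure) (use p0 cyl_subset_closure le in auto)
    then show False using p0 by simp
  qed
  then obtain q where q: "q \<in> {0<..<1} \<times> \<Omega>" "F q > 0" by blast
  have op: "open ({0<..<1::real} \<times> \<Omega>)" by (intro open_Times open_dom) auto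
  have "continuous_on ({0<..<1} \<times> \<Omega>) F"
    by (rule continuous_on_subset[OF Fc]) (use closure_subset in \<open>auto simp: cyl_def\<close>)
  then have "open (({0<..<1} \<times> \<Omega>) \<inter> F -` {0<..})"
    using op continuous_on_open_vimage[OF op] by (metis Int_commute open_greaterThan)
  moreover have "q \<in> ({0<..<1} \<times> \<Omega>) \<inter> F -` {0<..}" using q by auto
  ultimately obtain A C where AC: "open A" "open C" "q \<in> A \<times> C" "A \<times> C \<subseteq> ({0<..<1} \<times> \<Omega>) \<inter> F -` {0<..}"
    by (rule open_prod_elim)
  have mem: "x \<in> \<Omega>" "t \<in> {0..1}" "?b (t, x) \<notin> B_set \<delta>" if "t \<in> A" "x \<in> C" for t x
  proof -
    have "(t, x) \<in> ({0<..<1} \<times> \<Omega>) \<inter> F -` {0<..}" using AC(4) that by blast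
    then show "x \<in> \<Omega>" "t \<in> {0..1}" "?b (t, x) \<notin> B_set \<delta>" using B[of "(t, x)"] by auto
  qed
  have inner: "(\<integral>\<^sup>+ x\<in>\<Omega>. convex_indicator (B_set \<delta>) (?b (t, x)) \<partial>lborel) = \<infinity>" if t: "t \<in> A" for t
  proof -
    have "(\<integral>\<^sup>+ x. \<infinity> * indicator C x \<partial>lborel) \<le> (\<integral>\<^sup>+ x\<in>\<Omega>. convex_indicator (B_set \<delta>) (?b (t, x)) \<partial>lborel)"
      by (rule nn_integral_mono) (use mem[OF t] in \<open>auto simp: indicator_def convex_indicator_def\<close>)
    moreover have "(\<integral>\<^sup>+ x. \<infinity> * indicator C x \<partial>lborel) = \<infinity>"
      using AC open_emeasure_pos[OF AC(2)] by (subst nn_integral_cmult_indicator) (auto simp: ennreal_top_mult)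
    ultimately show ?thesis by (simp add: top_unique)
  qed
  have "(\<integral>\<^sup>+ t. \<infinity> * indicator A t \<partial>lborel) \<le>
      (\<integral>\<^sup>+ t\<in>{0..1}. (\<integral>\<^sup>+ x\<in>\<Omega>. convex_indicator (B_set \<delta>) (?b (t, x)) \<partial>lborel) \<partial>lborel)"
  proof (rule nn_integral_mono)
    fix t :: real
    obtain x where "x \<in> C" using AC by auto
    show "\<infinity> * indicator A t \<le> (\<integral>\<^sup>+ x\<in>\<Omega>. convex_indicator (B_set \<delta>) (?b (t, x)) \<partial>lborel) * indicator {0..1} t"
    proof (cases "t \<in> A")
      case True
      then show ?thesis using inner[OF True] mem(2)[OF True \<open>x \<in> C\<close>] by simp
    qed auto
  qed
  moreover have "(\<integral>\<^sup>+ t. \<infinity> * indicator A t \<partial>lborel) = (\<infinity>::ennreal)"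
    using AC open_emeasure_pos[OF AC(1)] by (subst nn_integral_cmult_indicator) (auto simp: ennreal_top_mult)
  ultimately have "(\<integral>\<^sup>+ t\<in>{0..1}. (\<integral>\<^sup>+ x\<in>\<Omega>. convex_indicator (B_set \<delta>) (?b (t, x)) \<partial>lborel) \<partial>lborel) = \<infinity>"
    by (simp add: top_unique)
  then show ?thesis unfolding J_def by simp
qed

end

section \<open>The action as a support functional\<close>

lemma f_delta_ge:
  assumes "\<delta> > 0" "p \<in> B_set \<delta>" shows "ennreal (p \<bullet> q) \<le> f_delta \<delta> q"
proof (cases "p \<bullet> q < 0")
  case False
  have "ereal (p \<bullet> q) - enn2ereal (convex_indicator (B_set \<delta>) p) \<le> enn2ereal (f_delta \<delta> q)"
    unfolding f_delta_eq_conjugate[OF assms(1)] by (rule SUP_upper) simp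
  then have "ereal (p \<bullet> q) \<le> enn2ereal (f_delta \<delta> q)"
    using assms(2) by (simp add: convex_indicator_def zero_ennreal.rep_eq)
  then show ?thesis using False by (simp add: less_eq_ennreal.rep_eq enn2ereal_ennreal)
qed (simp add: ennreal_neg)

lemma ennreal_integral_le_nn_integral:
  assumes "integrable M G" shows "ennreal (\<integral>x. G x \<partial>M) \<le> (\<integral>\<^sup>+x. ennreal (G x) \<partial>M)"
proof -
  have i: "integrable M (\<lambda>x. max 0 (G x))" using assms by auto
  have "ennreal (\<integral>x. G x \<partial>M) \<le> ennreal (\<integral>x. max 0 (G x) \<partial>M)"
    by (intro ennreal_leI integral_mono assms i) auto
  also have "\<dots> = (\<integral>\<^sup>+x. ennreal (max 0 (G x)) \<partial>M)"
    by (rule nn_integral_eq_integral[OF i, symmetric]) auto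
  also have "\<dots> = (\<integral>\<^sup>+x. ennreal (G x) \<partial>M)"
    by (intro nn_integral_cong) (auto simp: max_def ennreal_neg)
  finally show ?thesis .
qed

context convex_domain
begin

lemma space_cylM [simp]: "space (cylM \<Omega>) = cyl \<Omega>"
  by (simp add: cylM_def space_restrict_space)

lemma continuous_cyl_measurable:
  "continuous_on (cyl \<Omega>) f \<Longrightarrow> f \<in> borel_measurable (cylM \<Omega>)"
  unfolding cylM_def by (rule borel_measurable_continuous_on_restrict)

lemma continuous_cyl_bounded:
  fixes f :: "'d spacetime \<Rightarrow> real"
  assumes "continuous_on (cyl \<Omega>) f"
  obtains B where "\<And>p. p \<in> cyl \<Omega> \<Longrightarrow> \<bar>f p\<bar> \<le> B"
proof -
  have "bounded (f ` cyl \<Omega>)" by (intro compact_imp_bounded compact_continuous_image assms compact_cyl)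
  then show ?thesis using that by (auto simp: bounded_iff)
qed

text \<open>
  All components of a triple have densities with respect to the total variation of the triple, and
  the signed integrals are integrals against these densities.
\<close>

lemma triple_density:
  fixes \<omega> :: "'d \<Rightarrow> _"
  assumes sm: "\<rho> \<in> signed_measures (cylM \<Omega>)" "\<And>i. \<omega> i \<in> signed_measures (cylM \<Omega>)" "\<zeta> \<in> signed_measures (cylM \<Omega>)"
    and \<nu>: "\<nu> = \<rho> \<or> (\<exists>i. \<nu> = \<omega> i) \<or> \<nu> = \<zeta>"
    and f: "f \<in> borel_measurable (cylM \<Omega>)" "\<And>p. p \<in> cyl \<Omega> \<Longrightarrow> \<bar>f p\<bar> \<le> B"
  defines "\<Lambda> \<equiv> total_variation (cylM \<Omega>) (joint (\<rho>, \<omega>, \<zeta>))"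
  shows "integrable \<Lambda> (\<lambda>x. signed_RN_deriv (cylM \<Omega>) \<Lambda> \<nu> x * f x)"
    and "signed_integral (cylM \<Omega>) \<nu> f = (\<integral>x. signed_RN_deriv (cylM \<Omega>) \<Lambda> \<nu> x * f x \<partial>\<Lambda>)"
proof -
  have \<nu>s: "\<nu> \<in> signed_measures (cylM \<Omega>)" using \<nu> sm by auto
  have fin: "finite_measure \<Lambda>" unfolding \<Lambda>_def by (rule total_variation_joint(1)[OF sm])
  have sets: "sets \<Lambda> = sets (cylM \<Omega>)" by (simp add: \<Lambda>_def)
  have dom: "\<nu> A = 0" if "A \<in> sets (cylM \<Omega>)" "emeasure \<Lambda> A = 0" for A
    using total_variation_joint(2)[OF sm that[unfolded \<Lambda>_def]] \<nu>
    by (auto simp: joint_def zero_prod_def vec_eq_iff)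
  show "integrable \<Lambda> (\<lambda>x. signed_RN_deriv (cylM \<Omega>) \<Lambda> \<nu> x * f x)"
    "signed_integral (cylM \<Omega>) \<nu> f = (\<integral>x. signed_RN_deriv (cylM \<Omega>) \<Lambda> \<nu> x * f x \<partial>\<Lambda>)"
    using signed_integral_RN_deriv[OF \<nu>s fin sets dom f(1), of B] f(2) by simp_all
qed

lemma weak_duality:
  fixes \<mu> :: "'d triple"
  assumes \<delta>: "\<delta> > 0" and \<mu>: "\<mu> \<in> CE \<Omega> \<rho>0 \<rho>1" and \<phi>: "\<phi> \<in> C1 \<Omega>" "admissible \<delta> \<phi>"
  shows "ennreal ((\<integral>x. \<phi> (1, x) \<partial>\<rho>1) - (\<integral>x. \<phi> (0, x) \<partial>\<rho>0)) \<le> action \<delta> \<Omega> \<mu>"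
proof -
  obtain \<rho> \<omega> \<zeta> where \<mu>_eq: "\<mu> = (\<rho>, \<omega>, \<zeta>)" by (cases \<mu>) auto
  let ?M = "cylM \<Omega>"
  define \<Lambda> where "\<Lambda> = total_variation ?M (joint (\<rho>, \<omega>, \<zeta>))"
  have sm: "\<rho> \<in> signed_measures ?M" "\<And>i. \<omega> i \<in> signed_measures ?M" "\<zeta> \<in> signed_measures ?M"
    and ce: "signed_integral ?M \<rho> (time_deriv \<Omega> \<phi>)
        + (\<Sum>i\<in>UNIV. signed_integral ?M (\<omega> i) (\<lambda>p. space_grad \<Omega> \<phi> p $ i))
        + signed_integral ?M \<zeta> \<phi> = (\<integral>x. \<phi> (1, x) \<partial>\<rho>1) - (\<integral>x. \<phi> (0, x) \<partial>\<rho>0)"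
    using \<mu> \<phi>(1) by (auto simp: CE_def \<mu>_eq)
  let ?h = "signed_RN_deriv ?M \<Lambda>"
  have dens: "integrable \<Lambda> (\<lambda>x. ?h \<nu> x * f x)" "signed_integral ?M \<nu> f = (\<integral>x. ?h \<nu> x * f x \<partial>\<Lambda>)"
    if \<nu>: "\<nu> = \<rho> \<or> (\<exists>i. \<nu> = \<omega> i) \<or> \<nu> = \<zeta>" and f: "continuous_on (cyl \<Omega>) f" for \<nu> f
  proof -
    obtain B where B: "\<And>p. p \<in> cyl \<Omega> \<Longrightarrow> \<bar>f p\<bar> \<le> B" using continuous_cyl_bounded[OF f] by blast
    show "integrable \<Lambda> (\<lambda>x. ?h \<nu> x * f x)" "signed_integral ?M \<nu> f = (\<integral>x. ?h \<nu> x * f x \<partial>\<Lambda>)"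
      using triple_density[OF sm \<nu> continuous_cyl_measurable[OF f] B] unfolding \<Lambda>_def by auto
  qed
  note c = C1_continuous[OF \<phi>(1)] C1_continuous_derivs[OF \<phi>(1)]
  have ci: "continuous_on (cyl \<Omega>) (\<lambda>p. space_grad \<Omega> \<phi> p $ i)" for i
    using c(3) by (intro continuous_intros)
  define G where "G x = ?h \<rho> x * time_deriv \<Omega> \<phi> x + (\<Sum>i\<in>UNIV. ?h (\<omega> i) x * space_grad \<Omega> \<phi> x $ i) + ?h \<zeta> x * \<phi> x" for x
  have i1: "integrable \<Lambda> (\<lambda>x. ?h \<rho> x * time_deriv \<Omega> \<phi> x)" by (rule dens(1)) (use c in auto)
  have i2: "integrable \<Lambda> (\<lambda>x. ?h (\<omega> i) x * space_grad \<Omega> \<phi> x $ i)" for i by (rule dens(1)) (use ci in auto)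
  have i3: "integrable \<Lambda> (\<lambda>x. ?h \<zeta> x * \<phi> x)" by (rule dens(1)) (use c in auto)
  have Gi: "integrable \<Lambda> G" unfolding G_def[abs_def] using i1 i2 i3 by auto
  have "(\<integral>x. G x \<partial>\<Lambda>) = (\<integral>x. ?h \<rho> x * time_deriv \<Omega> \<phi> x \<partial>\<Lambda>)
      + (\<Sum>i\<in>UNIV. \<integral>x. ?h (\<omega> i) x * space_grad \<Omega> \<phi> x $ i \<partial>\<Lambda>) + (\<integral>x. ?h \<zeta> x * \<phi> x \<partial>\<Lambda>)"
    unfolding G_def using i1 i2 i3 by simp
  also have "\<dots> = (\<integral>x. \<phi> (1, x) \<partial>\<rho>1) - (\<integral>x. \<phi> (0, x) \<partial>\<rho>0)"
  proof -
    have "signed_integral ?M (\<omega> i) (\<lambda>p. space_grad \<Omega> \<phi> p $ i) = (\<integral>x. ?h (\<omega> i) x * space_grad \<Omega> \<phi> x $ i \<partial>\<Lambda>)" for i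
      by (rule dens(2)[OF _ ci]) auto
    then show ?thesis using dens(2)[of \<rho>, OF _ c(2)] dens(2)[of \<zeta>, OF _ c(1)] ce by simp
  qed
  finally have "ennreal ((\<integral>x. \<phi> (1, x) \<partial>\<rho>1) - (\<integral>x. \<phi> (0, x) \<partial>\<rho>0)) = ennreal (\<integral>x. G x \<partial>\<Lambda>)" by simp
  also have "\<dots> \<le> (\<integral>\<^sup>+x. ennreal (G x) \<partial>\<Lambda>)" by (rule ennreal_integral_le_nn_integral[OF Gi])
  also have "\<dots> \<le> (\<integral>\<^sup>+x. f_delta \<delta> (?h \<rho> x, \<chi> i. ?h (\<omega> i) x, ?h \<zeta> x) \<partial>\<Lambda>)"
  proof (rule nn_integral_mono)
    fix x assume "x \<in> space \<Lambda>"
    then have "(time_deriv \<Omega> \<phi> x, space_grad \<Omega> \<phi> x, \<phi> x) \<in> B_set \<delta>"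
      using \<phi>(2) by (simp add: admissible_def \<Lambda>_def)
    from f_delta_ge[OF \<delta> this, of "(?h \<rho> x, \<chi> i. ?h (\<omega> i) x, ?h \<zeta> x)"]
    show "ennreal (G x) \<le> f_delta \<delta> (?h \<rho> x, \<chi> i. ?h (\<omega> i) x, ?h \<zeta> x)"
      by (simp add: G_def inner_vec_def mult.commute add.assoc)
  qed
  also have "\<dots> = action \<delta> \<Omega> \<mu>" by (simp add: action_def action_wrt_def \<mu>_eq \<Lambda>_def)
  finally show ?thesis .
qed

text \<open>
  With \<open>h\<close> the density of the triple, the integrand \<open>f_delta \<delta> h\<close> is the supremum of
  \<open>b \<bullet> h\<^sub>\<omega> + c h\<^sub>\<zeta> - (\<bar>b\<bar>\<^sup>2 + c\<^sup>2 / \<delta>\<^sup>2) h\<^sub>\<rho> / 2\<close> over \<open>b\<close> and \<open>c\<close>.  The hypothesis bounds the integral of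
  this expression for continuous fields; by approximation the bound holds for bounded measurable
  ones, and truncated maximisers recover the action through Fatou's lemma.
\<close>

lemma action_le:
  fixes \<omega> :: "'d \<Rightarrow> _"
  assumes \<delta>: "\<delta> > 0"     and sm: "\<rho> \<in> signed_measures (cylM \<Omega>)" "\<And>i. \<omega> i \<in> signed_measures (cylM \<Omega>)" "\<zeta> \<in> signed_measures (cylM \<Omega>)"
    and nonneg: "\<And>A. A \<in> sets (cylM \<Omega>) \<Longrightarrow> 0 \<le> \<rho> A"
    and dual: "\<And>b c. (\<And>i. continuous_on UNIV (b i)) \<Longrightarrow> continuous_on UNIV c \<Longrightarrow>
      (\<Sum>i\<in>UNIV. signed_integral (cylM \<Omega>) (\<omega> i) (b i)) + signed_integral (cylM \<Omega>) \<zeta> c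
      - 1/2 * signed_integral (cylM \<Omega>) \<rho> (\<lambda>p. (\<Sum>i\<in>UNIV. (b i p)\<^sup>2) + (c p)\<^sup>2 / \<delta>\<^sup>2) \<le> S"
  shows "action \<delta> \<Omega> (\<rho>, \<omega>, \<zeta>) \<le> ennreal S"
proof -
  let ?M = "cylM \<Omega>"
  define \<Lambda> where "\<Lambda> = total_variation ?M (joint (\<rho>, \<omega>, \<zeta>))"
  let ?h = "signed_RN_deriv ?M \<Lambda>"
  have fin: "finite_measure \<Lambda>" unfolding \<Lambda>_def by (rule total_variation_joint(1)[OF sm])
  have sets: "sets \<Lambda> = sets ?M" and sp: "space \<Lambda> = cyl \<Omega>" by (simp_all add: \<Lambda>_def)
  have mc: "f \<in> borel_measurable ?M \<longleftrightarrow> f \<in> borel_measurable \<Lambda>" for f :: "'d spacetime \<Rightarrow> real"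
    using sets by (auto cong: measurable_cong_sets)
  have hm [measurable]: "?h \<nu> \<in> borel_measurable \<Lambda>" for \<nu>
    unfolding signed_RN_deriv_def[abs_def] by measurable
  have dens: "integrable \<Lambda> (\<lambda>x. ?h \<nu> x * f x)" "signed_integral ?M \<nu> f = (\<integral>x. ?h \<nu> x * f x \<partial>\<Lambda>)"
    if "\<nu> = \<rho> \<or> (\<exists>i. \<nu> = \<omega> i) \<or> \<nu> = \<zeta>" "f \<in> borel_measurable \<Lambda>" "\<And>p. p \<in> cyl \<Omega> \<Longrightarrow> \<bar>f p\<bar> \<le> B" for \<nu> f B
    using triple_density[OF sm that(1) that(2)[folded mc] that(3)] unfolding \<Lambda>_def by auto
  \<comment> \<open>The component \<open>Some i\<close> of \<open>u\<close> is \<open>b\<^sub>i\<close> and \<open>None\<close> is \<open>c\<close>, so that all of them are approximated simultaneously.\<close>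
  define E where "E u x = (\<Sum>i\<in>UNIV. ?h (\<omega> i) x * u (Some i) x) + ?h \<zeta> x * u None x
     - 1/2 * (?h \<rho> x * ((\<Sum>i\<in>UNIV. (u (Some i) x)\<^sup>2) + (u None x)\<^sup>2 / \<delta>\<^sup>2))" for u :: "'d option \<Rightarrow> 'd spacetime \<Rightarrow> real" and x
  have sq: "\<bar>(\<Sum>i\<in>(UNIV::'d set). (w (Some i))\<^sup>2) + (w None)\<^sup>2 / \<delta>\<^sup>2\<bar> \<le> (\<Sum>i\<in>(UNIV::'d set). B\<^sup>2) + B\<^sup>2 / \<delta>\<^sup>2"
    if "\<And>j. \<bar>w j\<bar> \<le> B" for w :: "'d option \<Rightarrow> real" and B
  proof -
    have w: "(w j)\<^sup>2 \<le> B\<^sup>2" for j using that[of j] by (metis abs_ge_zero abs_le_square_iff abs_of_nonneg order_trans)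
    have "0 \<le> (\<Sum>i\<in>(UNIV::'d set). (w (Some i))\<^sup>2) + (w None)\<^sup>2 / \<delta>\<^sup>2" by (intro add_nonneg_nonneg sum_nonneg) auto
    moreover have "(\<Sum>i\<in>(UNIV::'d set). (w (Some i))\<^sup>2) + (w None)\<^sup>2 / \<delta>\<^sup>2 \<le> (\<Sum>i\<in>(UNIV::'d set). B\<^sup>2) + B\<^sup>2 / \<delta>\<^sup>2"
      by (intro add_mono sum_mono divide_right_mono w) auto
    ultimately show ?thesis by simp
  qed
  have E_int: "integrable \<Lambda> (E u)" "(\<integral>x. E u x \<partial>\<Lambda>) = (\<Sum>i\<in>UNIV. signed_integral ?M (\<omega> i) (u (Some i))) + signed_integral ?M \<zeta> (u None)
      - 1/2 * signed_integral ?M \<rho> (\<lambda>p. (\<Sum>i\<in>UNIV. (u (Some i) p)\<^sup>2) + (u None p)\<^sup>2 / \<delta>\<^sup>2)"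
    if um: "\<And>j. u j \<in> borel_measurable \<Lambda>" and uB: "\<And>j x. \<bar>u j x\<bar> \<le> B" for u B
  proof -
    have 1: "integrable \<Lambda> (\<lambda>x. ?h (\<omega> i) x * u (Some i) x)"
      "signed_integral ?M (\<omega> i) (u (Some i)) = (\<integral>x. ?h (\<omega> i) x * u (Some i) x \<partial>\<Lambda>)" for i
      using dens[of "\<omega> i" "u (Some i)" B] um uB by auto
    have 2: "integrable \<Lambda> (\<lambda>x. ?h \<zeta> x * u None x)"
      "signed_integral ?M \<zeta> (u None) = (\<integral>x. ?h \<zeta> x * u None x \<partial>\<Lambda>)"
      using dens[of \<zeta> "u None" B] um uB by auto
    have m: "(\<lambda>p. (\<Sum>i\<in>UNIV. (u (Some i) p)\<^sup>2) + (u None p)\<^sup>2 / \<delta>\<^sup>2) \<in> borel_measurable \<Lambda>"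
      using um by measurable
    note 3 = dens[of \<rho>, OF _ m sq[of "\<lambda>j. u j p" for p, OF uB]]
    show "integrable \<Lambda> (E u)" unfolding E_def[abs_def] using 1 2 3 by auto
    show "(\<integral>x. E u x \<partial>\<Lambda>) = (\<Sum>i\<in>UNIV. signed_integral ?M (\<omega> i) (u (Some i))) + signed_integral ?M \<zeta> (u None)
      - 1/2 * signed_integral ?M \<rho> (\<lambda>p. (\<Sum>i\<in>UNIV. (u (Some i) p)\<^sup>2) + (u None p)\<^sup>2 / \<delta>\<^sup>2)"
      unfolding E_def using 1 2 3 by simp
  qed
  have E_le: "(\<integral>x. E u x \<partial>\<Lambda>) \<le> S"
    if um: "\<And>j. u j \<in> borel_measurable \<Lambda>" and uB: "\<And>j x. \<bar>u j x\<bar> \<le> B" for u B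
  proof -
    obtain g :: "nat \<Rightarrow> 'd option \<Rightarrow> 'd spacetime \<Rightarrow> real" where g: "\<And>n j. continuous_on UNIV (g n j)" "\<And>n j x. \<bar>g n j x\<bar> \<le> B"
      "AE x in \<Lambda>. \<forall>j. (\<lambda>n. g n j x) \<longlonglongrightarrow> u j x"
      using family_approx_continuous[where f = u, OF fin sets[unfolded cylM_def] closed_cyl um uB] by blast
    have gm: "g n j \<in> borel_measurable \<Lambda>" for n j
      using continuous_cyl_measurable[OF continuous_on_subset[OF g(1)]] mc by auto
    have "(\<lambda>n. \<integral>x. E (g n) x \<partial>\<Lambda>) \<longlonglongrightarrow> (\<integral>x. E u x \<partial>\<Lambda>)"
    proof (rule integral_dominated_convergence[where w = "\<lambda>x. (\<Sum>i\<in>UNIV. \<bar>?h (\<omega> i) x * B\<bar>) + \<bar>?h \<zeta> x * B\<bar>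
        + 1/2 * \<bar>?h \<rho> x * ((\<Sum>i\<in>(UNIV::'d set). B\<^sup>2) + B\<^sup>2 / \<delta>\<^sup>2)\<bar>"])
      show "E u \<in> borel_measurable \<Lambda>" "\<And>n. E (g n) \<in> borel_measurable \<Lambda>"
        using E_int(1)[OF um uB] E_int(1)[OF gm g(2)] by auto
      have c: "integrable \<Lambda> (\<lambda>x. ?h \<nu> x * r)" if "\<nu> = \<rho> \<or> (\<exists>i. \<nu> = \<omega> i) \<or> \<nu> = \<zeta>" for \<nu> and r :: real
        by (rule dens(1)[OF that, of _ "\<bar>r\<bar>"]) auto
      show "integrable \<Lambda> (\<lambda>x. (\<Sum>i\<in>UNIV. \<bar>?h (\<omega> i) x * B\<bar>) + \<bar>?h \<zeta> x * B\<bar>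
        + 1/2 * \<bar>?h \<rho> x * ((\<Sum>i\<in>(UNIV::'d set). B\<^sup>2) + B\<^sup>2 / \<delta>\<^sup>2)\<bar>)"
        by (intro Bochner_Integration.integrable_add Bochner_Integration.integrable_sum integrable_abs integrable_mult_right c) auto
      show "AE x in \<Lambda>. (\<lambda>n. E (g n) x) \<longlonglongrightarrow> E u x"
        using g(3)
      proof eventually_elim
        case (elim x)
        then have l: "(\<lambda>n. g n j x) \<longlonglongrightarrow> u j x" for j by blast
        show ?case unfolding E_def by (intro tendsto_intros l) (use \<delta> in auto)
      qed
      show "AE x in \<Lambda>. norm (E (g n) x) \<le> (\<Sum>i\<in>UNIV. \<bar>?h (\<omega> i) x * B\<bar>) + \<bar>?h \<zeta> x * B\<bar>
        + 1/2 * \<bar>?h \<rho> x * ((\<Sum>i\<in>(UNIV::'d set). B\<^sup>2) + B\<^sup>2 / \<delta>\<^sup>2)\<bar>" for n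
      proof (rule AE_I2)
        fix x
        let ?q = "(\<Sum>i\<in>(UNIV::'d set). (g n (Some i) x)\<^sup>2) + (g n None x)\<^sup>2 / \<delta>\<^sup>2"
        let ?Q = "(\<Sum>i\<in>(UNIV::'d set). B\<^sup>2) + B\<^sup>2 / \<delta>\<^sup>2"
        have B: "\<bar>y * g n j x\<bar> \<le> \<bar>y * B\<bar>" for y j
          using g(2)[of n j x] unfolding abs_mult by (intro mult_left_mono) auto
        have "norm (E (g n) x) \<le> \<bar>\<Sum>i\<in>UNIV. ?h (\<omega> i) x * g n (Some i) x\<bar> + \<bar>?h \<zeta> x * g n None x\<bar> + 1/2 * \<bar>?h \<rho> x * ?q\<bar>"
          unfolding E_def real_norm_def by linarith
        also have "\<bar>\<Sum>i\<in>UNIV. ?h (\<omega> i) x * g n (Some i) x\<bar> \<le> (\<Sum>i\<in>UNIV. \<bar>?h (\<omega> i) x * g n (Some i) x\<bar>)" by (rule sum_abs)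
        also have "\<dots> \<le> (\<Sum>i\<in>UNIV. \<bar>?h (\<omega> i) x * B\<bar>)" by (intro sum_mono B)
        also have "\<bar>?h \<zeta> x * g n None x\<bar> \<le> \<bar>?h \<zeta> x * B\<bar>" by (rule B)
        also have "\<bar>?h \<rho> x * ?q\<bar> \<le> \<bar>?h \<rho> x * ?Q\<bar>"
          unfolding abs_mult using sq[of "\<lambda>j. g n j x" B] g(2) by (intro mult_left_mono) auto
        finally show "norm (E (g n) x) \<le> (\<Sum>i\<in>UNIV. \<bar>?h (\<omega> i) x * B\<bar>) + \<bar>?h \<zeta> x * B\<bar> + 1/2 * \<bar>?h \<rho> x * ?Q\<bar>"
          by simp
      qed
    qed
    moreover have "(\<integral>x. E (g n) x \<partial>\<Lambda>) \<le> S" for n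
    proof -
      show ?thesis unfolding E_int(2)[OF gm g(2)] by (intro dual g)
    qed
    ultimately show ?thesis by (intro LIMSEQ_le_const2) auto
  qed
  have h\<rho>: "AE x in \<Lambda>. 0 \<le> ?h \<rho> x"
  proof -
    define A where "A = {x\<in>space \<Lambda>. ?h \<rho> x < 0}"
    have A: "A \<in> sets ?M" unfolding A_def sets[symmetric] by measurable
    have Am: "(indicator A :: _ \<Rightarrow> real) \<in> borel_measurable \<Lambda>" using A sets by auto
    have ind: "\<bar>indicator A p :: real\<bar> \<le> 1" for p by (simp add: indicator_def)
    have "signed_integral ?M \<rho> (indicator A) = \<rho> A"
      unfolding signed_integral_def using jordan_decomposition[OF sm(1) A] A sets.sets_into_space[OF A]
      by (simp add: Int_absorb2)
    also have "signed_integral ?M \<rho> (indicator A) = (\<integral>x. ?h \<rho> x * indicator A x \<partial>\<Lambda>)"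
      by (rule dens(2)[OF _ Am ind]) simp
    finally have ge: "0 \<le> (\<integral>x. ?h \<rho> x * indicator A x \<partial>\<Lambda>)" using nonneg[OF A] by simp
    have i: "integrable \<Lambda> (\<lambda>x. - (?h \<rho> x * indicator A x))"
      using dens(1)[OF _ Am ind, of \<rho>] by simp
    have pos: "AE x in \<Lambda>. 0 \<le> - (?h \<rho> x * indicator A x)" by (rule AE_I2) (auto simp: A_def indicator_def)
    have "(\<integral>x. - (?h \<rho> x * indicator A x) \<partial>\<Lambda>) = 0"
      using ge integral_nonneg_AE[OF pos] by simp
    then have "AE x in \<Lambda>. - (?h \<rho> x * indicator A x) = 0"
      using integral_nonneg_eq_0_iff_AE[OF i pos] by simp
    then show ?thesis
      using AE_space by eventually_elim (auto simp: A_def indicator_def not_less split: if_splits)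
  qed
  \<comment> \<open>Where \<open>h\<^sub>\<rho> > 0\<close>, the maximiser is \<open>(h\<^sub>\<omega> / h\<^sub>\<rho>, \<delta>\<^sup>2 h\<^sub>\<zeta> / h\<^sub>\<rho>)\<close>, kept where it is at most \<open>n\<close>; where \<open>h\<^sub>\<rho> = 0\<close>, large multiples of \<open>(h\<^sub>\<omega>, h\<^sub>\<zeta>)\<close> make the expression tend to infinity unless both densities vanish.\<close>
  define good where "good n x \<longleftrightarrow> 0 < ?h \<rho> x \<and> (\<forall>i. \<bar>?h (\<omega> i) x\<bar> \<le> real n * ?h \<rho> x) \<and> \<delta>\<^sup>2 * \<bar>?h \<zeta> x\<bar> \<le> real n * ?h \<rho> x" for n :: nat and x
  define sing where "sing n x \<longleftrightarrow> ?h \<rho> x = 0 \<and> (\<forall>i. \<bar>?h (\<omega> i) x\<bar> \<le> real n) \<and> \<bar>?h \<zeta> x\<bar> \<le> real n" for n :: nat and x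
  define u where "u n j x = (if good n x then (case j of Some i \<Rightarrow> ?h (\<omega> i) x / ?h \<rho> x | None \<Rightarrow> \<delta>\<^sup>2 * ?h \<zeta> x / ?h \<rho> x)
     else if sing n x then real n * (case j of Some i \<Rightarrow> ?h (\<omega> i) x | None \<Rightarrow> ?h \<zeta> x) else 0)" for n j x
  have [measurable]: "Measurable.pred \<Lambda> (good n)" "Measurable.pred \<Lambda> (sing n)" for n
    unfolding good_def[abs_def] sing_def[abs_def] by measurable
  have um: "u n j \<in> borel_measurable \<Lambda>" for n j
  proof (cases j)
    case None
    have "u n j = (\<lambda>x. if good n x then \<delta>\<^sup>2 * ?h \<zeta> x / ?h \<rho> x else if sing n x then real n * ?h \<zeta> x else 0)"
      by (rule ext) (auto simp: u_def None)
    also have "\<dots> \<in> borel_measurable \<Lambda>" by measurable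
    finally show ?thesis .
  next
    case (Some i)
    have "u n j = (\<lambda>x. if good n x then ?h (\<omega> i) x / ?h \<rho> x else if sing n x then real n * ?h (\<omega> i) x else 0)"
      by (rule ext) (auto simp: u_def Some)
    also have "\<dots> \<in> borel_measurable \<Lambda>" by measurable
    finally show ?thesis .
  qed
  have uB: "\<bar>u n j x\<bar> \<le> real n + real n * real n" for n j x
  proof -
    have 1: "\<bar>u n j x\<bar> \<le> real n" if "good n x"
      using that by (cases j) (auto simp: u_def good_def abs_mult field_simps)
    have 2: "\<bar>u n j x\<bar> \<le> real n * real n" if "\<not> good n x" "sing n x"
      using that by (cases j) (auto simp: u_def sing_def abs_mult intro!: mult_left_mono)
    show ?thesis
    proof (cases "good n x \<or> sing n x")
      case True
      then show ?thesis using 1 2 by (cases "good n x") (auto intro: add_increasing add_increasing2)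
    qed (auto simp: u_def)
  qed
  have nrm: "(norm (\<chi> i. ?h (\<omega> i) x))\<^sup>2 = (\<Sum>i\<in>UNIV. (?h (\<omega> i) x)\<^sup>2)" for x
    unfolding power2_norm_eq_inner inner_vec_def by (simp add: power2_eq_square)
  let ?v = "\<lambda>x. ((norm (\<chi> i. ?h (\<omega> i) x))\<^sup>2 + \<delta>\<^sup>2 * (?h \<zeta> x)\<^sup>2) / (2 * ?h \<rho> x)"
  have E_good: "E (u n) x = ?v x" if "good n x" for n x
  proof -
    have r: "?h \<rho> x > 0" using that by (simp add: good_def)
    have s1: "(\<Sum>i\<in>UNIV. ?h (\<omega> i) x * (?h (\<omega> i) x / ?h \<rho> x)) = (\<Sum>i\<in>UNIV. (?h (\<omega> i) x)\<^sup>2) / ?h \<rho> x"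
      by (simp add: sum_divide_distrib power2_eq_square)
    have s2: "(\<Sum>i\<in>UNIV. (?h (\<omega> i) x / ?h \<rho> x)\<^sup>2) = (\<Sum>i\<in>UNIV. (?h (\<omega> i) x)\<^sup>2) / (?h \<rho> x)\<^sup>2"
      by (simp add: sum_divide_distrib power_divide)
    have alg: "N / r + z * (d * z / r) - 1/2 * (r * (N / r\<^sup>2 + (d * z / r)\<^sup>2 / d)) = (N + d * z\<^sup>2) / (2 * r)"
      if "r > 0" "d > 0" for N r z d :: real
      using that by (simp add: field_simps power2_eq_square)
    have ud: "u n (Some i) x = ?h (\<omega> i) x / ?h \<rho> x" "u n None x = \<delta>\<^sup>2 * ?h \<zeta> x / ?h \<rho> x" for i
      using that by (simp_all add: u_def)
    show ?thesis unfolding E_def nrm ud s1 s2 by (rule alg) (use r \<delta> in auto)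
  qed
  have E_sing: "E (u n) x = real n * ((\<Sum>i\<in>UNIV. (?h (\<omega> i) x)\<^sup>2) + (?h \<zeta> x)\<^sup>2)" if "sing n x" for n x
  proof -
    have "\<not> good n x" "?h \<rho> x = 0" using that by (auto simp: good_def sing_def)
    then show ?thesis using that
      by (simp add: E_def u_def sum_distrib_left power2_eq_square algebra_simps)
  qed
  have E_nonneg: "0 \<le> E (u n) x" for n x
  proof (cases "good n x")
    case True
    then show ?thesis unfolding E_good[OF True] by (auto simp: good_def)
  next
    case False
    show ?thesis
    proof (cases "sing n x")
      case True
      show ?thesis unfolding E_sing[OF True] by (intro mult_nonneg_nonneg add_nonneg_nonneg sum_nonneg) auto
    qed (use False in \<open>simp add: E_def u_def\<close>)
  qed
  have lower: "f_delta \<delta> (?h \<rho> x, \<chi> i. ?h (\<omega> i) x, ?h \<zeta> x) \<le> liminf (\<lambda>n. ennreal (E (u n) x))"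
    if x: "0 \<le> ?h \<rho> x" for x
  proof -
    define W where "W = (\<Sum>i\<in>UNIV. \<bar>?h (\<omega> i) x\<bar>) + \<delta>\<^sup>2 * \<bar>?h \<zeta> x\<bar> + \<bar>?h \<zeta> x\<bar>"
    have W1: "\<bar>?h (\<omega> i) x\<bar> \<le> W" for i
    proof -
      have "\<bar>?h (\<omega> i) x\<bar> \<le> (\<Sum>i\<in>UNIV. \<bar>?h (\<omega> i) x\<bar>)" by (rule member_le_sum) auto
      then show ?thesis unfolding W_def by (intro add_increasing2) auto
    qed
    have s0: "0 \<le> (\<Sum>i\<in>UNIV. \<bar>?h (\<omega> i) x\<bar>)" by (intro sum_nonneg) auto
    have W2: "\<delta>\<^sup>2 * \<bar>?h \<zeta> x\<bar> \<le> W" "\<bar>?h \<zeta> x\<bar> \<le> W" using s0 by (auto simp: W_def)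
    consider "?h \<rho> x > 0" | "?h \<rho> x = 0" "(\<chi> i. ?h (\<omega> i) x) = 0" "?h \<zeta> x = 0"
      | "?h \<rho> x = 0" "\<not> ((\<chi> i. ?h (\<omega> i) x) = 0 \<and> ?h \<zeta> x = 0)" using x by fastforce
    then show ?thesis
    proof cases
      case 1
      obtain N where N: "W / ?h \<rho> x \<le> real N" using real_arch_simple by blast
      have "good n x" if "n \<ge> N" for n
      proof -
        have "W \<le> real N * ?h \<rho> x" using N 1 by (simp add: field_simps)
        also have "\<dots> \<le> real n * ?h \<rho> x" using 1 that by (intro mult_right_mono) auto
        finally show ?thesis using W1 W2 1 unfolding good_def by (meson order_trans)
      qed
      then have "f_delta \<delta> (?h \<rho> x, \<chi> i. ?h (\<omega> i) x, ?h \<zeta> x) \<le> ennreal (E (u n) x)" if "n \<ge> N" for n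
        using 1 E_good that by (simp add: f_delta_def)
      then have "\<forall>\<^sub>F n in sequentially. f_delta \<delta> (?h \<rho> x, \<chi> i. ?h (\<omega> i) x, ?h \<zeta> x) \<le> ennreal (E (u n) x)"
        unfolding eventually_sequentially by blast
      then show ?thesis by (rule Liminf_bounded)
    next
      case 2
      then show ?thesis by (simp add: f_delta_def)
    next
      case 3
      define s where "s = (\<Sum>i\<in>UNIV. (?h (\<omega> i) x)\<^sup>2) + (?h \<zeta> x)\<^sup>2"
      have s: "s > 0"
      proof (cases "?h \<zeta> x = 0")
        case True
        then have "(\<chi> i. ?h (\<omega> i) x) \<noteq> 0" using 3 by simp
        then have "0 < (norm (\<chi> i. ?h (\<omega> i) x))\<^sup>2" by simp
        then show ?thesis unfolding s_def nrm[symmetric] by (intro add_pos_nonneg) auto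
      qed (auto simp: s_def intro!: add_nonneg_pos sum_nonneg)
      have ge: "ennreal r \<le> liminf (\<lambda>n. ennreal (E (u n) x))" for r
      proof -
        obtain N where N: "max W (r / s) \<le> real N" using real_arch_simple by blast
        have "ennreal r \<le> ennreal (E (u n) x)" if "n \<ge> N" for n
        proof -
          have n: "W \<le> real n" "r / s \<le> real n" using N that by auto
          have "sing n x" unfolding sing_def using 3 W1 W2 n(1) by (meson order_trans)
          then have "E (u n) x = real n * s" by (simp add: E_sing s_def)
          also have "\<dots> \<ge> r" using n(2) s by (simp add: field_simps)
          finally show ?thesis by (rule ennreal_leI)
        qed
        then have "\<forall>\<^sub>F n in sequentially. ennreal r \<le> ennreal (E (u n) x)"
          by (auto simp: eventually_sequentially)
        then show ?thesis by (rule Liminf_bounded)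
      qed
      have "liminf (\<lambda>n. ennreal (E (u n) x)) = top"
      proof (rule ccontr)
        assume "liminf (\<lambda>n. ennreal (E (u n) x)) \<noteq> top"
        then obtain r where r: "0 \<le> r" "liminf (\<lambda>n. ennreal (E (u n) x)) = ennreal r"
          by (cases "liminf (\<lambda>n. ennreal (E (u n) x))") auto
        have "ennreal (r + 1) \<le> ennreal r" using ge[of "r + 1"] r by simp
        then show False using r by simp
      qed
      then show ?thesis by simp
    qed
  qed
  have "action \<delta> \<Omega> (\<rho>, \<omega>, \<zeta>) = (\<integral>\<^sup>+x. f_delta \<delta> (?h \<rho> x, \<chi> i. ?h (\<omega> i) x, ?h \<zeta> x) \<partial>\<Lambda>)"
    by (simp add: action_def action_wrt_def \<Lambda>_def)
  also have "\<dots> \<le> (\<integral>\<^sup>+x. liminf (\<lambda>n. ennreal (E (u n) x)) \<partial>\<Lambda>)"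
    by (rule nn_integral_mono_AE) (use h\<rho> lower in auto)
  also have "\<dots> \<le> liminf (\<lambda>n. \<integral>\<^sup>+x. ennreal (E (u n) x) \<partial>\<Lambda>)"
    using E_int(1)[OF um uB] by (intro nn_integral_liminf) auto
  also have "\<dots> \<le> liminf (\<lambda>n. ennreal S)"
  proof (rule Liminf_mono, rule always_eventually, rule allI)
    fix n
    have "(\<integral>\<^sup>+x. ennreal (E (u n) x) \<partial>\<Lambda>) = ennreal (\<integral>x. E (u n) x \<partial>\<Lambda>)"
      by (rule nn_integral_eq_integral[OF E_int(1)[OF um uB]]) (use E_nonneg in auto)
    also have "\<dots> \<le> ennreal S" by (intro ennreal_leI E_le[OF um uB])
    finally show "(\<integral>\<^sup>+x. ennreal (E (u n) x) \<partial>\<Lambda>) \<le> ennreal S" .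
  qed
  also have "\<dots> = ennreal S" by (simp add: Liminf_const)
  finally show ?thesis .
qed

end

section \<open>Duality and attainment\<close>

lemma convex_B_set: "convex (B_set \<delta>)"
  unfolding convex_def
proof (intro ballI allI impI)
  fix p q :: "real \<times> (real^'d) \<times> real" and u v :: real
  assume pq: "p \<in> B_set \<delta>" "q \<in> B_set \<delta>" and uv: "0 \<le> u" "0 \<le> v" "u + v = 1"
  obtain a b c where p: "p = (a, b, c)" by (cases p) auto
  obtain a' b' c' where q: "q = (a', b', c')" by (cases q) auto
  have sq: "(u * x + v * y)\<^sup>2 \<le> u * x\<^sup>2 + v * y\<^sup>2" for x y :: real
  proof -
    have "u * x\<^sup>2 + v * y\<^sup>2 - (u * x + v * y)\<^sup>2 = (u * v) * (x - y)\<^sup>2 + (u * x\<^sup>2 + v * y\<^sup>2) * (1 - (u + v))"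
      by (simp add: power2_eq_square algebra_simps)
    also have "\<dots> \<ge> 0" using uv by simp
    finally show ?thesis by simp
  qed
  have "norm (u *\<^sub>R b + v *\<^sub>R b') \<le> u * norm b + v * norm b'"
    using norm_triangle_ineq[of "u *\<^sub>R b" "v *\<^sub>R b'"] uv by simp
  then have "(norm (u *\<^sub>R b + v *\<^sub>R b'))\<^sup>2 \<le> (u * norm b + v * norm b')\<^sup>2" by (intro power_mono) auto
  also have "\<dots> \<le> u * (norm b)\<^sup>2 + v * (norm b')\<^sup>2" by (rule sq)
  finally have 1: "(norm (u *\<^sub>R b + v *\<^sub>R b'))\<^sup>2 \<le> u * (norm b)\<^sup>2 + v * (norm b')\<^sup>2" .
  have "(u * c + v * c')\<^sup>2 / \<delta>\<^sup>2 \<le> (u * c\<^sup>2 + v * c'\<^sup>2) / \<delta>\<^sup>2" by (intro divide_right_mono sq) simp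
  then have 2: "(u * c + v * c')\<^sup>2 / \<delta>\<^sup>2 \<le> u * (c\<^sup>2 / \<delta>\<^sup>2) + v * (c'\<^sup>2 / \<delta>\<^sup>2)" by (simp add: add_divide_distrib)
  have 3: "u * (a + 1/2 * ((norm b)\<^sup>2 + c\<^sup>2 / \<delta>\<^sup>2)) \<le> 0" "v * (a' + 1/2 * ((norm b')\<^sup>2 + c'\<^sup>2 / \<delta>\<^sup>2)) \<le> 0"
    using pq uv by (auto simp: B_set_def p q intro!: mult_nonneg_nonpos)
  have "u * a + v * a' + 1/2 * ((norm (u *\<^sub>R b + v *\<^sub>R b'))\<^sup>2 + (u * c + v * c')\<^sup>2 / \<delta>\<^sup>2) \<le>
      u * a + v * a' + 1/2 * ((u * (norm b)\<^sup>2 + v * (norm b')\<^sup>2) + (u * (c\<^sup>2 / \<delta>\<^sup>2) + v * (c'\<^sup>2 / \<delta>\<^sup>2)))"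
    using 1 2 by (intro add_left_mono mult_left_mono add_mono) auto
  also have "\<dots> = u * (a + 1/2 * ((norm b)\<^sup>2 + c\<^sup>2 / \<delta>\<^sup>2)) + v * (a' + 1/2 * ((norm b')\<^sup>2 + c'\<^sup>2 / \<delta>\<^sup>2))"
    by (simp add: algebra_simps)
  also have "\<dots> \<le> 0" using 3 by simp
  finally show "u *\<^sub>R p + v *\<^sub>R q \<in> B_set \<delta>" by (simp add: B_set_def p q)
qed

text \<open>
  The field of \<open>(t, x) \<mapsto> - e t\<close> is uniformly interior to the constraint: the linear gain \<open>e\<close> of the first
  coordinate beats the quadratic terms, which are of order \<open>e\<^sup>2\<close>.
\<close>

lemma B_set_interior_time:
  fixes p :: "real \<times> (real^'d) \<times> real"
  assumes \<delta>: "\<delta> > 0" and e: "e > 0" "e \<le> 1" "e \<le> \<delta>\<^sup>2 / 4" and t: "0 \<le> t" "t \<le> 1"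
    and near: "norm (p - (- e, 0, - e * t)) \<le> e / 4"
  shows "p \<in> B_set \<delta>"
proof -
  obtain a b c where p: "p = (a, b, c)" by (cases p) auto
  have n: "norm (a + e, b, c + e * t) \<le> e / 4" using near by (simp add: p)
  have 1: "\<bar>a + e\<bar> \<le> e / 4" using norm_fst_le[of "a + e" "(b, c + e * t)"] n by simp
  have n2: "norm (b, c + e * t) \<le> e / 4" using norm_snd_le[of "(b, c + e * t)" "a + e"] n by simp
  have 2: "norm b \<le> e / 4" using norm_fst_le[of b "c + e * t"] n2 by simp
  have 3: "\<bar>c + e * t\<bar> \<le> e / 4" using norm_snd_le[of "c + e * t" b] n2 by simp
  have et: "0 \<le> e * t" "e * t \<le> e" using e t by (auto intro: mult_left_le)
  have c: "\<bar>c\<bar> \<le> 5/4 * e" using 3 et by linarith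
  have b2: "(norm b)\<^sup>2 \<le> e"
  proof -
    have "(norm b)\<^sup>2 \<le> e\<^sup>2" using 2 e by (intro power_mono) auto
    also have "\<dots> \<le> e * 1" unfolding power2_eq_square using e by (intro mult_left_mono) auto
    finally show ?thesis by simp
  qed
  have c2: "c\<^sup>2 / \<delta>\<^sup>2 \<le> 25/64 * e"
  proof -
    have "c\<^sup>2 \<le> (5/4 * e)\<^sup>2" using c by (metis abs_ge_zero power2_abs power_mono)
    also have "\<dots> = 25/16 * e * e" by (simp add: power2_eq_square)
    also have "\<dots> \<le> 25/16 * e * (\<delta>\<^sup>2 / 4)" using e by (intro mult_left_mono) auto
    finally have "c\<^sup>2 \<le> 25/64 * e * \<delta>\<^sup>2" by simp
    then show ?thesis using \<delta> by (simp add: divide_le_eq)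
  qed
  have "a \<le> - 3/4 * e" using 1 by linarith
  then have "a + 1/2 * ((norm b)\<^sup>2 + c\<^sup>2 / \<delta>\<^sup>2) \<le> - 3/4 * e + 1/2 * (e + 25/64 * e)"
    using b2 c2 by (intro add_mono mult_left_mono) auto
  also have "\<dots> \<le> 0" using e by simp
  finally show ?thesis by (simp add: B_set_def p)
qed

context convex_domain
begin

text \<open>
  Makes a function that is only controlled on the cylinder bounded on the whole space.
\<close>

definition on_cyl :: "('d spacetime \<Rightarrow> 'b::zero) \<Rightarrow> 'd spacetime \<Rightarrow> 'b" where
  "on_cyl f p = (if p \<in> cyl \<Omega> then f p else 0)"

lemma on_cyl_bounded:
  fixes f :: "'d spacetime \<Rightarrow> 'b::real_normed_vector"
  assumes "continuous_on (cyl \<Omega>) f" shows "bounded (range (on_cyl f))"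
proof (rule bounded_subset)
  show "bounded (insert 0 (f ` cyl \<Omega>))"
    using compact_imp_bounded[OF compact_continuous_image[OF assms compact_cyl]] by simp
qed (auto simp: on_cyl_def)

lemma on_cyl_continuous: "continuous_on (cyl \<Omega>) f \<Longrightarrow> continuous_on (cyl \<Omega>) (on_cyl f)"
  by (erule continuous_on_eq) (simp add: on_cyl_def)

lemma signed_integral_cong:
  assumes "\<And>p. p \<in> cyl \<Omega> \<Longrightarrow> f p = g p"
  shows "signed_integral (cylM \<Omega>) \<nu> f = signed_integral (cylM \<Omega>) \<nu> g"
  unfolding signed_integral_def using assms
  by (intro arg_cong2[of _ _ _ _ "(-)"] Bochner_Integration.integral_cong) auto

lemma slice_integrable:
  assumes \<rho>: "sets \<rho> = sets (restrict_space borel (closure \<Omega>))" "finite_measure \<rho>"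
    and \<phi>: "continuous_on (cyl \<Omega>) \<phi>" and t: "t \<in> {0..1}"
  shows "integrable \<rho> (\<lambda>x. \<phi> (t, x) :: real)"
proof -
  interpret finite_measure \<rho> by fact
  have c: "continuous_on (closure \<Omega>) (\<lambda>x. \<phi> (t, x))"
    by (rule continuous_on_compose2[OF \<phi>]) (use t in \<open>auto simp: cyl_def intro!: continuous_intros\<close>)
  obtain B where B: "\<And>p. p \<in> cyl \<Omega> \<Longrightarrow> \<bar>\<phi> p\<bar> \<le> B" using continuous_cyl_bounded[OF \<phi>] by blast
  have sp: "space \<rho> = closure \<Omega>" using sets_eq_imp_space_eq[OF \<rho>(1)] by (simp add: space_restrict_space)
  show ?thesis
  proof (rule integrable_const_bound[where B = B])
    show "(\<lambda>x. \<phi> (t, x)) \<in> borel_measurable \<rho>"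
      using borel_measurable_continuous_on_restrict[OF c] \<rho>(1) by (simp cong: measurable_cong_sets)
    show "AE x in \<rho>. norm (\<phi> (t, x)) \<le> B"
      by (rule AE_I2) (use B t in \<open>auto simp: sp cyl_def\<close>)
  qed
qed

lemma on_cyl_represented:
  assumes PN: "finite_measure P" "finite_measure N" "sets P = sets (cylM \<Omega>)" "sets N = sets (cylM \<Omega>)"
    and l: "\<And>f. bounded (range f) \<Longrightarrow> continuous_on (cyl \<Omega>) f \<Longrightarrow> l f = (\<integral>x. f x \<partial>P) - (\<integral>x. f x \<partial>N)"
    and f: "continuous_on (cyl \<Omega>) f"
  shows "l (on_cyl f) = signed_integral (cylM \<Omega>) (\<lambda>A. measure P A - measure N A) f"
proof -
  obtain B where B: "\<forall>x. \<bar>on_cyl f x\<bar> \<le> B" using bounded_range_normD[OF on_cyl_bounded[OF f]] by auto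
  have "l (on_cyl f) = signed_integral (cylM \<Omega>) (\<lambda>A. measure P A - measure N A) (on_cyl f)"
    using signed_integral_diff[OF PN continuous_cyl_measurable[OF on_cyl_continuous[OF f]] spec[OF B]]
      l[OF on_cyl_bounded[OF f] on_cyl_continuous[OF f]] by simp
  then show ?thesis using signed_integral_cong[of "on_cyl f" f] by (simp add: on_cyl_def)
qed

lemma signed_measure_of_functional:
  fixes l :: "('d spacetime \<Rightarrow> real) \<Rightarrow> real"
  assumes "linear_on_bounded l"
    and "\<And>f. bounded (range f) \<Longrightarrow> \<forall>x\<in>cyl \<Omega>. \<bar>f x\<bar> \<le> 1 \<Longrightarrow> l f \<le> c"
  shows "\<exists>\<nu>. \<nu> \<in> signed_measures (cylM \<Omega>) \<and>
    (\<forall>f. continuous_on (cyl \<Omega>) f \<longrightarrow> l (on_cyl f) = signed_integral (cylM \<Omega>) \<nu> f)"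
proof -
  have "\<exists>l1 l2. positive_functional (cyl \<Omega>) l1 \<and> positive_functional (cyl \<Omega>) l2 \<and>
      (\<forall>f. bounded (range f) \<longrightarrow> l f = l1 f - l2 f)"
    using assms by (rule jordan_functional)
  then obtain l1 l2 where l12: "positive_functional (cyl \<Omega>) l1" "positive_functional (cyl \<Omega>) l2"
    "\<forall>f. bounded (range f) \<longrightarrow> l f = l1 f - l2 f" by (elim exE conjE)
  obtain P where P: "finite_measure P" "sets P = sets (cylM \<Omega>)"
    "\<forall>f. bounded (range f) \<longrightarrow> continuous_on (cyl \<Omega>) f \<longrightarrow> l1 f = (\<integral>x. f x \<partial>P)"
    using positive_functional.riesz_representation[OF l12(1) compact_cyl] unfolding cylM_def by (elim exE conjE)
  obtain N where N: "finite_measure N" "sets N = sets (cylM \<Omega>)"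
    "\<forall>f. bounded (range f) \<longrightarrow> continuous_on (cyl \<Omega>) f \<longrightarrow> l2 f = (\<integral>x. f x \<partial>N)"
    using positive_functional.riesz_representation[OF l12(2) compact_cyl] unfolding cylM_def by (elim exE conjE)
  have "l (on_cyl f) = signed_integral (cylM \<Omega>) (\<lambda>A. measure P A - measure N A) f"
    if "continuous_on (cyl \<Omega>) f" for f
    by (rule on_cyl_represented[OF P(1) N(1) P(2) N(2) _ that]) (use l12(3) P(3) N(3) in simp)
  then show ?thesis using signed_measure_diff[OF P(1) N(1) P(2) N(2)] by blast
qed

text \<open>
  Along a fixed vector \<open>e\<close>, the functional \<open>f \<mapsto> l (\<lambda>p. f p e)\<close> acts on scalar functions.  For
  \<open>e = (1, 0, 0)\<close> it is positive, because \<open>B_set \<delta>\<close> contains \<open>(- s, 0, 0)\<close> for all \<open>s \<ge> 0\<close>.  For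
  \<open>e = (0, v, z)\<close> it is bounded on the unit ball, because lowering the first coordinate by a constant
  moves \<open>f e\<close> into \<open>B_set \<delta>\<close>.
\<close>

lemma triple_of_functional:
  fixes l :: "('d spacetime \<Rightarrow> real \<times> (real^'d) \<times> real) \<Rightarrow> real"
  assumes lin: "linear_on_bounded l"
    and l_B: "\<And>f. bounded (range f) \<Longrightarrow> \<forall>p\<in>cyl \<Omega>. f p \<in> B_set \<delta> \<Longrightarrow> l f \<le> S"
  obtains \<rho> \<omega> \<zeta> where "\<rho> \<in> signed_measures (cylM \<Omega>)" "\<And>i. \<omega> i \<in> signed_measures (cylM \<Omega>)"
    "\<zeta> \<in> signed_measures (cylM \<Omega>)" "\<And>A. 0 \<le> \<rho> A"
    "\<And>a b c. continuous_on (cyl \<Omega>) a \<Longrightarrow> continuous_on (cyl \<Omega>) b \<Longrightarrow> continuous_on (cyl \<Omega>) c \<Longrightarrow>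
      l (on_cyl (\<lambda>p. (a p, b p, c p))) = signed_integral (cylM \<Omega>) \<rho> a
        + (\<Sum>i\<in>UNIV. signed_integral (cylM \<Omega>) (\<omega> i) (\<lambda>p. b p $ i)) + signed_integral (cylM \<Omega>) \<zeta> c"
proof -
  let ?M = "cylM \<Omega>"
  define k where "k e f = l (\<lambda>p. f p *\<^sub>R e)" for e :: "real \<times> (real^'d) \<times> real" and f :: "'d spacetime \<Rightarrow> real"
  have b: "bounded (range (\<lambda>x. f x *\<^sub>R e))"
    if "bounded (range f)" for f :: "'d spacetime \<Rightarrow> real" and e :: "real \<times> (real^'d) \<times> real"
    by (rule bounded_range_scaleR_const[OF that])
  have k_lin: "linear_on_bounded (k e)" for e
    unfolding k_def[abs_def] by (rule linear_on_bounded_along[OF lin])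
  let ?e1 = "(1, 0, 0) :: real \<times> (real^'d) \<times> real"
  interpret pf: positive_functional "cyl \<Omega>" "k ?e1"
  proof
    show "0 \<le> k ?e1 f" if f: "bounded (range f)" "\<forall>p\<in>cyl \<Omega>. 0 \<le> f p" for f
    proof (rule nonneg_if_multiples_bounded)
      fix t :: real assume t: "t > 0"
      have "k ?e1 (\<lambda>x. - t *\<^sub>R f x) \<le> S"
        unfolding k_def
        by (rule l_B[OF b[OF bounded_range_scaleR[OF f(1)]]]) (use f t in \<open>auto simp: B_set_def\<close>)
      then show "- t * k ?e1 f \<le> S" using linear_on_bounded_scale[OF k_lin f(1), of ?e1 "- t"] by simp
    qed
  qed (rule k_lin)
  obtain R where R: "finite_measure R" "sets R = sets ?M"
    "\<forall>f. bounded (range f) \<longrightarrow> continuous_on (cyl \<Omega>) f \<longrightarrow> k ?e1 f = (\<integral>x. f x \<partial>R)"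
    using pf.riesz_representation[OF compact_cyl] unfolding cylM_def by (elim exE conjE)
  define \<rho> where "\<rho> A = measure R A" for A
  have null: "finite_measure (null_measure ?M)" by (rule finite_measureI) simp
  have \<rho>: "\<rho> \<in> signed_measures ?M" "k ?e1 (on_cyl f) = signed_integral ?M \<rho> f" if "continuous_on (cyl \<Omega>) f" for f
    unfolding \<rho>_def[abs_def]
    using signed_measure_diff[OF R(1) null R(2)] on_cyl_represented[OF R(1) null R(2) _ _ that, of "k ?e1"] R(3)
    by simp_all
  have one: "bounded (range (\<lambda>_::'d spacetime. r))" for r :: real by (simp add: image_constant_conv)
  have k_bnd: "k (0, v, z) f \<le> S + 1/2 * ((norm v)\<^sup>2 + z\<^sup>2 / \<delta>\<^sup>2) * k ?e1 (\<lambda>_. 1)"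
    if f: "bounded (range f)" "\<forall>p\<in>cyl \<Omega>. \<bar>f p\<bar> \<le> 1" for v z f
  proof -
    let ?q = "1/2 * ((norm v)\<^sup>2 + z\<^sup>2 / \<delta>\<^sup>2)"
    have half: "- (1/2 * Y) + 1/2 * X \<le> 0" if "X \<le> 1 * Y" for X Y :: real
      using that by simp
    have "k ?e1 (\<lambda>_. - ?q *\<^sub>R 1) + k (0, v, z) f = l (\<lambda>p. (- ?q *\<^sub>R 1) *\<^sub>R ?e1 + f p *\<^sub>R (0, v, z))"
      unfolding k_def by (rule linear_on_bounded_add[OF lin b[OF one] b[OF f(1)], symmetric])
    moreover have "l (\<lambda>p. (- ?q *\<^sub>R 1) *\<^sub>R ?e1 + f p *\<^sub>R (0, v, z)) \<le> S"
    proof (rule l_B)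
      show "bounded (range (\<lambda>p. (- ?q *\<^sub>R 1) *\<^sub>R ?e1 + f p *\<^sub>R (0, v, z)))"
        by (intro bounded_plus_comp b one f)
      show "\<forall>p\<in>cyl \<Omega>. (- ?q *\<^sub>R 1) *\<^sub>R ?e1 + f p *\<^sub>R (0, v, z) \<in> B_set \<delta>"
      proof
        fix p assume "p \<in> cyl \<Omega>"
        then have s: "(f p)\<^sup>2 \<le> 1" using f(2) by (simp add: abs_square_le_1)
        have "(norm (f p *\<^sub>R v))\<^sup>2 + (f p * z)\<^sup>2 / \<delta>\<^sup>2 = (f p)\<^sup>2 * ((norm v)\<^sup>2 + z\<^sup>2 / \<delta>\<^sup>2)"
          by (simp add: power_mult_distrib algebra_simps)
        also have "\<dots> \<le> 1 * ((norm v)\<^sup>2 + z\<^sup>2 / \<delta>\<^sup>2)" using s by (intro mult_right_mono) auto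
        finally have "- ?q + 1/2 * ((norm (f p *\<^sub>R v))\<^sup>2 + (f p * z)\<^sup>2 / \<delta>\<^sup>2) \<le> 0" by (rule half)
        then have "(- ?q, f p *\<^sub>R v, f p * z) \<in> B_set \<delta>" by (simp only: B_set_def mem_Collect_eq prod.case)
        then show "(- ?q *\<^sub>R 1) *\<^sub>R ?e1 + f p *\<^sub>R (0, v, z) \<in> B_set \<delta>" by simp
      qed
    qed
    ultimately show ?thesis using linear_on_bounded_scale[OF k_lin one[of 1], of ?e1 "- ?q"] by simp
  qed
  have sgn: "\<exists>\<nu>. \<nu> \<in> signed_measures ?M \<and>
      (\<forall>f. continuous_on (cyl \<Omega>) f \<longrightarrow> k (0, v, z) (on_cyl f) = signed_integral ?M \<nu> f)" for v z
    by (rule signed_measure_of_functional[OF k_lin k_bnd])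
  have "\<forall>i. \<exists>\<nu>. \<nu> \<in> signed_measures ?M \<and>
      (\<forall>f. continuous_on (cyl \<Omega>) f \<longrightarrow> k (0, axis i 1, 0) (on_cyl f) = signed_integral ?M \<nu> f)"
    by (intro allI sgn)
  from choice[OF this] obtain \<omega> where \<omega>: "\<forall>i. \<omega> i \<in> signed_measures ?M \<and>
      (\<forall>f. continuous_on (cyl \<Omega>) f \<longrightarrow> k (0, axis i 1, 0) (on_cyl f) = signed_integral ?M (\<omega> i) f)" ..
  from sgn[of 0 1] obtain \<zeta> where \<zeta>: "\<zeta> \<in> signed_measures ?M"
    "\<forall>f. continuous_on (cyl \<Omega>) f \<longrightarrow> k (0, 0, 1) (on_cyl f) = signed_integral ?M \<zeta> f" by (elim exE conjE)
  have l_sum: "bounded (range (\<lambda>p. \<Sum>i\<in>I. f i p)) \<and> l (\<lambda>p. \<Sum>i\<in>I. f i p) = (\<Sum>i\<in>I. l (f i))"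
    if "finite I" "\<And>i. bounded (range (f i))" for I :: "'d set" and f
    using that(1)
  proof (induction I rule: finite_induct)
    case empty
    have "l (\<lambda>p. 0 *\<^sub>R (0 *\<^sub>R ?e1)) = 0 * l (\<lambda>p. 0 *\<^sub>R ?e1)" by (rule linear_on_bounded_scale[OF lin b[OF one]])
    then show ?case by (simp add: image_constant_conv zero_prod_def)
  next
    case (insert i I)
    then show ?case using linear_on_bounded_add[OF lin that(2)] bounded_plus_comp[OF that(2)] by simp
  qed
  have main: "l (on_cyl (\<lambda>p. (a p, v p, c p))) = signed_integral ?M \<rho> a
        + (\<Sum>i\<in>UNIV. signed_integral ?M (\<omega> i) (\<lambda>p. v p $ i)) + signed_integral ?M \<zeta> c"
    if cont: "continuous_on (cyl \<Omega>) a" "continuous_on (cyl \<Omega>) v" "continuous_on (cyl \<Omega>) c" for a v c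
  proof -
    have cv: "continuous_on (cyl \<Omega>) (\<lambda>p. v p $ i)" for i using cont(2) by (intro continuous_intros)
    note ba = b[OF on_cyl_bounded[OF cont(1)]] and bv = b[OF on_cyl_bounded[OF cv]] and bc = b[OF on_cyl_bounded[OF cont(3)]]
    have dec: "(a p, v p, c p) = a p *\<^sub>R ?e1 + ((\<Sum>i\<in>UNIV. v p $ i *\<^sub>R (0, axis i 1, 0)) + c p *\<^sub>R (0, 0, 1))" for p
    proof -
      have "v p = (\<Sum>i\<in>UNIV. v p $ i *\<^sub>R axis i 1)"
        using basis_expansion[of "v p"] by (simp add: scalar_mult_eq_scaleR)
      then show ?thesis by (intro prod_eqI) (simp_all add: fst_sum snd_sum)
    qed
    have eq: "on_cyl (\<lambda>p. (a p, v p, c p)) = (\<lambda>p. on_cyl a p *\<^sub>R ?e1 +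
        ((\<Sum>i\<in>UNIV. on_cyl (\<lambda>p. v p $ i) p *\<^sub>R (0, axis i 1, 0)) + on_cyl c p *\<^sub>R (0, 0, 1)))"
    proof
      fix p
      show "on_cyl (\<lambda>p. (a p, v p, c p)) p = on_cyl a p *\<^sub>R ?e1 +
        ((\<Sum>i\<in>UNIV. on_cyl (\<lambda>p. v p $ i) p *\<^sub>R (0, axis i 1, 0)) + on_cyl c p *\<^sub>R (0, 0, 1))"
        using dec[of p] by (cases "p \<in> cyl \<Omega>") (simp_all only: on_cyl_def if_True if_False scaleR_zero_left sum.neutral_const add_0)
    qed
    note s = l_sum[OF finite_class.finite_UNIV, of "\<lambda>i p. on_cyl (\<lambda>p. v p $ i) p *\<^sub>R (0, axis i 1, 0)", OF bv]
    have "l (on_cyl (\<lambda>p. (a p, v p, c p))) = k ?e1 (on_cyl a) +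
        ((\<Sum>i\<in>UNIV. k (0, axis i 1, 0) (on_cyl (\<lambda>p. v p $ i))) + k (0, 0, 1) (on_cyl c))"
      unfolding eq k_def linear_on_bounded_add[OF lin ba bounded_plus_comp[OF conjunct1[OF s] bc]]
        linear_on_bounded_add[OF lin conjunct1[OF s] bc] conjunct2[OF s] ..
    also have "\<dots> = signed_integral ?M \<rho> a + ((\<Sum>i\<in>UNIV. signed_integral ?M (\<omega> i) (\<lambda>p. v p $ i)) + signed_integral ?M \<zeta> c)"
      using \<rho>(2)[OF cont(1)] \<omega> cv \<zeta>(2) cont(3) by simp
    finally show ?thesis by simp
  qed
  have "\<rho> \<in> signed_measures ?M" using \<rho>(1)[OF continuous_on_const] .
  then show thesis
    by (rule that[of \<rho> \<omega> \<zeta>]) (use \<omega> \<zeta>(1) main in \<open>simp_all add: \<rho>_def\<close>)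
qed

text \<open>
  The field of values on which the constraint and the continuity equation act.
\<close>

definition jet :: "('d spacetime \<Rightarrow> real) \<Rightarrow> 'd spacetime \<Rightarrow> real \<times> (real^'d) \<times> real" where
  "jet \<phi> p = (time_deriv \<Omega> \<phi> p, space_grad \<Omega> \<phi> p, \<phi> p)"

lemmas C1_zero = C1_time[where r = 0, simplified]

lemma jet_continuous: "\<phi> \<in> C1 \<Omega> \<Longrightarrow> continuous_on (cyl \<Omega>) (jet \<phi>)"
  unfolding jet_def[abs_def] using C1_continuous C1_continuous_derivs by (intro continuous_intros) auto

text \<open>
  The functional is extended from the fields of test functions to all bounded fields with the bound \<open>S\<close>
  kept; a triple representing the extension solves the continuity equation because it agrees with the
  functional on fields of test functions, and its action inherits the bound.
\<close>

lemma dual_attained: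
  assumes \<delta>: "\<delta> > 0"
    and \<rho>0: "sets \<rho>0 = sets (restrict_space borel (closure \<Omega>))" "finite_measure \<rho>0"
    and \<rho>1: "sets \<rho>1 = sets (restrict_space borel (closure \<Omega>))" "finite_measure \<rho>1"
    and S: "\<And>\<phi>. \<phi> \<in> C1 \<Omega> \<Longrightarrow> admissible \<delta> \<phi> \<Longrightarrow> (\<integral>x. \<phi> (1, x) \<partial>\<rho>1) - (\<integral>x. \<phi> (0, x) \<partial>\<rho>0) \<le> S"
  shows "\<exists>\<mu>\<in>CE \<Omega> \<rho>0 \<rho>1. action \<delta> \<Omega> \<mu> \<le> ennreal S"
proof -
  define V where "V = {F. bounded (range F) \<and> (\<exists>\<phi>\<in>C1 \<Omega>. \<forall>p\<in>cyl \<Omega>. F p = jet \<phi> p)}"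
  define L where "L F = (\<integral>x. snd (snd (F (1, x))) \<partial>\<rho>1) - (\<integral>x. snd (snd (F (0, x))) \<partial>\<rho>0)"
    for F :: "'d spacetime \<Rightarrow> real \<times> (real^'d) \<times> real"
  have sp: "space \<rho>0 = closure \<Omega>" "space \<rho>1 = closure \<Omega>"
    using sets_eq_imp_space_eq[OF \<rho>0(1)] sets_eq_imp_space_eq[OF \<rho>1(1)] by (simp_all add: space_restrict_space)
  have LV: "L F = (\<integral>x. \<phi> (1, x) \<partial>\<rho>1) - (\<integral>x. \<phi> (0, x) \<partial>\<rho>0)" if "\<forall>p\<in>cyl \<Omega>. F p = jet \<phi> p" for F \<phi>
    unfolding L_def using that
    by (intro arg_cong2[of _ _ _ _ "(-)"] Bochner_Integration.integral_cong) (auto simp: sp cyl_def jet_def)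
  note int0 = slice_integrable[OF \<rho>0 C1_continuous] and int1 = slice_integrable[OF \<rho>1 C1_continuous]
  have jet_V: "on_cyl (jet \<phi>) \<in> V" if "\<phi> \<in> C1 \<Omega>" for \<phi>
    unfolding V_def using that on_cyl_bounded[OF jet_continuous[OF that]] by (auto simp: on_cyl_def)
  define e where "e = min 1 (\<delta>\<^sup>2 / 4)"
  have e: "e > 0" "e \<le> 1" "e \<le> \<delta>\<^sup>2 / 4" using \<delta> by (auto simp: e_def)
  define \<phi>0 where "\<phi>0 = (\<lambda>p :: 'd spacetime. - e * fst p)"
  have \<phi>0: "\<phi>0 \<in> C1 \<Omega>" "\<And>p. p \<in> cyl \<Omega> \<Longrightarrow> jet \<phi>0 p = (- e, 0, - e * fst p)"
    using C1_time[where r = "- e"] by (simp_all add: \<phi>0_def jet_def)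
  have "\<exists>l. linear_on_bounded l \<and> (\<forall>F\<in>V. l F = L F)
    \<and> (\<forall>f. bounded (range f) \<longrightarrow> (\<forall>x\<in>cyl \<Omega>. f x \<in> B_set \<delta>) \<longrightarrow> l f \<le> S)"
  proof (rule bounded_function_extension[where r = "e / 4" and ?v0.0 = "on_cyl (jet \<phi>0)"])
    show "(\<lambda>_. 0) \<in> V"
    proof -
      have "\<forall>p\<in>cyl \<Omega>. 0 = jet (\<lambda>_. 0) p"
        by (simp add: jet_def zero_prod_def C1_zero)
      then show ?thesis unfolding V_def using C1_zero(1) by (auto simp: image_constant_conv)
    qed
    show "(\<lambda>x. F x + G x) \<in> V" if FG: "F \<in> V" "G \<in> V" for F G
    proof -
      obtain \<phi> \<psi> where \<phi>: "\<phi> \<in> C1 \<Omega>" "\<forall>p\<in>cyl \<Omega>. F p = jet \<phi> p" and \<psi>: "\<psi> \<in> C1 \<Omega>" "\<forall>p\<in>cyl \<Omega>. G p = jet \<psi> p"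
        using FG by (auto simp: V_def)
      have "\<forall>p\<in>cyl \<Omega>. F p + G p = jet (\<lambda>p. \<phi> p + \<psi> p) p"
        using \<phi>(2) \<psi>(2) C1_add(2,3)[OF \<phi>(1) \<psi>(1)] by (simp add: jet_def)
      then show ?thesis using FG C1_add(1)[OF \<phi>(1) \<psi>(1)] unfolding V_def by (blast intro: bounded_plus_comp)
    qed
    show "(\<lambda>x. c *\<^sub>R F x) \<in> V" if F: "F \<in> V" for c F
    proof -
      obtain \<phi> where \<phi>: "\<phi> \<in> C1 \<Omega>" "\<forall>p\<in>cyl \<Omega>. F p = jet \<phi> p" using F by (auto simp: V_def)
      have "\<forall>p\<in>cyl \<Omega>. c *\<^sub>R F p = jet (\<lambda>p. c * \<phi> p) p"
        using \<phi>(2) C1_scale(2,3)[OF \<phi>(1) \<phi>(1)] by (simp add: jet_def)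
      moreover have "bounded (range (\<lambda>x. c *\<^sub>R F x))" using F by (simp add: V_def bounded_range_scaleR)
      ultimately show ?thesis using C1_scale(1)[OF \<phi>(1) \<phi>(1)] unfolding V_def by blast
    qed
    show "L (\<lambda>x. F x + G x) = L F + L G" if FG: "F \<in> V" "G \<in> V" for F G
    proof -
      obtain \<phi> \<psi> where \<phi>: "\<phi> \<in> C1 \<Omega>" "\<forall>p\<in>cyl \<Omega>. F p = jet \<phi> p" and \<psi>: "\<psi> \<in> C1 \<Omega>" "\<forall>p\<in>cyl \<Omega>. G p = jet \<psi> p"
        using FG by (auto simp: V_def)
      have "\<forall>p\<in>cyl \<Omega>. F p + G p = jet (\<lambda>p. \<phi> p + \<psi> p) p"
        using \<phi>(2) \<psi>(2) C1_add(2,3)[OF \<phi>(1) \<psi>(1)] by (simp add: jet_def)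
      from LV[OF this] show ?thesis
        unfolding LV[OF \<phi>(2)] LV[OF \<psi>(2)]
        using int0[OF \<phi>(1), of 0] int0[OF \<psi>(1), of 0] int1[OF \<phi>(1), of 1] int1[OF \<psi>(1), of 1] by simp
    qed
    show "L (\<lambda>x. c *\<^sub>R F x) = c * L F" if F: "F \<in> V" for c F
      unfolding L_def by (simp add: right_diff_distrib)
    show "on_cyl (jet \<phi>0) \<in> V" by (rule jet_V[OF \<phi>0(1)])
    show "f x \<in> B_set \<delta>" if near: "\<forall>y\<in>cyl \<Omega>. norm (f y - on_cyl (jet \<phi>0) y) \<le> e / 4" and x: "x \<in> cyl \<Omega>" for f x
    proof (rule B_set_interior_time[OF \<delta> e])
      show "0 \<le> fst x" "fst x \<le> 1" using x by (auto simp: cyl_def)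
      show "norm (f x - (- e, 0, - e * fst x)) \<le> e / 4"
        using bspec[OF near x] x \<phi>0(2)[OF x] by (simp add: on_cyl_def)
    qed
    show "L F \<le> S" if F: "F \<in> V" "\<forall>x\<in>cyl \<Omega>. F x \<in> B_set \<delta>" for F
    proof -
      obtain \<phi> where \<phi>: "\<phi> \<in> C1 \<Omega>" "\<forall>p\<in>cyl \<Omega>. F p = jet \<phi> p" using F by (auto simp: V_def)
      have "admissible \<delta> \<phi>" using F(2) \<phi>(2) by (simp add: admissible_def jet_def)
      then show ?thesis unfolding LV[OF \<phi>(2)] by (rule S[OF \<phi>(1)])
    qed
  qed (use e convex_B_set in \<open>auto simp: V_def\<close>)
  then obtain l where lin: "linear_on_bounded l" and l_V: "\<forall>F\<in>V. l F = L F"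
    and l_B: "\<forall>f. bounded (range f) \<longrightarrow> (\<forall>x\<in>cyl \<Omega>. f x \<in> B_set \<delta>) \<longrightarrow> l f \<le> S" by (elim exE conjE)
  let ?I = "signed_integral (cylM \<Omega>)"
  obtain \<rho> \<omega> \<zeta> where sm: "\<rho> \<in> signed_measures (cylM \<Omega>)" "\<And>i. \<omega> i \<in> signed_measures (cylM \<Omega>)"
    "\<zeta> \<in> signed_measures (cylM \<Omega>)" "\<And>A. 0 \<le> \<rho> A"
    and rep: "\<And>a b c. continuous_on (cyl \<Omega>) a \<Longrightarrow> continuous_on (cyl \<Omega>) b \<Longrightarrow> continuous_on (cyl \<Omega>) c \<Longrightarrow>
      l (on_cyl (\<lambda>p. (a p, b p, c p))) = ?I \<rho> a + (\<Sum>i\<in>UNIV. ?I (\<omega> i) (\<lambda>p. b p $ i)) + ?I \<zeta> c"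
    by (rule triple_of_functional[OF lin l_B[rule_format]]) blast+
  have "(\<rho>, \<omega>, \<zeta>) \<in> CE \<Omega> \<rho>0 \<rho>1"
    unfolding CE_def mem_Collect_eq prod.case
  proof (intro conjI ballI allI sm(1-3))
    fix \<phi> assume \<phi>: "\<phi> \<in> C1 \<Omega>"
    have "?I \<rho> (time_deriv \<Omega> \<phi>) + (\<Sum>i\<in>UNIV. ?I (\<omega> i) (\<lambda>p. space_grad \<Omega> \<phi> p $ i)) + ?I \<zeta> \<phi> = l (on_cyl (jet \<phi>))"
      unfolding jet_def[abs_def]
      by (rule rep[symmetric]) (use C1_continuous[OF \<phi>] C1_continuous_derivs[OF \<phi>] in auto)
    also have "\<dots> = L (on_cyl (jet \<phi>))" using l_V jet_V[OF \<phi>] by blast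
    also have "\<dots> = (\<integral>x. \<phi> (1, x) \<partial>\<rho>1) - (\<integral>x. \<phi> (0, x) \<partial>\<rho>0)" by (rule LV) (simp add: on_cyl_def)
    finally show "?I \<rho> (time_deriv \<Omega> \<phi>) + (\<Sum>i\<in>UNIV. ?I (\<omega> i) (\<lambda>p. space_grad \<Omega> \<phi> p $ i)) + ?I \<zeta> \<phi> =
      (\<integral>x. \<phi> (1, x) \<partial>\<rho>1) - (\<integral>x. \<phi> (0, x) \<partial>\<rho>0)" .
  qed
  moreover have "action \<delta> \<Omega> (\<rho>, \<omega>, \<zeta>) \<le> ennreal S"
  proof (rule action_le[OF \<delta> sm])
    fix b :: "'d \<Rightarrow> 'd spacetime \<Rightarrow> real" and c :: "'d spacetime \<Rightarrow> real"
    assume bc: "\<And>i. continuous_on UNIV (b i)" "continuous_on UNIV c"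
    define q where "q p = (\<Sum>i\<in>UNIV. (b i p)\<^sup>2) + (c p)\<^sup>2 / \<delta>\<^sup>2" for p
    have cb: "continuous_on (cyl \<Omega>) (b i)" and cc: "continuous_on (cyl \<Omega>) c" for i
      using bc by (auto intro: continuous_on_subset)
    have cq: "continuous_on (cyl \<Omega>) (\<lambda>p. - (1/2) * q p)"
      unfolding q_def divide_inverse by (intro continuous_intros cb cc)
    have cv: "continuous_on (cyl \<Omega>) (\<lambda>p. \<chi> i. b i p)" by (intro continuous_on_vec_lambda cb)
    have "l (on_cyl (\<lambda>p. (- (1/2) * q p, \<chi> i. b i p, c p))) \<le> S"
    proof -
      have "bounded (range (on_cyl (\<lambda>p. (- (1/2) * q p, \<chi> i. b i p, c p))))"
        by (intro on_cyl_bounded continuous_on_Pair cq cv cc)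
      moreover have "on_cyl (\<lambda>p. (- (1/2) * q p, \<chi> i. b i p, c p)) p \<in> B_set \<delta>" if "p \<in> cyl \<Omega>" for p
      proof -
        have "(norm (\<chi> i. b i p))\<^sup>2 = (\<Sum>i\<in>UNIV. (b i p)\<^sup>2)"
          unfolding power2_norm_eq_inner inner_vec_def by (simp add: power2_eq_square)
        then show ?thesis using that by (simp add: on_cyl_def B_set_def q_def)
      qed
      ultimately show ?thesis using l_B by blast
    qed
    moreover have "l (on_cyl (\<lambda>p. (- (1/2) * q p, \<chi> i. b i p, c p))) =
        ?I \<rho> (\<lambda>p. - (1/2) * q p) + (\<Sum>i\<in>UNIV. ?I (\<omega> i) (b i)) + ?I \<zeta> c"
      using rep[OF cq cv cc] by simp
    moreover have "?I \<rho> (\<lambda>p. - (1/2) * q p) = - (1/2) * ?I \<rho> q"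
      unfolding signed_integral_def by (simp only: integral_mult_right_zero right_diff_distrib)
    ultimately show "(\<Sum>i\<in>UNIV. ?I (\<omega> i) (b i)) + ?I \<zeta> c
        - 1/2 * ?I \<rho> (\<lambda>p. (\<Sum>i\<in>UNIV. (b i p)\<^sup>2) + (c p)\<^sup>2 / \<delta>\<^sup>2) \<le> S"
      unfolding q_def[abs_def] by simp
  qed
  ultimately show ?thesis by blast
qed

end

theorem mainTheorem1:
  fixes \<Omega> :: "(real^'d) set" and \<delta> :: real and \<rho>0 \<rho>1 :: "(real^'d) measure"
  assumes "open \<Omega>" "bounded \<Omega>" "convex \<Omega>" "\<Omega> \<noteq> {}"
    and "\<delta> > 0"
    and "sets \<rho>0 = sets (restrict_space borel (closure \<Omega>))" "finite_measure \<rho>0"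
    and "sets \<rho>1 = sets (restrict_space borel (closure \<Omega>))" "finite_measure \<rho>1"
  shows "enn2ereal ((WF \<delta> \<Omega> \<rho>0 \<rho>1)\<^sup>2) = - (INF \<phi>\<in>C1 \<Omega>. J \<delta> \<Omega> \<rho>0 \<rho>1 \<phi>)
    \<and> (\<exists>\<mu>\<in>CE \<Omega> \<rho>0 \<rho>1. action \<delta> \<Omega> \<mu> = (INF \<mu>'\<in>CE \<Omega> \<rho>0 \<rho>1. action \<delta> \<Omega> \<mu>'))"
proof -
  interpret convex_domain \<Omega> using assms by unfold_locales auto
  interpret R0: finite_measure \<rho>0 by fact
  interpret R1: finite_measure \<rho>1 by fact
  have sp: "space \<rho>0 = closure \<Omega>" "space \<rho>1 = closure \<Omega>"
    using sets_eq_imp_space_eq[OF assms(6)] sets_eq_imp_space_eq[OF assms(8)] by (simp_all add: space_restrict_space)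
  define A where "A = {\<phi> \<in> C1 \<Omega>. admissible \<delta> \<phi>}"
  define L where "L \<phi> = (\<integral>x. \<phi> (1, x) \<partial>\<rho>1) - (\<integral>x. \<phi> (0, x) \<partial>\<rho>0)" for \<phi> :: "'d spacetime \<Rightarrow> real"
  define S where "S = (SUP \<phi>\<in>A. L \<phi>)"
  have zero: "(\<lambda>_. 0) \<in> A"
    by (simp add: A_def admissible_def B_set_def C1_zero)
  have bdd: "bdd_above (L ` A)"
  proof (rule bdd_aboveI2)
    fix \<phi> assume "\<phi> \<in> A"
    then have \<phi>: "\<phi> \<in> C1 \<Omega>" "admissible \<delta> \<phi>" by (auto simp: A_def)
    note b = admissible_bounds[OF assms(5) \<phi>]
    have "(\<integral>x. \<phi> (1, x) \<partial>\<rho>1) \<le> (\<integral>x. 2 * \<delta>\<^sup>2 \<partial>\<rho>1)"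
      by (intro integral_mono slice_integrable[OF assms(8,9) C1_continuous[OF \<phi>(1)]]) (use b sp in auto)
    moreover have "(\<integral>x. - (2 * \<delta>\<^sup>2) \<partial>\<rho>0) \<le> (\<integral>x. \<phi> (0, x) \<partial>\<rho>0)"
      by (intro integral_mono slice_integrable[OF assms(6,7) C1_continuous[OF \<phi>(1)]]) (use b sp in auto)
    ultimately show "L \<phi> \<le> (\<integral>x. 2 * \<delta>\<^sup>2 \<partial>\<rho>1) - (\<integral>x. - (2 * \<delta>\<^sup>2) \<partial>\<rho>0)" unfolding L_def by linarith
  qed
  have L_le: "L \<phi> \<le> S" if "\<phi> \<in> A" for \<phi> unfolding S_def by (rule cSUP_upper[OF that bdd])
  have S_le: "S \<le> r" if "\<And>\<phi>. \<phi> \<in> A \<Longrightarrow> L \<phi> \<le> r" for r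
    unfolding S_def by (rule cSUP_least) (use zero that in auto)
  have S0: "0 \<le> S" using L_le[OF zero] by (simp add: L_def)
  obtain \<mu> where \<mu>: "\<mu> \<in> CE \<Omega> \<rho>0 \<rho>1" "action \<delta> \<Omega> \<mu> \<le> ennreal S"
    using dual_attained[OF assms(5-9), of S] L_le by (auto simp: A_def L_def)
  have weak: "ennreal S \<le> action \<delta> \<Omega> \<mu>'" if \<mu>': "\<mu>' \<in> CE \<Omega> \<rho>0 \<rho>1" for \<mu>'
  proof (cases "action \<delta> \<Omega> \<mu>'")
    case (real r)
    have "L \<phi> \<le> r" if "\<phi> \<in> A" for \<phi>
      using weak_duality[OF assms(5) \<mu>', of \<phi>] that real by (auto simp: A_def L_def)
    then show ?thesis unfolding real(2) by (intro ennreal_leI S_le)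
  qed simp
  have act: "action \<delta> \<Omega> \<mu> = ennreal S" by (rule antisym[OF \<mu>(2) weak[OF \<mu>(1)]])
  have INF: "(INF \<mu>'\<in>CE \<Omega> \<rho>0 \<rho>1. action \<delta> \<Omega> \<mu>') = ennreal S"
  proof (rule antisym)
    show "(INF \<mu>'\<in>CE \<Omega> \<rho>0 \<rho>1. action \<delta> \<Omega> \<mu>') \<le> ennreal S" using INF_lower[OF \<mu>(1), of "action \<delta> \<Omega>"] act by simp
  qed (intro INF_greatest weak)
  have J: "J \<delta> \<Omega> \<rho>0 \<rho>1 \<phi> = ereal (- L \<phi>)" if "\<phi> \<in> A" for \<phi>
    using J_admissible[of \<delta> \<phi> \<rho>0 \<rho>1] that by (simp add: A_def L_def)
  have "(INF \<phi>\<in>C1 \<Omega>. J \<delta> \<Omega> \<rho>0 \<rho>1 \<phi>) = ereal (- S)"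
  proof (rule antisym)
    have le: "(INF \<phi>\<in>C1 \<Omega>. J \<delta> \<Omega> \<rho>0 \<rho>1 \<phi>) \<le> ereal (- L \<phi>)" if "\<phi> \<in> A" for \<phi>
      using INF_lower[of \<phi> "C1 \<Omega>" "J \<delta> \<Omega> \<rho>0 \<rho>1"] J[OF that] that by (simp add: A_def)
    show "(INF \<phi>\<in>C1 \<Omega>. J \<delta> \<Omega> \<rho>0 \<rho>1 \<phi>) \<le> ereal (- S)"
    proof (cases "INF \<phi>\<in>C1 \<Omega>. J \<delta> \<Omega> \<rho>0 \<rho>1 \<phi>")
      case (real r)
      have "S \<le> - r" by (rule S_le) (use le real in force)
      then show ?thesis using real by simp
    next
      case PInf
      then show ?thesis using le[OF zero] by simp
    qed simp
    show "ereal (- S) \<le> (INF \<phi>\<in>C1 \<Omega>. J \<delta> \<Omega> \<rho>0 \<rho>1 \<phi>)"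
    proof (rule INF_greatest)
      fix \<phi> assume \<phi>: "\<phi> \<in> C1 \<Omega>"
      show "ereal (- S) \<le> J \<delta> \<Omega> \<rho>0 \<rho>1 \<phi>"
      proof (cases "admissible \<delta> \<phi>")
        case True
        then have "\<phi> \<in> A" using \<phi> by (simp add: A_def)
        then show ?thesis using J L_le by simp
      qed (simp add: J_not_admissible[OF \<phi>])
    qed
  qed
  then have "enn2ereal ((WF \<delta> \<Omega> \<rho>0 \<rho>1)\<^sup>2) = - (INF \<phi>\<in>C1 \<Omega>. J \<delta> \<Omega> \<rho>0 \<rho>1 \<phi>)"
    using S0 by (simp add: WF_def ennreal_sqrt_power2 INF enn2ereal_ennreal)
  moreover have "\<exists>\<mu>\<in>CE \<Omega> \<rho>0 \<rho>1. action \<delta> \<Omega> \<mu> = (INF \<mu>'\<in>CE \<Omega> \<rho>0 \<rho>1. action \<delta> \<Omega> \<mu>')"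
    using \<mu>(1) act INF by auto
  ultimately show ?thesis ..
qed

end
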